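(* Let $\mathcal{X}\subset\mathcal{C}(I,E)$ be a compact set of paths such that distinct elements of $\mathcal{X}$ are not tree-like equivalent, and let $\sigma>0$. The kernel $k:\mathcal{P}(\mathcal{X})\times\mathcal{P}(\mathcal{X})\to\mathbb{R}$ defined by $$k(\mu,\nu)=\exp\Big(-\sigma^2\big\|\mathbb{E}S(\mu)-\mathbb{E}S(\nu)\big\|_{\mathcal{T}(E)}^2\Big)$$ is universal, i.e. the associated reproducing kernel Hilbert space is dense (in the supremum norm) in the space of weakly continuous functions from $\mathcal{P}(\mathcal{X})$ to $\mathbb{R}$.
   Context: Let $I=[a,T]$ with $0\le a<T$, and let $E$ be a real separable Hilbert space of (finite or countably infinite) dimension $d$ with orthonormal basis $\{e_1,e_2,\ldots\}$ (for $d=\infty$, $\{1,\ldots,d\}$ means $\mathbb{N}$). Paths: $\mathcal{C}(I,E)$ is the Banach space of Lipschitz-continuous functions $x:I\to E$ with norm $\|x\|_{Lip}=\|x_a\|+\sup_{s\neq t\in I}\frac{\|x_t-x_s\|}{|t-s|}$. Compactness of $\mathcal{X}$ is with respect to $\|\cdot\|_{Lip}$. Tensor space: $E^{\otimes 0}=\mathbb{R}$, and $E^{\otimes k}$ is the Hilbert space with orthonormal basis $\{e_{i_1}\otimes\cdots\otimes e_{i_k}\}$. $\mathcal{T}(E)$ is the Hilbert space direct sum of the $E^{\otimes k}$, $k\ge 0$, with $\langle A,B\rangle_{\mathcal{T}(E)}=\sum_{k\ge0}\langle A_k,B_k\rangle_{E^{\otimes k}}$. Signature: $S:\mathcal{C}(I,E)\to\mathcal{T}(E)$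 has degree-zero coordinate $1$ and, for $(i_1,\ldots,i_k)\in\{1,\ldots,d\}^k$, $k\ge1$, $$S(x)^{(i_1,\ldots,i_k)}=\int\cdots\int_{a<u_1<\cdots<u_k<T}dx^{(i_1)}_{u_1}\cdots dx^{(i_k)}_{u_k}$$ (Riemann–Stieltjes integrals), where $x^{(i)}$ is the $i$-th coordinate of $x$. Tree-like equivalence: two paths $x,y\in\mathcal{C}(I,E)$ are tree-like equivalent if and only if $S(x)=S(y)$. Measures: $\mathcal{P}(\mathcal{X})$ is the set of Borel probability measures on $\mathcal{X}$, with the topology of weak convergence ($\mu_n\to\mu$ weakly if $\int f\,d\mu_n\to\int f\,d\mu$ for every continuous $f:\mathcal{X}\to\mathbb{R}$). "Weakly continuous" means continuous for this topology. Expected signature: $\mathbb{E}S:\mathcal{P}(\mathcal{X})\to\mathcal{T}(E)$ is defined coordinate-wise by $\mathbb{E}S(\mu)^{(i_1,\ldots,i_k)}=\int_{\mathcal{X}}S(x)^{(i_1,\ldots,i_k)}\mu(dx)$. *)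

theory Defs
  imports "HOL-Probability.Probability"
begin

section \<open>Orthonormal bases of separable Hilbert spaces\<close>

text \<open>The dimension is an extended natural number; for \<open>d = \<infinity>\<close> the index set is
  \<open>{1, 2, \<dots>}\<close>.  Values of \<open>e\<close> outside the index set are irrelevant.\<close>

definition index_set :: "enat \<Rightarrow> nat set" where
  "index_set d = {i. 1 \<le> i \<and> enat i \<le> d}"

definition orthonormal_basis :: "enat \<Rightarrow> (nat \<Rightarrow> 'e::real_inner) \<Rightarrow> bool" where
  "orthonormal_basis d e \<longleftrightarrow>
     (\<forall>i\<in>index_set d. \<forall>j\<in>index_set d. e i \<bullet> e j = (if i = j then 1 else 0)) \<and>
     closure (span (e ` index_set d)) = UNIV"


section \<open>Lipschitz paths\<close>

text \<open>A path on \<open>[a,T]\<close> is an extensional function, so that equality of paths is equality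
  on \<open>[a,T]\<close>.\<close>

definition lip_paths :: "real \<Rightarrow> real \<Rightarrow> (real \<Rightarrow> 'e::real_normed_vector) set" where
  "lip_paths a T = {x \<in> extensional {a..T}. \<exists>L. L-lipschitz_on {a..T} x}"

definition lip_norm :: "real \<Rightarrow> real \<Rightarrow> (real \<Rightarrow> 'e::real_normed_vector) \<Rightarrow> real" where
  "lip_norm a T x = norm (x a) +
     (SUP (s, t) \<in> {(s, t). s \<in> {a..T} \<and> t \<in> {a..T} \<and> s \<noteq> t}. norm (x t - x s) / \<bar>t - s\<bar>)"

text \<open>The value \<open>0\<close> off the carrier is a dummy: the locale \<open>Metric_space\<close> asks for a distance
  that is nonnegative and symmetric on the whole type.\<close>

definition lip_dist :: "real \<Rightarrow> real \<Rightarrow> (real \<Rightarrow> 'e::real_normed_vector) \<Rightarrow> (real \<Rightarrow> 'e) \<Rightarrow> real" where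
  "lip_dist a T x y =
     (if x \<in> lip_paths a T \<and> y \<in> lip_paths a T then lip_norm a T (\<lambda>t. x t - y t) else 0)"

definition path_topology :: "real \<Rightarrow> real \<Rightarrow> (real \<Rightarrow> 'e::real_normed_vector) topology" where
  "path_topology a T = Metric_space.mtopology (lip_paths a T) (lip_dist a T)"

lemma Metric_space_lip_paths:
  fixes a T :: real
  assumes "a < T"
  shows "Metric_space (lip_paths a T :: (real \<Rightarrow> 'e::real_normed_vector) set) (lip_dist a T)"
proof -
  let ?P = "{(s, t). s \<in> {a..T} \<and> t \<in> {a..T} \<and> s \<noteq> t}"
  let ?q = "\<lambda>(x :: real \<Rightarrow> 'e) (s, t). norm (x t - x s) / \<bar>t - s\<bar>"
  have ne: "(a, T) \<in> ?P"
    using assms by auto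
  have bdd: "bdd_above (?q (\<lambda>t. x t - y t) ` ?P)"
    if xy: "x \<in> lip_paths a T" "y \<in> lip_paths a T" for x y :: "real \<Rightarrow> 'e"
  proof -
    from xy obtain L M where L: "L-lipschitz_on {a..T} x" and M: "M-lipschitz_on {a..T} y"
      by (auto simp: lip_paths_def)
    have "?q (\<lambda>t. x t - y t) p \<le> L + M" if "p \<in> ?P" for p
    proof -
      obtain s t where p: "p = (s, t)" by (cases p)
      with that have st: "s \<in> {a..T}" "t \<in> {a..T}" "s \<noteq> t" by auto
      have "norm ((x t - y t) - (x s - y s)) \<le> norm (x t - x s) + norm (y t - y s)"
        using norm_triangle_ineq4[of "x t - x s" "y t - y s"] by (simp add: algebra_simps)
      also have "\<dots> \<le> L * \<bar>t - s\<bar> + M * \<bar>t - s\<bar>"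
        using lipschitz_onD[OF L st(2,1)] lipschitz_onD[OF M st(2,1)]
        by (simp add: dist_norm)
      finally show ?thesis
        using st by (simp add: p divide_simps algebra_simps)
    qed
    then show ?thesis by (auto intro!: bdd_aboveI2)
  qed
  have upper: "?q (\<lambda>t. x t - y t) p \<le> (SUP p\<in>?P. ?q (\<lambda>t. x t - y t) p)"
    if "x \<in> lip_paths a T" "y \<in> lip_paths a T" "p \<in> ?P" for x y :: "real \<Rightarrow> 'e" and p
    using cSUP_upper[OF that(3) bdd[OF that(1,2)]] .
  have sup0: "0 \<le> (SUP p\<in>?P. ?q (\<lambda>t. x t - y t) p)"
    if "x \<in> lip_paths a T" "y \<in> lip_paths a T" for x y :: "real \<Rightarrow> 'e"
  proof -
    have "0 \<le> ?q (\<lambda>t. x t - y t) (a, T)" by simp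
    also have "\<dots> \<le> (SUP p\<in>?P. ?q (\<lambda>t. x t - y t) p)"
      by (rule upper[OF that ne])
    finally show ?thesis .
  qed
  show ?thesis
  proof
    fix x y :: "real \<Rightarrow> 'e"
    show "0 \<le> lip_dist a T x y"
      using sup0 by (auto simp: lip_dist_def lip_norm_def)
    have "norm (x t - y t - (x s - y s)) = norm (y t - x t - (y s - x s))" for s t
      by (metis (no_types, opaque_lifting) minus_diff_eq norm_minus_commute minus_diff_minus)
    then show "lip_dist a T x y = lip_dist a T y x"
      by (simp add: lip_dist_def lip_norm_def norm_minus_commute[of "x a"] cong: conj_cong)
  next
    fix x y :: "real \<Rightarrow> 'e"
    assume xy: "x \<in> lip_paths a T" "y \<in> lip_paths a T"
    show "lip_dist a T x y = 0 \<longleftrightarrow> x = y"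
    proof
      assume "lip_dist a T x y = 0"
      then have z: "norm (x a - y a) = 0" "(SUP p\<in>?P. ?q (\<lambda>t. x t - y t) p) = 0"
        using xy sup0[OF xy] norm_ge_zero[of "x a - y a"]
        by (simp_all add: lip_dist_def lip_norm_def add_nonneg_eq_0_iff)
      have "x t = y t" for t
      proof (cases "t \<in> {a..T}")
        case True
        show ?thesis
        proof (cases "t = a")
          case False
          then have "?q (\<lambda>t. x t - y t) (a, t) \<le> 0"
            using upper[OF xy, of "(a, t)"] z(2) True assms by auto
          then show ?thesis using z(1) False by (simp add: divide_le_0_iff)
        qed (use z in simp)
      next
        case False
        then show ?thesis using xy by (simp add: lip_paths_def extensional_def)
      qed
      then show "x = y" by blast
    next
      assume "x = y"
      moreover have "(SUP p\<in>?P. (0::real)) = 0"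
        using ne by (intro cSUP_const) blast
      ultimately show "lip_dist a T x y = 0"
        using xy by (simp add: lip_dist_def lip_norm_def case_prod_unfold)
    qed
  next
    fix x y z :: "real \<Rightarrow> 'e"
    assume xyz: "x \<in> lip_paths a T" "y \<in> lip_paths a T" "z \<in> lip_paths a T"
    have "(SUP p\<in>?P. ?q (\<lambda>t. x t - z t) p) \<le>
        (SUP p\<in>?P. ?q (\<lambda>t. x t - y t) p) + (SUP p\<in>?P. ?q (\<lambda>t. y t - z t) p)"
    proof (rule cSUP_least)
      fix p assume p: "p \<in> ?P"
      obtain s t where st: "p = (s, t)" by (cases p)
      have "norm ((x t - z t) - (x s - z s)) \<le>
          norm ((x t - y t) - (x s - y s)) + norm ((y t - z t) - (y s - z s))"
        using norm_triangle_ineq[of "(x t - y t) - (x s - y s)" "(y t - z t) - (y s - z s)"]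
        by (simp add: algebra_simps)
      then have "?q (\<lambda>t. x t - z t) p \<le> ?q (\<lambda>t. x t - y t) p + ?q (\<lambda>t. y t - z t) p"
        by (simp add: st divide_right_mono flip: add_divide_distrib)
      then show "?q (\<lambda>t. x t - z t) p \<le>
          (SUP p\<in>?P. ?q (\<lambda>t. x t - y t) p) + (SUP p\<in>?P. ?q (\<lambda>t. y t - z t) p)"
        using upper[OF xyz(1,2) p] upper[OF xyz(2,3) p] by linarith
    qed (use ne in blast)
    then show "lip_dist a T x z \<le> lip_dist a T x y + lip_dist a T y z"
      using xyz norm_triangle_ineq[of "x a - y a" "y a - z a"]
      by (simp add: lip_dist_def lip_norm_def)
  qed
qed


section \<open>Signatures\<close>

text \<open>Riemann--Stieltjes integral \<open>\<integral>\<^sub>s\<^sup>t f dg\<close>: limit of the sums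
  \<open>\<Sum> f(\<xi>\<^sub>j) (g(t\<^sub>j) - g(t\<^sub>j\<^sub>-\<^sub>1))\<close> as the mesh tends to zero.  Since a tag lies in its
  interval, being fine for balls of a constant radius is a bound on the mesh.\<close>

definition has_RS_integral ::
    "(real \<Rightarrow> real) \<Rightarrow> (real \<Rightarrow> real) \<Rightarrow> real \<Rightarrow> real \<Rightarrow> real \<Rightarrow> bool" where
  "has_RS_integral f g s t I \<longleftrightarrow>
     (\<forall>\<epsilon>>0. \<exists>\<delta>>0. \<forall>p. p tagged_division_of {s..t} \<and> (\<lambda>\<xi>. ball \<xi> \<delta>) fine p \<longrightarrow>
        \<bar>(\<Sum>(\<xi>, K)\<in>p. f \<xi> * (g (Sup K) - g (Inf K))) - I\<bar> < \<epsilon>)"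

definition RS_integral :: "(real \<Rightarrow> real) \<Rightarrow> (real \<Rightarrow> real) \<Rightarrow> real \<Rightarrow> real \<Rightarrow> real" where
  "RS_integral f g s t = (THE I. has_RS_integral f g s t I)"

lemma has_RS_integral_unique:
  assumes I: "has_RS_integral f g s t I" and J: "has_RS_integral f g s t J"
  shows "I = J"
proof (rule ccontr)
  assume "I \<noteq> J"
  then have pos: "\<bar>I - J\<bar> / 2 > 0" by simp
  let ?S = "\<lambda>p. \<Sum>(\<xi>, K)\<in>p. f \<xi> * (g (Sup K) - g (Inf K))"
  obtain \<delta>1 where d1: "\<delta>1 > 0"
    "\<And>p. p tagged_division_of {s..t} \<Longrightarrow> (\<lambda>\<xi>. ball \<xi> \<delta>1) fine p \<Longrightarrow> \<bar>?S p - I\<bar> < \<bar>I - J\<bar> / 2"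
    using I pos unfolding has_RS_integral_def by meson
  obtain \<delta>2 where d2: "\<delta>2 > 0"
    "\<And>p. p tagged_division_of {s..t} \<Longrightarrow> (\<lambda>\<xi>. ball \<xi> \<delta>2) fine p \<Longrightarrow> \<bar>?S p - J\<bar> < \<bar>I - J\<bar> / 2"
    using J pos unfolding has_RS_integral_def by meson
  have "gauge (\<lambda>\<xi>::real. ball \<xi> (min \<delta>1 \<delta>2))"
    using d1(1) d2(1) by (intro gauge_ball) simp
  then obtain p where p: "p tagged_division_of {s..t}" "(\<lambda>\<xi>. ball \<xi> (min \<delta>1 \<delta>2)) fine p"
    by (rule fine_division_exists_real)
  have fine: "(\<lambda>\<xi>. ball \<xi> \<delta>1) fine p" "(\<lambda>\<xi>. ball \<xi> \<delta>2) fine p"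
    using p(2) by (fastforce simp: fine_def)+
  from d1(2)[OF p(1) fine(1)] d2(2)[OF p(1) fine(2)]
  have "\<bar>?S p - J\<bar> + \<bar>?S p - I\<bar> < \<bar>I - J\<bar>"
    by argo
  moreover have "\<bar>I - J\<bar> \<le> \<bar>?S p - J\<bar> + \<bar>?S p - I\<bar>"
    using abs_triangle_ineq4[of "?S p - J" "?S p - I"] by simp
  ultimately show False by simp
qed

lemma RS_integral_eqI: "has_RS_integral f g s t I \<Longrightarrow> RS_integral f g s t = I"
  unfolding RS_integral_def using has_RS_integral_unique by blast

text \<open>\<open>iterated_integral a X [i\<^sub>k, \<dots>, i\<^sub>1] t\<close> is the integral of
  \<open>dX\<^sub>i\<^sub>1(u\<^sub>1) \<dots> dX\<^sub>i\<^sub>k(u\<^sub>k)\<close> over \<open>a < u\<^sub>1 < \<dots> < u\<^sub>k < t\<close>; the outermost variable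
  \<open>u\<^sub>k\<close> comes first in the list, whence the reversal in \<open>signature\<close>.\<close>

primrec iterated_integral :: "real \<Rightarrow> (nat \<Rightarrow> real \<Rightarrow> real) \<Rightarrow> nat list \<Rightarrow> real \<Rightarrow> real" where
  "iterated_integral a X [] t = 1"
| "iterated_integral a X (i # w) t = RS_integral (iterated_integral a X w) (X i) a t"

text \<open>Multi-indices \<open>(i\<^sub>1, \<dots>, i\<^sub>k)\<close> of all lengths \<open>k \<ge> 0\<close>.  An element of the tensor space is
  represented by its coordinates with respect to the orthonormal basis
  \<open>e\<^sub>i\<^sub>1 \<otimes> \<dots> \<otimes> e\<^sub>i\<^sub>k\<close>: a real function on words, zero at lists that are not words.\<close>

definition words :: "enat \<Rightarrow> nat list set" where
  "words d = lists (index_set d)"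

definition tensor_inner :: "enat \<Rightarrow> (nat list \<Rightarrow> real) \<Rightarrow> (nat list \<Rightarrow> real) \<Rightarrow> real" where
  "tensor_inner d A B = (\<Sum>k. \<Sum>\<^sub>\<infinity>w\<in>{w \<in> words d. length w = k}. A w * B w)"

definition tensor_norm :: "enat \<Rightarrow> (nat list \<Rightarrow> real) \<Rightarrow> real" where
  "tensor_norm d A = sqrt (tensor_inner d A A)"

definition signature ::
    "real \<Rightarrow> real \<Rightarrow> enat \<Rightarrow> (nat \<Rightarrow> 'e::real_inner) \<Rightarrow> (real \<Rightarrow> 'e) \<Rightarrow> nat list \<Rightarrow> real" where
  "signature a T d e x w =
     (if w \<in> words d then iterated_integral a (\<lambda>i u. x u \<bullet> e i) (rev w) T else 0)"

definition tree_like_equivalent ::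
    "real \<Rightarrow> real \<Rightarrow> enat \<Rightarrow> (nat \<Rightarrow> 'e::real_inner) \<Rightarrow> (real \<Rightarrow> 'e) \<Rightarrow> (real \<Rightarrow> 'e) \<Rightarrow> bool" where
  "tree_like_equivalent a T d e x y \<longleftrightarrow> signature a T d e x = signature a T d e y"

definition expected_signature ::
    "real \<Rightarrow> real \<Rightarrow> enat \<Rightarrow> (nat \<Rightarrow> 'e::real_inner) \<Rightarrow> (real \<Rightarrow> 'e) measure \<Rightarrow> nat list \<Rightarrow> real" where
  "expected_signature a T d e \<mu> w =
     (if w \<in> words d then \<integral>x. signature a T d e x w \<partial>\<mu> else 0)"


section \<open>Borel probability measures and weak convergence\<close>

definition borel_probs :: "'a topology \<Rightarrow> 'a measure set" where
  "borel_probs X = {\<mu>. prob_space \<mu> \<and> space \<mu> = topspace X \<and>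
     sets \<mu> = sigma_sets (topspace X) {U. openin X U}}"

text \<open>The coarsest topology making \<open>\<mu> \<mapsto> \<integral> f d\<mu>\<close> continuous for every continuous \<open>f\<close>.  For
  non-compact \<open>X\<close> one would restrict to bounded \<open>f\<close>.\<close>

definition weak_topology :: "'a topology \<Rightarrow> 'a measure topology" where
  "weak_topology X = topology_generated_by
     {{\<mu> \<in> borel_probs X. (\<integral>x. f x \<partial>\<mu>) \<in> U} | f U. continuous_map X euclideanreal f \<and> open U}"

lemma topspace_weak_topology [simp]: "topspace (weak_topology X) = borel_probs X"
proof -
  have "continuous_map X euclideanreal (\<lambda>x. 0) \<and> open (UNIV :: real set)"
    by simp
  then have "borel_probs X \<in> {{\<mu> \<in> borel_probs X. (\<integral>x. f x \<partial>\<mu>) \<in> U} | f U.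
      continuous_map X euclideanreal f \<and> open U}"
    by blast
  then show ?thesis
    unfolding weak_topology_def topology_generated_by_topspace by blast
qed

lemma limitin_weak_topology:
  "limitin (weak_topology X) \<mu> \<nu> F \<longleftrightarrow>
     \<nu> \<in> borel_probs X \<and> (\<forall>\<^sub>F n in F. \<mu> n \<in> borel_probs X) \<and>
     (\<forall>f. continuous_map X euclideanreal f \<longrightarrow> ((\<lambda>n. \<integral>x. f x \<partial>\<mu> n) \<longlongrightarrow> (\<integral>x. f x \<partial>\<nu>)) F)"
  (is "?L \<longleftrightarrow> ?R")
proof
  assume L: ?L
  have ev: "\<forall>\<^sub>F n in F. \<mu> n \<in> borel_probs X \<and> (\<integral>x. f x \<partial>\<mu> n) \<in> U"
    if "continuous_map X euclideanreal f" "open U" "(\<integral>x. f x \<partial>\<nu>) \<in> U" for f U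
  proof -
    have "openin (weak_topology X) {\<mu> \<in> borel_probs X. (\<integral>x. f x \<partial>\<mu>) \<in> U}"
      unfolding weak_topology_def using that by (intro topology_generated_by_Basis) blast
    then show ?thesis using L that(3) by (auto simp: limitin_def)
  qed
  have "\<forall>\<^sub>F n in F. \<mu> n \<in> borel_probs X"
    using ev[of "\<lambda>x. 0" UNIV] by simp
  moreover have "((\<lambda>n. \<integral>x. f x \<partial>\<mu> n) \<longlongrightarrow> (\<integral>x. f x \<partial>\<nu>)) F"
    if "continuous_map X euclideanreal f" for f
  proof (rule topological_tendstoI)
    fix U :: "real set" assume "open U" "(\<integral>x. f x \<partial>\<nu>) \<in> U"
    from ev[OF that this] show "\<forall>\<^sub>F n in F. (\<integral>x. f x \<partial>\<mu> n) \<in> U"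
      by (rule eventually_mono) simp
  qed
  ultimately show ?R using L by (auto simp: limitin_def)
next
  assume R: ?R
  have "\<forall>\<^sub>F n in F. \<mu> n \<in> U"
    if "generate_topology_on {{\<mu> \<in> borel_probs X. (\<integral>x. f x \<partial>\<mu>) \<in> U} | f U.
         continuous_map X euclideanreal f \<and> open U} U" "\<nu> \<in> U" for U
    using that
  proof (induction rule: generate_topology_on.induct)
    case (Basis s)
    then obtain f V where s: "s = {\<mu> \<in> borel_probs X. (\<integral>x. f x \<partial>\<mu>) \<in> V}"
      and f: "continuous_map X euclideanreal f" and V: "open V" by blast
    have "\<forall>\<^sub>F n in F. (\<integral>x. f x \<partial>\<mu> n) \<in> V"
      using R f V Basis.prems s by (blast dest: topological_tendstoD)
    then show ?case using R unfolding s by (auto elim: eventually_elim2)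
  next
    case (UN K)
    then obtain k where "k \<in> K" "\<nu> \<in> k" by blast
    then show ?case using UN.IH[of k] by (auto elim: eventually_mono)
  qed (auto elim: eventually_elim2)
  then show ?L
    using R by (auto simp: limitin_def) (simp add: weak_topology_def openin_topology_generated_by_iff)
qed


section \<open>Reproducing kernel Hilbert spaces and universality\<close>

text \<open>A Hilbert space \<open>H\<close> of real functions on \<open>P\<close>, with pointwise operations and inner product
  \<open>ip\<close>, whose reproducing kernel is \<open>k\<close>.\<close>

locale rkhs =
  fixes P :: "'p set" and k :: "'p \<Rightarrow> 'p \<Rightarrow> real"
    and H :: "('p \<Rightarrow> real) set" and ip :: "('p \<Rightarrow> real) \<Rightarrow> ('p \<Rightarrow> real) \<Rightarrow> real"
  assumes extensional: "H \<subseteq> extensional P"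
    and zero: "(\<lambda>x\<in>P. 0) \<in> H"
    and add: "\<lbrakk>f \<in> H; g \<in> H\<rbrakk> \<Longrightarrow> (\<lambda>x\<in>P. f x + g x) \<in> H"
    and scale: "f \<in> H \<Longrightarrow> (\<lambda>x\<in>P. c * f x) \<in> H"
    and ip_commute: "\<lbrakk>f \<in> H; g \<in> H\<rbrakk> \<Longrightarrow> ip f g = ip g f"
    and ip_add: "\<lbrakk>f \<in> H; g \<in> H; h \<in> H\<rbrakk> \<Longrightarrow> ip (\<lambda>x\<in>P. f x + g x) h = ip f h + ip g h"
    and ip_scale: "\<lbrakk>f \<in> H; g \<in> H\<rbrakk> \<Longrightarrow> ip (\<lambda>x\<in>P. c * f x) g = c * ip f g"
    and ip_nonneg: "f \<in> H \<Longrightarrow> 0 \<le> ip f f"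
    and ip_eq_0: "\<lbrakk>f \<in> H; ip f f = 0\<rbrakk> \<Longrightarrow> f = (\<lambda>x\<in>P. 0)"
    and complete: "\<lbrakk>\<And>n. F n \<in> H;
        \<forall>\<epsilon>>0. \<exists>N. \<forall>m\<ge>N. \<forall>n\<ge>N. sqrt (ip (\<lambda>x\<in>P. F m x - F n x) (\<lambda>x\<in>P. F m x - F n x)) < \<epsilon>\<rbrakk>
      \<Longrightarrow> \<exists>f\<in>H. (\<lambda>n. sqrt (ip (\<lambda>x\<in>P. F n x - f x) (\<lambda>x\<in>P. F n x - f x))) \<longlonglongrightarrow> 0"
    and kernel_mem: "x \<in> P \<Longrightarrow> (\<lambda>y\<in>P. k y x) \<in> H"
    and reproducing: "\<lbrakk>f \<in> H; x \<in> P\<rbrakk> \<Longrightarrow> f x = ip f (\<lambda>y\<in>P. k y x)"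

definition sup_dense_in_continuous :: "'p topology \<Rightarrow> ('p \<Rightarrow> real) set \<Rightarrow> bool" where
  "sup_dense_in_continuous X H \<longleftrightarrow>
     (\<forall>h\<in>H. continuous_map X euclideanreal h) \<and>
     (\<forall>f. continuous_map X euclideanreal f \<longrightarrow>
        (\<forall>\<epsilon>>0. \<exists>h\<in>H. \<forall>x\<in>topspace X. \<bar>f x - h x\<bar> \<le> \<epsilon>))"

text \<open>By the Moore--Aronszajn theorem a kernel has at most one reproducing kernel Hilbert space,
  and it has one iff it is symmetric and positive semidefinite.  Here existence is part of
  universality, and density is asked of every space satisfying \<open>rkhs\<close>.\<close>

definition universal_kernel :: "'p topology \<Rightarrow> ('p \<Rightarrow> 'p \<Rightarrow> real) \<Rightarrow> bool" where
  "universal_kernel X k \<longleftrightarrow>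
     (\<exists>H ip. rkhs (topspace X) k H ip) \<and>
     (\<forall>H ip. rkhs (topspace X) k H ip \<longrightarrow> sup_dense_in_continuous X H)"

end

theory Submission
  imports Defs
begin

text \<open>
  Write \<open>\<Phi>(\<mu>) = ES(\<mu>)\<close>, an element of the Hilbert space of square-summable families of coordinates.
  The signature is a Lipschitz map on bounded sets of Lipschitz paths, so the signatures of the paths
  in \<open>X\<close> form a compact set, whose coordinates have uniformly small tails; hence \<open>\<Phi>\<close> is
  weakly continuous.  By the shuffle identity the span of the signature coordinates is an algebra,
  which is dense in the continuous functions on \<open>X\<close> by Stone--Weierstrass, so \<open>\<Phi>(\<mu>)\<close>
  determines all integrals of continuous functions.  The space of probability measures is
  sequentially compact, so each weakly continuous function is \<open>g \<circ> \<Phi>\<close> with \<open>g\<close>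
  continuous on a compact subset of the Hilbert space.  It remains to see that the Gaussian kernel
  is universal on compact subsets of a Hilbert space: with the feature map whose coordinates are
  \<open>exp (- \<sigma>\<^sup>2 |y|\<^sup>2)\<close> times the scaled monomials in the coordinates of \<open>y\<close>, this
  is again Stone--Weierstrass.
\<close>

section \<open>Square-summable families\<close>

text \<open>Three obstacles shape the proof. The iterated integrals are definite descriptions with
  integrators that need not be differentiable, so each of them is first shown to exist; all
  estimates are then made on increments, in the form of \<open>RS_primitive\<close>, where a product
  rule and a growth bound replace differentiation. Norms of infinite families are controlled through
  finite sets of words with \<open>L2_set\<close>, and the factorial decay of the levels makes these
  bounds summable. Finally, weak compactness enters in sequential form only: a set of measures
  closed under weak limits of sequences has a compact image under \<open>mean S\<close>. This makes
  \<open>g\<close> continuous although neither metrizability nor the Hausdorff property of the weak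
  topology is established. Since universality quantifies over every Hilbert space with the given
  kernel, the approximants are finite combinations of kernel sections, which lie in all of these
  spaces.\<close>

lemma summable_on_mult_of_squares:
  fixes f g :: "'i \<Rightarrow> real"
  assumes "(\<lambda>i. (f i)\<^sup>2) summable_on A" "(\<lambda>i. (g i)\<^sup>2) summable_on A"
  shows "(\<lambda>i. f i * g i) summable_on A"
proof -
  have "(\<lambda>i. norm ((f i)\<^sup>2 + (g i)\<^sup>2)) summable_on A"
    using summable_on_add[OF assms] by simp
  then have "(\<lambda>i. norm (f i * g i)) summable_on A"
  proof (rule Infinite_Sum.abs_summable_on_comparison_test)
    fix i
    show "norm (f i * g i) \<le> norm ((f i)\<^sup>2 + (g i)\<^sup>2)"
    proof -
      have "2 * \<bar>f i * g i\<bar> \<le> (f i)\<^sup>2 + (g i)\<^sup>2"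
        using sum_squares_bound[of "\<bar>f i\<bar>" "\<bar>g i\<bar>"] by (simp add: abs_mult mult.assoc)
      then show ?thesis using abs_ge_zero[of "f i * g i"] unfolding real_norm_def by linarith
    qed
  qed
  then show ?thesis by (rule abs_summable_summable)
qed

lemma summable_on_squares_add:
  fixes f g :: "'i \<Rightarrow> real"
  assumes "(\<lambda>i. (f i)\<^sup>2) summable_on A" "(\<lambda>i. (g i)\<^sup>2) summable_on A"
  shows "(\<lambda>i. (f i + g i)\<^sup>2) summable_on A"
proof -
  have "(\<lambda>i. (f i)\<^sup>2 + (g i)\<^sup>2 + 2 * (f i * g i)) summable_on A"
    by (intro summable_on_add summable_on_cmult_right summable_on_mult_of_squares assms)
  then show ?thesis by (simp add: power2_sum mult.assoc)
qed

text \<open>One Hilbert space in two roles: over words it holds signatures and their means, over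
  lists of words it holds the features of the Gaussian kernel. As a type it takes part in the
  type-class topology of compactness and Stone-Weierstrass.\<close>

typedef 'i ell2 = "{f :: 'i \<Rightarrow> real. (\<lambda>i. (f i)\<^sup>2) summable_on UNIV}"
  morphisms coord Ell2
proof
  show "(\<lambda>_. 0) \<in> {f :: 'i \<Rightarrow> real. (\<lambda>i. (f i)\<^sup>2) summable_on UNIV}"
    by simp
qed

setup_lifting type_definition_ell2

lemma ell2_eq_iff: "x = y \<longleftrightarrow> (\<forall>i. coord x i = coord y i)"
  by (simp add: coord_inject[symmetric] fun_eq_iff)

lemma summable_coord_sq: "(\<lambda>i. (coord x i)\<^sup>2) summable_on A"
  using coord[of x] by (auto intro: summable_on_subset_banach)

lemma summable_coord_mult: "(\<lambda>i. coord x i * coord y i) summable_on A"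
  by (intro summable_on_mult_of_squares summable_coord_sq)

instantiation ell2 :: (type) real_vector
begin

lift_definition zero_ell2 :: "'a ell2" is "\<lambda>_. 0" by simp
lift_definition plus_ell2 :: "'a ell2 \<Rightarrow> 'a ell2 \<Rightarrow> 'a ell2" is "\<lambda>f g i. f i + g i"
  by (rule summable_on_squares_add)
lift_definition scaleR_ell2 :: "real \<Rightarrow> 'a ell2 \<Rightarrow> 'a ell2" is "\<lambda>c f i. c * f i"
  by (simp add: power_mult_distrib summable_on_cmult_right)
lift_definition uminus_ell2 :: "'a ell2 \<Rightarrow> 'a ell2" is "\<lambda>f i. - f i" by simp
definition minus_ell2 :: "'a ell2 \<Rightarrow> 'a ell2 \<Rightarrow> 'a ell2" where "minus_ell2 x y = x + - y"

instance
proof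
  fix x y z :: "'a ell2" and r s :: real
  note reps = ell2_eq_iff zero_ell2.rep_eq plus_ell2.rep_eq scaleR_ell2.rep_eq uminus_ell2.rep_eq
  show "x + y + z = x + (y + z)" by (simp add: reps add.assoc)
  show "x + y = y + x" by (simp add: reps add.commute)
  show "0 + x = x" by (simp add: reps)
  show "- x + x = 0" by (simp add: reps)
  show "x - y = x + - y" by (rule minus_ell2_def)
  show "r *\<^sub>R (x + y) = r *\<^sub>R x + r *\<^sub>R y" by (simp add: reps distrib_left)
  show "(r + s) *\<^sub>R x = r *\<^sub>R x + s *\<^sub>R x" by (simp add: reps distrib_right)
  show "r *\<^sub>R s *\<^sub>R x = (r * s) *\<^sub>R x" by (simp add: reps)
  show "1 *\<^sub>R x = x" by (simp add: reps)
qed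

end

lemmas coord_simps [simp] =
  zero_ell2.rep_eq plus_ell2.rep_eq scaleR_ell2.rep_eq uminus_ell2.rep_eq

lemma coord_diff [simp]: "coord (x - y) = (\<lambda>i. coord x i - coord y i)"
  unfolding minus_ell2_def plus_ell2.rep_eq uminus_ell2.rep_eq by simp

instantiation ell2 :: (type) real_inner
begin

definition inner_ell2 :: "'a ell2 \<Rightarrow> 'a ell2 \<Rightarrow> real" where
  "inner_ell2 x y = (\<Sum>\<^sub>\<infinity>i. coord x i * coord y i)"
definition norm_ell2 :: "'a ell2 \<Rightarrow> real" where "norm_ell2 x = sqrt (inner x x)"
definition sgn_ell2 :: "'a ell2 \<Rightarrow> 'a ell2" where "sgn_ell2 x = x /\<^sub>R norm x"
definition dist_ell2 :: "'a ell2 \<Rightarrow> 'a ell2 \<Rightarrow> real" where "dist_ell2 x y = norm (x - y)"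
definition uniformity_ell2 :: "('a ell2 \<times> 'a ell2) filter" where
  "uniformity_ell2 = (INF e\<in>{0<..}. principal {(x, y). dist x y < e})"
definition open_ell2 :: "'a ell2 set \<Rightarrow> bool" where
  "open_ell2 U = (\<forall>x\<in>U. eventually (\<lambda>(x', y). x' = x \<longrightarrow> y \<in> U) uniformity)"

instance
proof
  fix x y z :: "'a ell2" and r s :: real
  show "dist x y = norm (x - y)" by (simp add: dist_ell2_def)
  show "sgn x = x /\<^sub>R norm x" by (simp add: sgn_ell2_def)
  show "uniformity = (INF e\<in>{0<..}. principal {(x :: 'a ell2, y). dist x y < e})"
    by (simp add: uniformity_ell2_def)
  show "open U = (\<forall>x\<in>U. eventually (\<lambda>(x', y). x' = x \<longrightarrow> y \<in> U) uniformity)"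
    for U :: "'a ell2 set" by (simp add: open_ell2_def)
  show "norm x = sqrt (inner x x)" by (simp add: norm_ell2_def)
  show "inner x y = inner y x" by (simp add: inner_ell2_def mult.commute)
  show "inner (x + y) z = inner x z + inner y z"
    unfolding inner_ell2_def plus_ell2.rep_eq distrib_right
    by (intro infsum_add summable_coord_mult)
  show "inner (scaleR r x) y = r * inner x y"
    unfolding inner_ell2_def scaleR_ell2.rep_eq mult.assoc
    by (rule infsum_cmult_right) (simp add: summable_coord_mult)
  show "0 \<le> inner x x" by (simp add: inner_ell2_def infsum_nonneg)
  show "inner x x = 0 \<longleftrightarrow> x = 0"
  proof
    assume "inner x x = 0"
    then have "coord x i * coord x i = 0" for i
      unfolding inner_ell2_def
      by (intro nonneg_infsum_le_0D[of _ UNIV]) (auto intro: summable_coord_mult)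
    then show "x = 0" by (simp add: ell2_eq_iff)
  qed (simp add: inner_ell2_def zero_ell2.rep_eq)
qed

end

lemma norm_ell2_sq: "(norm x)\<^sup>2 = (\<Sum>\<^sub>\<infinity>i. (coord x i)\<^sup>2)"
  by (simp add: power2_norm_eq_inner) (simp add: inner_ell2_def power2_eq_square)

lemma sum_coord_sq_le: "finite F \<Longrightarrow> (\<Sum>i\<in>F. (coord x i)\<^sup>2) \<le> (norm x)\<^sup>2"
  unfolding norm_ell2_sq by (intro finite_sum_le_infsum summable_coord_sq) auto

lemma L2_set_coord_le: "finite F \<Longrightarrow> L2_set (coord x) F \<le> norm x"
  unfolding L2_set_def by (intro real_le_lsqrt sum_coord_sq_le) auto

lemma abs_coord_le: "\<bar>coord x i\<bar> \<le> norm x"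
  using L2_set_coord_le[of "{i}" x] by (simp add: L2_set_def)

text \<open>The way in which every norm bound is obtained: a bound on all finite sections, uniform
  in the section.\<close>

lemma norm_ell2_leI:
  assumes "\<And>F. finite F \<Longrightarrow> L2_set (coord x) F \<le> B"
  shows "norm x \<le> B"
proof -
  have B: "0 \<le> B" using assms[of "{}"] by simp
  have "(norm x)\<^sup>2 \<le> B\<^sup>2"
    unfolding norm_ell2_sq
  proof (rule infsum_le_finite_sums)
    fix F :: "'a set" assume "finite F"
    then have "sqrt (\<Sum>i\<in>F. (coord x i)\<^sup>2) \<le> B" using assms[of F] by (simp add: L2_set_def)
    then have "(sqrt (\<Sum>i\<in>F. (coord x i)\<^sup>2))\<^sup>2 \<le> B\<^sup>2" by (intro power_mono) (auto intro: sum_nonneg)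
    then show "(\<Sum>i\<in>F. (coord x i)\<^sup>2) \<le> B\<^sup>2" by (simp add: sum_nonneg)
  qed (rule summable_coord_sq)
  then show ?thesis by (rule power2_le_imp_le[OF _ B])
qed

lemma bounded_linear_coord: "bounded_linear (\<lambda>x. coord x i)"
  by (rule bounded_linear_intro[of _ 1]) (auto simp: abs_coord_le)

lemmas continuous_on_coord [continuous_intros] =
  bounded_linear.continuous_on[OF bounded_linear_coord]

text \<open>\<open>Ell2\<close> says nothing about a family that is not square-summable. A bound on
  the finite sections is the usual certificate, for signatures and for their means.\<close>

lemma coord_Ell2_finite_bound:
  assumes "\<And>F. finite F \<Longrightarrow> L2_set f F \<le> B"
  shows "coord (Ell2 f) = f"
proof -
  have "(\<Sum>i\<in>F. (f i)\<^sup>2) \<le> B\<^sup>2" if "finite F" for F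
  proof -
    have "(L2_set f F)\<^sup>2 \<le> B\<^sup>2" using assms[OF that] by (intro power_mono) auto
    then show ?thesis by (simp add: L2_set_def sum_nonneg)
  qed
  then have "(\<lambda>i. (f i)\<^sup>2) summable_on UNIV"
    by (intro nonneg_bounded_partial_sums_imp_summable_on[of _ _ "B\<^sup>2"])
      (auto intro: eventually_finite_subsets_at_top_weakI)
  then show ?thesis by (simp add: Ell2_inverse)
qed

instance ell2 :: (type) complete_space
proof
  fix X :: "nat \<Rightarrow> 'a ell2" assume C: "Cauchy X"
  have "Cauchy (\<lambda>n. coord (X n) i)" for i
    by (rule bounded_linear.Cauchy[OF bounded_linear_coord C])
  then have "\<exists>l. (\<lambda>n. coord (X n) i) \<longlonglongrightarrow> l" for i
    by (simp add: real_Cauchy_convergent convergentD)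
  then obtain f where f: "\<And>i. (\<lambda>n. coord (X n) i) \<longlonglongrightarrow> f i" by metis
  \<comment> \<open>On a finite \<open>F\<close> the limit in n may be taken coordinate by
    coordinate; the resulting bound does not depend on \<open>F\<close>.\<close>
  have key: "L2_set (\<lambda>i. f i - coord (X m) i) F \<le> \<epsilon>"
    if F: "finite F" and N: "\<And>n. n \<ge> m \<Longrightarrow> norm (X n - X m) \<le> \<epsilon>" for F m \<epsilon>
  proof -
    have "(\<lambda>n. L2_set (\<lambda>i. coord (X n) i - coord (X m) i) F)
        \<longlonglongrightarrow> L2_set (\<lambda>i. f i - coord (X m) i) F"
      unfolding L2_set_def by (intro tendsto_intros f)
    moreover have "L2_set (\<lambda>i. coord (X n) i - coord (X m) i) F \<le> \<epsilon>" if "n \<ge> m" for n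
      using L2_set_coord_le[OF F, of "X n - X m"] N[OF that] by simp
    ultimately show ?thesis
      by (intro LIMSEQ_le_const2) blast+
  qed
  have ev: "\<exists>M. \<forall>m\<ge>M. \<forall>n\<ge>M. norm (X n - X m) \<le> \<epsilon>" if "\<epsilon> > 0" for \<epsilon>
    using CauchyD[OF C that] by (meson less_imp_le)
  obtain M where M: "\<And>n. n \<ge> M \<Longrightarrow> norm (X n - X M) \<le> 1" using ev[of 1] by auto
  have "L2_set f F \<le> 1 + norm (X M)" if "finite F" for F
    using L2_set_triangle_ineq[of "\<lambda>i. f i - coord (X M) i" "coord (X M)" F]
      key[OF that M] L2_set_coord_le[OF that, of "X M"] by simp
  then have co: "coord (Ell2 f) = f" by (rule coord_Ell2_finite_bound)
  have "X \<longlonglongrightarrow> Ell2 f"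
  proof (rule LIMSEQ_I)
    fix r :: real assume "r > 0"
    then obtain M where M: "\<And>m n. m \<ge> M \<Longrightarrow> n \<ge> M \<Longrightarrow> norm (X n - X m) \<le> r / 2"
      using ev[of "r/2"] by auto
    have "norm (X m - Ell2 f) < r" if "m \<ge> M" for m
    proof -
      have "norm (Ell2 f - X m) \<le> r / 2"
      proof (rule norm_ell2_leI)
        fix F :: "'a set" assume "finite F"
        then show "L2_set (coord (Ell2 f - X m)) F \<le> r / 2"
          using key[of F m "r/2"] M that by (simp add: co)
      qed
      then show ?thesis using \<open>r > 0\<close> by (simp add: norm_minus_commute)
    qed
    then show "\<exists>M. \<forall>m\<ge>M. norm (X m - Ell2 f) < r" by blast
  qed
  then show "convergent X" by (auto simp: convergent_def)
qed

section \<open>Tails of square-summable families\<close>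

lemma ell2_tail_le:
  "\<epsilon> > 0 \<Longrightarrow> \<exists>F. finite F \<and> (\<forall>G. finite G \<and> G \<inter> F = {} \<longrightarrow> L2_set (coord x) G \<le> \<epsilon>)"
proof -
  assume "\<epsilon> > 0"
  then have "\<forall>\<^sub>F F in finite_subsets_at_top UNIV.
      dist (\<Sum>i\<in>F. (coord x i)\<^sup>2) (\<Sum>\<^sub>\<infinity>i. (coord x i)\<^sup>2) < \<epsilon>\<^sup>2"
    using tendstoD[OF infsum_tendsto[OF summable_coord_sq[of x UNIV]], of "\<epsilon>\<^sup>2"] by simp
  then obtain F where F: "finite F"
    "dist (\<Sum>i\<in>F. (coord x i)\<^sup>2) (\<Sum>\<^sub>\<infinity>i. (coord x i)\<^sup>2) < \<epsilon>\<^sup>2"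
    unfolding eventually_finite_subsets_at_top by (metis order_refl subset_UNIV)
  have "L2_set (coord x) G \<le> \<epsilon>" if G: "finite G" "G \<inter> F = {}" for G
  proof -
    have "(\<Sum>i\<in>F. (coord x i)\<^sup>2) + (\<Sum>i\<in>G. (coord x i)\<^sup>2) = (\<Sum>i\<in>F \<union> G. (coord x i)\<^sup>2)"
      using F(1) G by (intro sum.union_disjoint[symmetric]) auto
    also have "\<dots> \<le> (\<Sum>\<^sub>\<infinity>i. (coord x i)\<^sup>2)"
      using sum_coord_sq_le[of "F \<union> G" x] F(1) G(1) by (simp add: norm_ell2_sq)
    finally have "(\<Sum>i\<in>G. (coord x i)\<^sup>2) \<le> \<epsilon>\<^sup>2" using F(2) by (simp add: dist_real_def)
    then show ?thesis
      unfolding L2_set_def using \<open>\<epsilon> > 0\<close> by (intro real_le_lsqrt) auto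
  qed
  with F(1) show ?thesis by blast
qed

text \<open>A finite \<epsilon>/2-net reduces the claim to the tails of its centres. Having one
  \<open>F\<close> for all of \<open>K\<close> is what turns coordinatewise convergence into norm
  convergence in \<open>continuous_map_mean\<close>.\<close>

lemma compact_ell2_tail_le:
  fixes K :: "'a ell2 set"
  assumes "compact K" "\<epsilon> > 0"
  shows "\<exists>F. finite F \<and> (\<forall>x\<in>K. \<forall>G. finite G \<and> G \<inter> F = {} \<longrightarrow> L2_set (coord x) G \<le> \<epsilon>)"
proof -
  have "K \<subseteq> (\<Union>c\<in>K. ball c (\<epsilon>/2))" using assms(2) by auto
  with compactE_image[OF assms(1), of K "\<lambda>c. ball c (\<epsilon>/2)"] open_ball
  obtain C where C: "C \<subseteq> K" "finite C" "K \<subseteq> (\<Union>c\<in>C. ball c (\<epsilon>/2))"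
    by blast
  have "\<forall>c::'a ell2. \<exists>F. finite F \<and> (\<forall>G. finite G \<and> G \<inter> F = {} \<longrightarrow> L2_set (coord c) G \<le> \<epsilon>/2)"
    using ell2_tail_le[OF half_gt_zero[OF assms(2)]] by blast
  then obtain F :: "'a ell2 \<Rightarrow> 'a set" where F: "\<And>c. finite (F c)"
      "\<And>c G. finite G \<Longrightarrow> G \<inter> F c = {} \<Longrightarrow> L2_set (coord c) G \<le> \<epsilon>/2" by metis
  have "L2_set (coord x) G \<le> \<epsilon>" if x: "x \<in> K" and G: "finite G" "G \<inter> (\<Union>(F ` C)) = {}" for x G
  proof -
    obtain c where c: "c \<in> C" "dist c x < \<epsilon>/2" using C(3) x by auto
    have "L2_set (coord x) G \<le> L2_set (coord (x - c)) G + L2_set (coord c) G"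
      using L2_set_triangle_ineq[of "coord (x - c)" "coord c" G] by simp
    also have "L2_set (coord (x - c)) G \<le> \<epsilon>/2"
      using L2_set_coord_le[OF G(1), of "x - c"] c(2) by (simp add: dist_norm norm_minus_commute)
    also have "L2_set (coord c) G \<le> \<epsilon>/2" using c(1) G by (intro F(2)) auto
    finally show ?thesis by simp
  qed
  then show ?thesis using C(2) F(1) by (intro exI[of _ "\<Union>(F ` C)"]) auto
qed

section \<open>Reproducing kernel Hilbert spaces\<close>

lemma subspace_closure:
  fixes S :: "'h::real_normed_vector set"
  assumes S: "subspace S"
  shows "subspace (closure S)"
proof (rule subspaceI)
  show "0 \<in> closure S" using subspace_0[OF S] closure_subset by blast
next
  fix x y assume "x \<in> closure S" "y \<in> closure S"
  then obtain f g where "\<forall>n. f n \<in> S" "f \<longlonglongrightarrow> x" "\<forall>n. g n \<in> S" "g \<longlonglongrightarrow> y"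
    unfolding closure_sequential by blast
  then show "x + y \<in> closure S"
    unfolding closure_sequential
    by (intro exI[of _ "\<lambda>n. f n + g n"]) (simp add: tendsto_add subspace_add[OF S])
next
  fix c x assume "x \<in> closure S"
  then obtain f where "\<forall>n. f n \<in> S" "f \<longlonglongrightarrow> x"
    unfolding closure_sequential by blast
  then show "c *\<^sub>R x \<in> closure S"
    unfolding closure_sequential
    by (intro exI[of _ "\<lambda>n. c *\<^sub>R f n"]) (simp add: tendsto_scaleR subspace_scale[OF S])
qed

text \<open>A vector c of the closed span \<open>V\<close> becomes the function with values
  \<open>c \<bullet> \<Psi> x\<close>. A vector of \<open>V\<close> orthogonal to all features is
  orthogonal to \<open>V\<close>, hence zero; so \<open>ev\<close> is injective on \<open>V\<close>,
  and the inner product of \<open>V\<close> is carried over along \<open>\<iota>\<close>.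
  Completeness holds because \<open>V\<close> is closed in a complete space.\<close>

lemma rkhs_of_feature_map:
  fixes \<Psi> :: "'p \<Rightarrow> 'h::{real_inner, complete_space}"
  assumes k: "\<And>x y. x \<in> P \<Longrightarrow> y \<in> P \<Longrightarrow> k x y = \<Psi> x \<bullet> \<Psi> y"
  shows "\<exists>H ip. rkhs P k H ip"
proof -
  define V where "V = closure (span (\<Psi> ` P))"
  define ev where "ev c = (\<lambda>x\<in>P. c \<bullet> \<Psi> x)" for c
  define \<iota> where "\<iota> = inv_into V ev"
  have subV: "subspace V"
    unfolding V_def by (rule subspace_closure) (rule subspace_span)
  have \<Psi>V: "\<Psi> x \<in> V" if "x \<in> P" for x
    unfolding V_def using that by (intro subsetD[OF closure_subset] span_base) auto
  have zero: "c = 0" if "c \<in> V" and c: "\<And>x. x \<in> P \<Longrightarrow> c \<bullet> \<Psi> x = 0" for c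
  proof -
    have "span (\<Psi> ` P) \<subseteq> {v. c \<bullet> v = 0}"
      by (intro span_minimal subspaceI) (use c in \<open>auto simp: inner_add_right\<close>)
    then have "V \<subseteq> {v. c \<bullet> v = 0}"
      unfolding V_def by (intro closure_minimal closed_Collect_eq continuous_intros)
    then show ?thesis using \<open>c \<in> V\<close> by auto
  qed
  have inj: "inj_on ev V"
  proof (rule inj_onI)
    fix c c' assume cc: "c \<in> V" "c' \<in> V" "ev c = ev c'"
    have "(c - c') \<bullet> \<Psi> x = 0" if "x \<in> P" for x
      using fun_cong[OF cc(3), of x] that by (simp add: ev_def inner_diff_left)
    then have "c - c' = 0" using cc by (intro zero subspace_diff[OF subV])
    then show "c = c'" by simp
  qed
  have \<iota>_ev [simp]: "\<iota> (ev c) = c" if "c \<in> V" for c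
    unfolding \<iota>_def using inj that by simp
  have plus: "(\<lambda>x\<in>P. ev c x + ev c' x) = ev (c + c')" for c c'
    by (auto simp: ev_def inner_add_left)
  have minus: "(\<lambda>x\<in>P. ev c x - ev c' x) = ev (c - c')" for c c'
    by (auto simp: ev_def inner_diff_left)
  have scale: "(\<lambda>x\<in>P. r * ev c x) = ev (r *\<^sub>R c)" for r c
    by (auto simp: ev_def)
  have ev0: "(\<lambda>x\<in>P. 0) = ev 0" by (auto simp: ev_def)
  have ker: "(\<lambda>y\<in>P. k y x) = ev (\<Psi> x)" if "x \<in> P" for x
    unfolding ev_def using that by (intro restrict_ext) (simp add: k inner_commute)
  note V_ops = subspace_add[OF subV] subspace_diff[OF subV] subspace_scale[OF subV] subspace_0[OF subV]
  have "rkhs P k (ev ` V) (\<lambda>f g. \<iota> f \<bullet> \<iota> g)"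
  proof
    fix F :: "nat \<Rightarrow> 'p \<Rightarrow> real"
    assume F: "\<And>n. F n \<in> ev ` V"
      "\<forall>\<epsilon>>0. \<exists>N. \<forall>m\<ge>N. \<forall>n\<ge>N. sqrt (\<iota> (\<lambda>x\<in>P. F m x - F n x) \<bullet> \<iota> (\<lambda>x\<in>P. F m x - F n x)) < \<epsilon>"
    have "\<forall>n. \<exists>c. c \<in> V \<and> F n = ev c" using F(1) by blast
    then obtain c where c: "\<And>n. c n \<in> V" "\<And>n. F n = ev (c n)"
      using choice[of "\<lambda>n c. c \<in> V \<and> F n = ev c"] by blast
    have "Cauchy c"
      using F(2) by (simp add: c minus V_ops Cauchy_def dist_norm norm_eq_sqrt_inner)
    then obtain l where l: "c \<longlonglongrightarrow> l" by (auto simp: Cauchy_convergent_iff convergent_def)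
    have "l \<in> V" using closed_sequentially[OF _ _ l] c(1) by (auto simp: V_def)
    moreover have "(\<lambda>n. sqrt (\<iota> (\<lambda>x\<in>P. F n x - ev l x) \<bullet> \<iota> (\<lambda>x\<in>P. F n x - ev l x))) \<longlonglongrightarrow> 0"
      using tendsto_norm_zero[OF LIM_zero[OF l]] \<open>l \<in> V\<close>
      by (simp add: c minus V_ops norm_eq_sqrt_inner)
    ultimately show "\<exists>f\<in>ev ` V. (\<lambda>n. sqrt (\<iota> (\<lambda>x\<in>P. F n x - f x) \<bullet> \<iota> (\<lambda>x\<in>P. F n x - f x))) \<longlonglongrightarrow> 0"
      by blast
  next
    show "(\<lambda>x\<in>P. 0) \<in> ev ` V" using V_ops(4) by (simp add: ev0)
    show "f x = \<iota> f \<bullet> \<iota> (\<lambda>y\<in>P. k y x)" if "f \<in> ev ` V" "x \<in> P" for f x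
      using that by (auto simp: ker \<Psi>V) (simp add: ev_def)
    show "f = (\<lambda>x\<in>P. 0)" if "f \<in> ev ` V" "\<iota> f \<bullet> \<iota> f = 0" for f
      using that by (auto simp: ev0)
  next
    show "ev ` V \<subseteq> extensional P" by (auto simp: ev_def)
  next
    fix f g assume "f \<in> ev ` V" "g \<in> ev ` V"
    then obtain c c' where "f = ev c" "g = ev c'" "c \<in> V" "c' \<in> V" by blast
    then show "(\<lambda>x\<in>P. f x + g x) \<in> ev ` V" "\<iota> f \<bullet> \<iota> g = \<iota> g \<bullet> \<iota> f"
      "\<And>h. h \<in> ev ` V \<Longrightarrow> \<iota> (\<lambda>x\<in>P. f x + g x) \<bullet> \<iota> h = \<iota> f \<bullet> \<iota> h + \<iota> g \<bullet> \<iota> h"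
      "\<And>r. \<iota> (\<lambda>x\<in>P. r * f x) \<bullet> \<iota> g = r * (\<iota> f \<bullet> \<iota> g)"
      "\<And>r. (\<lambda>x\<in>P. r * f x) \<in> ev ` V"
      by (simp_all add: plus scale V_ops inner_add_left inner_commute[of c])
  next
    show "(\<lambda>y\<in>P. k y x) \<in> ev ` V" if "x \<in> P" for x
      using that by (simp add: ker \<Psi>V)
  qed simp
  then show ?thesis by blast
qed

section \<open>Consequences of the reproducing property\<close>

context rkhs
begin

lemma ip_zero_left: "g \<in> H \<Longrightarrow> ip (\<lambda>x\<in>P. 0) g = 0"
  using ip_scale[OF zero, of g 0] by simp

lemma diff: "f \<in> H \<Longrightarrow> g \<in> H \<Longrightarrow> (\<lambda>x\<in>P. f x - g x) \<in> H"
  using add[OF _ scale[of g "-1"], of f] by (simp cong: restrict_cong)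

lemma ip_diff:
  assumes "f \<in> H" "g \<in> H" "h \<in> H"
  shows "ip (\<lambda>x\<in>P. f x - g x) h = ip f h - ip g h"
  using ip_add[OF assms(1) scale[OF assms(2), of "-1"] assms(3)] ip_scale[OF assms(2,3), of "-1"]
  by (simp cong: restrict_cong)

lemma ip_Cauchy_Schwarz:
  assumes "f \<in> H" "g \<in> H"
  shows "(ip f g)\<^sup>2 \<le> ip f f * ip g g"
proof (cases "ip g g = 0")
  case True
  then have "ip g f = 0" using ip_eq_0[OF assms(2)] ip_zero_left[OF assms(1)] by metis
  then show ?thesis using ip_commute[OF assms] True by simp
next
  case False
  \<comment> \<open>The component of \<open>f\<close> orthogonal to \<open>g\<close>. The inner
    restriction is kept so that \<open>diff\<close> and \<open>scale\<close> match
    literally.\<close>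
  define h where "h = (\<lambda>x\<in>P. f x - (\<lambda>x\<in>P. (ip f g / ip g g) * g x) x)"
  have hH: "h \<in> H" unfolding h_def by (intro diff scale assms)
  have ip_h: "ip h u = ip f u - (ip f g / ip g g) * ip g u" if "u \<in> H" for u
    unfolding h_def ip_diff[OF assms(1) scale[OF assms(2)] that] ip_scale[OF assms(2) that] ..
  have "ip h g = 0" using ip_h[OF assms(2)] False by simp
  then have "ip h h = ip h f"
    using ip_h[OF hH] ip_commute[OF hH] assms by simp
  also have "\<dots> = ip f f - (ip f g)\<^sup>2 / ip g g"
    using ip_h[OF assms(1)] ip_commute[OF assms] by (simp add: power2_eq_square)
  finally have "(ip f g)\<^sup>2 / ip g g \<le> ip f f" using ip_nonneg[OF hH] by simp
  then show ?thesis using ip_nonneg[OF assms(2)] False by (simp add: field_simps)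
qed

text \<open>The difference of two kernel sections represents the functional taking \<open>h\<close>
  to \<open>h x - h y\<close>; the bound is Cauchy-Schwarz, with its squared norm again computed by
  the reproducing property.\<close>

lemma abs_diff_le:
  assumes h: "h \<in> H" and xy: "x \<in> P" "y \<in> P"
  shows "\<bar>h x - h y\<bar> \<le> sqrt (ip h h * (k x x - k x y - k y x + k y y))"
proof -
  let ?f = "\<lambda>z\<in>P. (\<lambda>y\<in>P. k y x) z - (\<lambda>x\<in>P. k x y) z"
  have fH: "?f \<in> H" by (intro diff kernel_mem xy)
  have fx: "ip ?f u = u x - u y" if "u \<in> H" for u
    using ip_diff[OF kernel_mem[OF xy(1)] kernel_mem[OF xy(2)] that] reproducing[OF that] xy
      ip_commute[OF that kernel_mem] by simp
  have "(h x - h y)\<^sup>2 \<le> ip ?f ?f * ip h h"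
    using ip_Cauchy_Schwarz[OF fH h] fx[OF h] by simp
  also have "ip ?f ?f = k x x - k x y - k y x + k y y"
    using fx[OF fH] xy by simp
  finally show ?thesis
    using real_le_rsqrt[of "\<bar>h x - h y\<bar>"] by (simp add: mult.commute)
qed

text \<open>With a constant diagonal \<open>c\<close> the bound of \<open>abs_diff_le\<close>
  becomes the square root of \<open>ip h h * (2 * c - 2 * k x y)\<close>, so continuity of the one
  section \<open>k x\<close> at \<open>x\<close> makes \<open>h\<close> continuous at
  \<open>x\<close>.\<close>

lemma continuous_map_mem:
  assumes h: "h \<in> H" and Z: "topspace Z = P"
    and kd: "\<And>x. x \<in> P \<Longrightarrow> k x x = c"
    and ks: "\<And>x y. x \<in> P \<Longrightarrow> y \<in> P \<Longrightarrow> k x y = k y x"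
    and kc: "\<And>x. x \<in> P \<Longrightarrow> continuous_map Z euclideanreal (k x)"
  shows "continuous_map Z euclideanreal h"
  unfolding continuous_map_atin Z limitin_canonical_iff
proof
  fix x assume x: "x \<in> P"
  have "((k x) \<longlongrightarrow> k x x) (atin Z x)"
    using kc[OF x] x unfolding continuous_map_atin Z limitin_canonical_iff by blast
  then have "((\<lambda>y. sqrt (ip h h * (2 * c - 2 * k x y))) \<longlongrightarrow> sqrt (ip h h * (2 * c - 2 * c))) (atin Z x)"
    using kd[OF x] by (intro tendsto_intros) simp
  then have lim: "((\<lambda>y. sqrt (ip h h * (2 * c - 2 * k x y))) \<longlongrightarrow> 0) (atin Z x)"
    by simp
  have "\<forall>\<^sub>F y in atin Z x. y \<in> P"
    unfolding eventually_atin using x Z by (metis openin_topspace DiffD1)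
  then have "\<forall>\<^sub>F y in atin Z x. norm (h y - h x) \<le> sqrt (ip h h * (2 * c - 2 * k x y))"
  proof eventually_elim
    case (elim y)
    then show ?case
      using abs_diff_le[OF h x elim] ks[OF x elim] kd x by (simp add: abs_minus_commute)
  qed
  then have "((\<lambda>y. h y - h x) \<longlongrightarrow> 0) (atin Z x)"
    by (rule Lim_null_comparison[OF _ lim])
  then show "(h \<longlongrightarrow> h x) (atin Z x)" by (rule LIM_zero_cancel)
qed

end

text \<open>If \<open>|c - v|\<^sup>2\<close> is within \<open>\<epsilon>\<^sup>2\<close> of its infimum over the subspace, then moving \<open>v\<close>
  along a unit vector \<open>u\<close> can gain at most \<open>\<epsilon>\<^sup>2\<close>, so \<open>|\<langle>c - v, u\<rangle>| \<le> \<epsilon>\<close>.  This replaces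
  the orthogonal projection.\<close>

lemma almost_orthogonal_approximation:
  fixes c :: "'h::real_inner"
  assumes V: "subspace V" and \<epsilon>: "\<epsilon> > 0"
  shows "\<exists>v\<in>V. \<forall>u\<in>V. norm u = 1 \<longrightarrow> \<bar>(c - v) \<bullet> u\<bar> \<le> \<epsilon>"
proof -
  define I where "I = (INF v\<in>V. (norm (c - v))\<^sup>2)"
  have ne: "V \<noteq> {}" using subspace_0[OF V] by blast
  have bdd: "bdd_below ((\<lambda>v. (norm (c - v))\<^sup>2) ` V)" by (rule bdd_belowI2[of _ 0]) simp
  have "I < I + \<epsilon>\<^sup>2" using \<epsilon> by simp
  then obtain v where v: "v \<in> V" "(norm (c - v))\<^sup>2 < I + \<epsilon>\<^sup>2"
    unfolding I_def by (subst (asm) cINF_less_iff[OF ne bdd]) blast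
  have "\<bar>(c - v) \<bullet> u\<bar> \<le> \<epsilon>" if u: "u \<in> V" "norm u = 1" for u
  proof -
    let ?t = "(c - v) \<bullet> u"
    have "I \<le> (norm (c - (v + ?t *\<^sub>R u)))\<^sup>2"
      unfolding I_def using v u by (intro cINF_lower bdd subspace_add[OF V] subspace_scale[OF V])
    also have "c - (v + ?t *\<^sub>R u) = (c - v) - ?t *\<^sub>R u" by simp
    also have "(norm \<dots>)\<^sup>2 = (norm (c - v))\<^sup>2 - 2 * ?t * ?t + ?t\<^sup>2 * (norm u)\<^sup>2"
      unfolding power2_norm_eq_inner
      by (simp add: inner_diff_left inner_diff_right inner_commute power2_eq_square algebra_simps)
    also have "\<dots> = (norm (c - v))\<^sup>2 - ?t\<^sup>2" using u by (simp add: power2_eq_square)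
    finally have "?t\<^sup>2 \<le> \<epsilon>\<^sup>2" using v(2) by simp
    then show ?thesis using \<epsilon> by (simp add: abs_le_square_iff[symmetric])
  qed
  with v(1) show ?thesis by blast
qed

section \<open>Stone--Weierstrass for linear spans\<close>

inductive_set fspan :: "('a \<Rightarrow> real) set \<Rightarrow> ('a \<Rightarrow> real) set" for B where
  fspan_zero: "(\<lambda>x. 0) \<in> fspan B"
| fspan_step: "b \<in> B \<Longrightarrow> p \<in> fspan B \<Longrightarrow> (\<lambda>x. r * b x + p x) \<in> fspan B"

lemma fspan_base: "b \<in> B \<Longrightarrow> b \<in> fspan B"
  using fspan_step[of b B "\<lambda>x. 0" 1] by (simp add: fspan_zero)

lemma fspan_add: "p \<in> fspan B \<Longrightarrow> q \<in> fspan B \<Longrightarrow> (\<lambda>x. p x + q x) \<in> fspan B"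
  by (induction p rule: fspan.induct) (auto simp: add.assoc intro: fspan_step)

lemma fspan_scale: "p \<in> fspan B \<Longrightarrow> (\<lambda>x. r * p x) \<in> fspan B"
proof (induction p rule: fspan.induct)
  case (fspan_step b p s)
  then show ?case using fspan.fspan_step[of b B "\<lambda>x. r * p x" "r * s"] by (simp add: algebra_simps)
qed (simp add: fspan_zero)

lemma fspan_sum_list:
  assumes "\<And>w. w \<in> set ws \<Longrightarrow> f w \<in> fspan B"
  shows "(\<lambda>x. \<Sum>w\<leftarrow>ws. f w x) \<in> fspan B"
  using assms by (induction ws) (auto intro: fspan_zero fspan_add)

text \<open>Bilinear extension from the generators: first in \<open>q\<close> with a generator on
  the left, then in \<open>p\<close>. Equality is asked on \<open>S\<close> only, because a rule
  such as the shuffle identity holds at signatures of paths and not at every point of the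
  space.\<close>

lemma fspan_mult:
  assumes B: "\<And>b b'. b \<in> B \<Longrightarrow> b' \<in> B \<Longrightarrow> \<exists>p\<in>fspan B. \<forall>x\<in>S. b x * b' x = p x"
    and p: "p \<in> fspan B" and q: "q \<in> fspan B"
  shows "\<exists>r\<in>fspan B. \<forall>x\<in>S. p x * q x = r x"
proof -
  have base: "\<exists>r\<in>fspan B. \<forall>x\<in>S. b x * q x = r x" if bB: "b \<in> B" for b
    using q
  proof (induction q rule: fspan.induct)
    case (fspan_step b' q s)
    then obtain r where r: "r \<in> fspan B" "\<forall>x\<in>S. b x * q x = r x" by blast
    obtain u where u: "u \<in> fspan B" "\<forall>x\<in>S. b x * b' x = u x" using B[OF bB fspan_step(1)] by blast
    have "(\<lambda>x. s * u x + r x) \<in> fspan B" by (intro fspan_add fspan_scale r u)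
    moreover have "b x * (s * b' x + q x) = s * u x + r x" if "x \<in> S" for x
      using r(2) u(2) that by (simp add: distrib_left mult.left_commute[of _ s])
    ultimately show ?case by (intro bexI[of _ "\<lambda>x. s * u x + r x"]) simp_all
  next
    case fspan_zero
    show ?case by (intro bexI[OF _ fspan.fspan_zero]) simp
  qed
  show ?thesis
    using p
  proof (induction p rule: fspan.induct)
    case (fspan_step b p s)
    then obtain r where r: "r \<in> fspan B" "\<forall>x\<in>S. p x * q x = r x" by blast
    obtain u where u: "u \<in> fspan B" "\<forall>x\<in>S. b x * q x = u x" using base[OF fspan_step(1)] by blast
    have "(\<lambda>x. s * u x + r x) \<in> fspan B" by (intro fspan_add fspan_scale r u)
    moreover have "(s * b x + p x) * q x = s * u x + r x" if "x \<in> S" for x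
      using r(2) u(2) that by (simp add: distrib_right mult.assoc)
    ultimately show ?case by (intro bexI[of _ "\<lambda>x. s * u x + r x"]) simp_all
  next
    case fspan_zero
    show ?case by (intro bexI[OF _ fspan.fspan_zero]) simp
  qed
qed

lemma continuous_on_fspan:
  assumes "\<And>b. b \<in> B \<Longrightarrow> continuous_on S b" "p \<in> fspan B"
  shows "continuous_on S p"
  using assms(2) by (induction p rule: fspan.induct) (simp_all add: assms(1) continuous_on_add continuous_on_mult_left)

lemma Stone_Weierstrass_fspan:
  fixes S :: "'a::t2_space set"
  assumes S: "compact S"
    and cont: "\<And>b. b \<in> B \<Longrightarrow> continuous_on S b"
    and mult: "\<And>b b'. b \<in> B \<Longrightarrow> b' \<in> B \<Longrightarrow> \<exists>p\<in>fspan B. \<forall>x\<in>S. b x * b' x = p x"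
    and one: "\<exists>p\<in>fspan B. \<forall>x\<in>S. p x = 1"
    and sep: "\<And>x y. x \<in> S \<Longrightarrow> y \<in> S \<Longrightarrow> x \<noteq> y \<Longrightarrow> \<exists>b\<in>B. b x \<noteq> b y"
    and f: "continuous_on S f" and \<epsilon>: "\<epsilon> > 0"
  shows "\<exists>p\<in>fspan B. \<forall>x\<in>S. \<bar>f x - p x\<bar> < \<epsilon>"
proof -
  \<comment> \<open>Passing to functions that agree on \<open>S\<close> with a member of the span
    makes the set closed under products.\<close>
  define R where "R = {g. \<exists>p\<in>fspan B. \<forall>x\<in>S. g x = p x}"
  interpret function_ring_on R S
  proof
    show "compact S" by fact
    show "continuous_on S g" if g: "g \<in> R" for g
    proof -
      obtain p where "p \<in> fspan B" "\<forall>x\<in>S. g x = p x" using g by (auto simp: R_def)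
      then show ?thesis using continuous_on_fspan[OF cont] continuous_on_cong by metis
    qed
    show "(\<lambda>x. g x + h x) \<in> R" if gh: "g \<in> R" "h \<in> R" for g h
    proof -
      obtain p q where "p \<in> fspan B" "\<forall>x\<in>S. g x = p x" "q \<in> fspan B" "\<forall>x\<in>S. h x = q x"
        using gh by (auto simp: R_def)
      then show ?thesis unfolding R_def by (auto intro!: bexI[OF _ fspan_add])
    qed
    show "(\<lambda>x. g x * h x) \<in> R" if gh: "g \<in> R" "h \<in> R" for g h
    proof -
      obtain p q where pq: "p \<in> fspan B" "\<forall>x\<in>S. g x = p x" "q \<in> fspan B" "\<forall>x\<in>S. h x = q x"
        using gh by (auto simp: R_def)
      obtain r where "r \<in> fspan B" "\<forall>x\<in>S. p x * q x = r x"
        using fspan_mult[OF mult pq(1,3)] by blast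
      then show ?thesis unfolding R_def using pq by (auto intro!: bexI[of _ r])
    qed
    show "(\<lambda>_. c) \<in> R" for c
    proof -
      obtain p where "p \<in> fspan B" "\<forall>x\<in>S. p x = 1" using one by blast
      then show ?thesis unfolding R_def by (auto intro!: bexI[OF _ fspan_scale[of p B c]])
    qed
    show "\<exists>g\<in>R. g x \<noteq> g y" if "x \<in> S" "y \<in> S" "x \<noteq> y" for x y
      using sep[OF that] fspan_base unfolding R_def by blast
  qed
  obtain g where g: "g \<in> R" "\<forall>x\<in>S. \<bar>f x - g x\<bar> < \<epsilon>" using Stone_Weierstrass_basic[OF f \<epsilon>] by blast
  then obtain p where "p \<in> fspan B" "\<forall>x\<in>S. g x = p x" by (auto simp: R_def)
  with g(2) show ?thesis by (auto intro!: bexI[of _ p])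
qed


section \<open>The feature map of the Gaussian kernel\<close>

text \<open>Monomials are indexed by lists, not by exponents, so a monomial occurs once for each
  ordering of its factors. This absorbs the multinomial coefficients: the sum over lists of length n
  is a plain power of the inner product.\<close>

definition monom :: "'i list \<Rightarrow> 'i ell2 \<Rightarrow> real" where
  "monom W x = prod_list (map (coord x) W)"

lemma monom_simps [simp]: "monom [] x = 1" "monom (i # W) x = coord x i * monom W x"
    "monom (V @ W) x = monom V x * monom W x"
  by (simp_all add: monom_def)

lemma continuous_on_monom [continuous_intros]: "continuous_on A (monom W)"
  by (induction W) (auto simp: monom_def[abs_def] intro!: continuous_intros)

lemma bij_betw_Cons:
  "bij_betw (\<lambda>(i, W). i # W) (UNIV \<times> {W. length W = n}) {W. length W = Suc n}"
  by (rule bij_betwI[where g = "\<lambda>W. (hd W, tl W)"]) (auto simp: length_Suc_conv)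

lemma bij_betw_by_length: "bij_betw snd (SIGMA n:UNIV. {W::'i list. length W = n}) UNIV"
  by (rule bij_betwI[where g = "\<lambda>W. (length W, W)"]) auto

lemma has_sum_by_length:
  fixes f :: "'i list \<Rightarrow> real"
  assumes "\<And>n. (f has_sum g n) {W. length W = n}" "(g has_sum s) UNIV" "f summable_on UNIV"
  shows "(f has_sum s) UNIV"
proof -
  have "((\<lambda>p. f (snd p)) has_sum s) (SIGMA n:UNIV. {W::'i list. length W = n})"
    by (rule has_sum_SigmaI[where g = g])
      (use assms summable_on_reindex_bij_betw[OF bij_betw_by_length, of f] in auto)
  then show ?thesis using has_sum_reindex_bij_betw[OF bij_betw_by_length, of f] by simp
qed

lemma summable_on_by_length:
  fixes f :: "'i list \<Rightarrow> real"
  assumes "\<And>n. (f has_sum g n) {W. length W = n}" "g summable_on UNIV" "\<And>W. 0 \<le> f W"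
  shows "f summable_on UNIV"
proof -
  have "(\<lambda>p. f (snd p)) summable_on (SIGMA n:UNIV. {W::'i list. length W = n})"
    by (rule summable_on_SigmaI[where g = g]) (use assms in auto)
  then show ?thesis using summable_on_reindex_bij_betw[OF bij_betw_by_length, of f] by simp
qed

lemma has_sum_coord_mult: "((\<lambda>i. coord x i * coord y i) has_sum (x \<bullet> y)) UNIV"
  unfolding inner_ell2_def by (intro has_sum_infsum summable_coord_mult)

text \<open>The monomials of degree n are the coordinates of the n-th tensor power, and this is the
  inner product of two tensor powers. The induction splits off the first index.\<close>

lemma has_sum_monom_mult:
  fixes x y :: "'i ell2"
  shows "((\<lambda>W. monom W x * monom W y) has_sum (x \<bullet> y) ^ n) {W. length W = n}"
proof (induction n arbitrary: x y)
  case 0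
  show ?case by (simp add: has_sum_finite_iff)
next
  case (Suc n)
  let ?f = "\<lambda>x y (i, W). (coord x i * monom W x) * (coord y i * monom W y)"
  have inner: "((\<lambda>W. ?f u v (i, W)) has_sum (coord u i * coord v i) * (u \<bullet> v) ^ n) {W. length W = n}"
    for u v :: "'i ell2" and i
    using has_sum_cmult_right[OF Suc, of "coord u i * coord v i" u v]
    by (simp add: mult.assoc mult.left_commute)
  have outer: "((\<lambda>i. (coord u i * coord v i) * (u \<bullet> v) ^ n) has_sum (u \<bullet> v) ^ Suc n) UNIV"
    for u v :: "'i ell2"
    using has_sum_cmult_left[OF has_sum_coord_mult[of u v], of "(u \<bullet> v) ^ n"] by simp
  \<comment> \<open>Summability on the product set comes first for the nonnegative squares; the
    mixed terms then follow from \<open>summable_on_mult_of_squares\<close>.\<close>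
  have sq: "(\<lambda>p. (case p of (i, W) \<Rightarrow> coord u i * monom W u)\<^sup>2) summable_on (UNIV \<times> {W. length W = n})"
    for u :: "'i ell2"
    by (rule summable_on_SigmaI[OF _ has_sum_imp_summable[OF outer[of u u]]])
      (use inner in \<open>simp_all add: power2_eq_square\<close>)
  have "(?f x y) summable_on (UNIV \<times> {W. length W = n})"
    using summable_on_mult_of_squares[OF sq[of x] sq[of y]] by (simp add: case_prod_unfold)
  then have "(?f x y has_sum (x \<bullet> y) ^ Suc n) (UNIV \<times> {W. length W = n})"
    by (intro has_sum_SigmaI[OF inner outer])
  then show ?case
    using has_sum_reindex_bij_betw[OF bij_betw_Cons, of "\<lambda>W. monom W x * monom W y" n]
    by (simp add: case_prod_unfold)
qed

text \<open>Square root of the n-th Taylor coefficient of exp(2 \<open>\<sigma>\<^sup>2\<close> t)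
  in t. Expanding the squared distance leaves exp(2 \<open>\<sigma>\<^sup>2\<close>
  (\<open>x \<bullet> y\<close>)) as the only mixed factor of the Gaussian kernel; the other two
  factors go into \<open>gauss_feature\<close>.\<close>

definition gauss_weight :: "real \<Rightarrow> nat \<Rightarrow> real" where
  "gauss_weight \<sigma> n = sqrt ((2 * \<sigma>\<^sup>2) ^ n / fact n)"

definition gauss_feature :: "real \<Rightarrow> 'i ell2 \<Rightarrow> 'i list ell2" where
  "gauss_feature \<sigma> x =
     Ell2 (\<lambda>W. exp (- (\<sigma>\<^sup>2 * (norm x)\<^sup>2)) * gauss_weight \<sigma> (length W) * monom W x)"

lemma gauss_weight_monom_sums:
  fixes x y :: "'i ell2"
  shows "(\<lambda>W. (gauss_weight \<sigma> (length W) * monom W x)\<^sup>2) summable_on UNIV" (is ?A)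
    and "((\<lambda>W. (gauss_weight \<sigma> (length W) * monom W x) * (gauss_weight \<sigma> (length W) * monom W y))
      has_sum exp (2 * \<sigma>\<^sup>2 * (x \<bullet> y))) UNIV" (is ?B)
proof -
  define c where "c n = (2 * \<sigma>\<^sup>2) ^ n / fact n" for n :: nat
  have c: "gauss_weight \<sigma> n * gauss_weight \<sigma> n = c n" for n
    by (simp add: gauss_weight_def c_def)
  have len: "((\<lambda>W. (gauss_weight \<sigma> (length W) * monom W x) * (gauss_weight \<sigma> (length W) * monom W y))
      has_sum c n * (x \<bullet> y) ^ n) {W. length W = n}" for n and x y :: "'i ell2"
  proof -
    have "((\<lambda>W. c n * (monom W x * monom W y)) has_sum c n * (x \<bullet> y) ^ n) {W. length W = n}"
      by (rule has_sum_cmult_right[OF has_sum_monom_mult])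
    then show ?thesis
      by (rule has_sum_cong[THEN iffD1, rotated]) (simp add: c[symmetric])
  qed
  have ser: "((\<lambda>n. c n * (x \<bullet> y) ^ n) has_sum exp (2 * \<sigma>\<^sup>2 * (x \<bullet> y))) UNIV" for x y :: "'i ell2"
  proof -
    have eq: "(2 * \<sigma>\<^sup>2 * (x \<bullet> y)) ^ n /\<^sub>R fact n = c n * (x \<bullet> y) ^ n" for n
      by (simp add: c_def power_mult_distrib field_simps)
    show ?thesis
      using norm_summable_imp_has_sum[OF summable_norm_exp exp_converges, of "2 * \<sigma>\<^sup>2 * (x \<bullet> y)"]
      unfolding eq .
  qed
  have A: "(\<lambda>W. (gauss_weight \<sigma> (length W) * monom W x)\<^sup>2) summable_on UNIV" for x :: "'i ell2"
    unfolding power2_eq_square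
    by (rule summable_on_by_length[OF len has_sum_imp_summable[OF ser]]) simp
  then show ?A .
  show ?B
    by (rule has_sum_by_length[OF len ser summable_on_mult_of_squares[OF A A]])
qed

lemma coord_gauss_feature:
  "coord (gauss_feature \<sigma> x) W =
     exp (- (\<sigma>\<^sup>2 * (norm x)\<^sup>2)) * (gauss_weight \<sigma> (length W) * monom W x)"
proof -
  have "(\<lambda>W. (exp (- (\<sigma>\<^sup>2 * (norm x)\<^sup>2)) * gauss_weight \<sigma> (length W) * monom W x)\<^sup>2) summable_on UNIV"
    using summable_on_cmult_right[OF gauss_weight_monom_sums(1)[of \<sigma> x], of "(exp (- (\<sigma>\<^sup>2 * (norm x)\<^sup>2)))\<^sup>2"]
    by (simp add: power_mult_distrib mult.assoc)
  then show ?thesis by (simp add: gauss_feature_def Ell2_inverse)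
qed

lemma inner_gauss_feature:
  "gauss_feature \<sigma> x \<bullet> gauss_feature \<sigma> y = exp (- (\<sigma>\<^sup>2) * (norm (x - y))\<^sup>2)"
proof -
  let ?a = "exp (- (\<sigma>\<^sup>2 * (norm x)\<^sup>2)) * exp (- (\<sigma>\<^sup>2 * (norm y)\<^sup>2))"
  have "gauss_feature \<sigma> x \<bullet> gauss_feature \<sigma> y = (\<Sum>\<^sub>\<infinity>W. ?a *
      ((gauss_weight \<sigma> (length W) * monom W x) * (gauss_weight \<sigma> (length W) * monom W y)))"
    unfolding inner_ell2_def coord_gauss_feature by (intro infsum_cong) simp
  also have "\<dots> = ?a * exp (2 * \<sigma>\<^sup>2 * (x \<bullet> y))"
    by (intro infsumI has_sum_cmult_right gauss_weight_monom_sums)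
  also have "\<dots> = exp (- (\<sigma>\<^sup>2) * (norm (x - y))\<^sup>2)"
    unfolding power2_norm_eq_inner
    by (simp add: exp_add[symmetric] inner_diff_left inner_diff_right inner_commute algebra_simps)
  finally show ?thesis .
qed

lemma norm_gauss_feature: "norm (gauss_feature \<sigma> x) = 1"
  by (simp add: norm_eq_sqrt_inner inner_gauss_feature)

lemma exists_coord_functional: "\<exists>u. \<forall>x. u \<bullet> x = coord x i"
proof -
  define f where "f j = (if j = i then 1 else 0 :: real)" for j
  have "(\<lambda>j. (f j)\<^sup>2) summable_on UNIV"
    by (rule finite_nonzero_values_imp_summable_on) (simp add: f_def)
  then have u: "coord (Ell2 f) = f" by (simp add: Ell2_inverse)
  have "Ell2 f \<bullet> x = coord x i" for x
  proof -
    have "Ell2 f \<bullet> x = (\<Sum>\<^sub>\<infinity>j\<in>{i}. f j * coord x j)"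
      unfolding inner_ell2_def u by (rule infsum_cong_neutral) (auto simp: f_def)
    then show ?thesis by (simp add: f_def)
  qed
  then show ?thesis by blast
qed

text \<open>A polynomial approximates \<open>g\<close> times the inverse of the Gaussian factor.
  Multiplied back by that factor, which is at most 1, it becomes the pairing of the feature with a
  fixed vector \<open>c\<close>, because every monomial is a feature coordinate up to a nonzero
  weight.\<close>

lemma span_gauss_feature_dense:
  fixes Q :: "'i ell2 set"
  assumes Q: "compact Q" and g: "continuous_on Q g" and \<sigma>: "\<sigma> > 0" and \<epsilon>: "\<epsilon> > 0"
  shows "\<exists>v\<in>span (gauss_feature \<sigma> ` Q). \<forall>x\<in>Q. \<bar>g x - v \<bullet> gauss_feature \<sigma> x\<bar> \<le> \<epsilon>"
proof -
  let ?B = "range (monom :: 'i list \<Rightarrow> 'i ell2 \<Rightarrow> real)"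
  have "\<exists>p\<in>fspan ?B. \<forall>x\<in>Q. \<bar>g x * exp (\<sigma>\<^sup>2 * (norm x)\<^sup>2) - p x\<bar> < \<epsilon> / 2"
  proof (rule Stone_Weierstrass_fspan[OF Q])
    show "continuous_on Q b" if "b \<in> ?B" for b using that by (auto intro: continuous_intros)
    show "\<exists>p\<in>fspan ?B. \<forall>x\<in>Q. b x * b' x = p x" if "b \<in> ?B" "b' \<in> ?B" for b b'
    proof -
      from that obtain V W where "b = monom V" "b' = monom W" by blast
      then show ?thesis by (intro bexI[of _ "monom (V @ W)"]) (auto intro: fspan_base)
    qed
    show "\<exists>p\<in>fspan ?B. \<forall>x\<in>Q. p x = 1"
      by (intro bexI[of _ "monom []"]) (auto intro: fspan_base)
    show "\<exists>b\<in>?B. b x \<noteq> b y" if "x \<noteq> y" for x y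
    proof -
      obtain i where "coord x i \<noteq> coord y i" using \<open>x \<noteq> y\<close> ell2_eq_iff by blast
      then show ?thesis by (intro bexI[of _ "monom [i]"]) auto
    qed
    show "continuous_on Q (\<lambda>x. g x * exp (\<sigma>\<^sup>2 * (norm x)\<^sup>2))" by (intro continuous_intros g)
  qed (use \<epsilon> in auto)
  then obtain p where p: "p \<in> fspan ?B"
    "\<And>x. x \<in> Q \<Longrightarrow> \<bar>g x * exp (\<sigma>\<^sup>2 * (norm x)\<^sup>2) - p x\<bar> < \<epsilon> / 2" by blast
  have "\<exists>c. \<forall>x. c \<bullet> gauss_feature \<sigma> x = exp (- (\<sigma>\<^sup>2 * (norm x)\<^sup>2)) * p x"
    using p(1)
  proof (induction p rule: fspan.induct)
    case fspan_zero
    show ?case by (intro exI[of _ 0]) simp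
  next
    case (fspan_step b p r)
    then obtain c W where c: "\<And>x. c \<bullet> gauss_feature \<sigma> x = exp (- (\<sigma>\<^sup>2 * (norm x)\<^sup>2)) * p x"
      and b: "b = monom W" by blast
    obtain u :: "'i list ell2" where u: "\<And>x. u \<bullet> x = coord x W"
      using exists_coord_functional[of W] by blast
    have "gauss_weight \<sigma> (length W) \<noteq> 0" using \<sigma> by (simp add: gauss_weight_def)
    then show ?case
      by (intro exI[of _ "(r / gauss_weight \<sigma> (length W)) *\<^sub>R u + c"])
        (simp add: inner_add_left c u b coord_gauss_feature distrib_left)
  qed
  then obtain c where c: "\<And>x. c \<bullet> gauss_feature \<sigma> x = exp (- (\<sigma>\<^sup>2 * (norm x)\<^sup>2)) * p x" by blast
  \<comment> \<open>The vector \<open>c\<close> need not lie in the span of the features of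
    \<open>Q\<close>. Features are unit vectors, so an almost orthogonal approximation
    \<open>v\<close> from the span costs at most another \<epsilon>/2.\<close>
  obtain v where v: "v \<in> span (gauss_feature \<sigma> ` Q)"
    "\<And>u. u \<in> span (gauss_feature \<sigma> ` Q) \<Longrightarrow> norm u = 1 \<Longrightarrow> \<bar>(c - v) \<bullet> u\<bar> \<le> \<epsilon> / 2"
    using almost_orthogonal_approximation[OF subspace_span half_gt_zero[OF \<epsilon>],
        of "gauss_feature \<sigma> ` Q" c] by blast
  have "\<bar>g x - v \<bullet> gauss_feature \<sigma> x\<bar> \<le> \<epsilon>" if x: "x \<in> Q" for x
  proof -
    let ?e = "exp (- (\<sigma>\<^sup>2 * (norm x)\<^sup>2))"
    have "g x - c \<bullet> gauss_feature \<sigma> x = ?e * (g x * exp (\<sigma>\<^sup>2 * (norm x)\<^sup>2) - p x)"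
      by (simp add: c right_diff_distrib exp_minus)
    also have "\<bar>\<dots>\<bar> \<le> 1 * (\<epsilon> / 2)"
      unfolding abs_mult using p(2)[OF x] by (intro mult_mono) auto
    finally have "\<bar>g x - c \<bullet> gauss_feature \<sigma> x\<bar> \<le> \<epsilon> / 2" by simp
    moreover have "\<bar>(c - v) \<bullet> gauss_feature \<sigma> x\<bar> \<le> \<epsilon> / 2"
      using x by (intro v(2) span_base norm_gauss_feature) auto
    ultimately show ?thesis unfolding inner_diff_left by linarith
  qed
  with v(1) show ?thesis by blast
qed

section \<open>Coding points by binary digits\<close>

definition binary_digit :: "nat \<Rightarrow> real \<Rightarrow> real" where
  "binary_digit m y = of_int (\<lfloor>2 ^ Suc m * y\<rfloor> - 2 * \<lfloor>2 ^ m * y\<rfloor>)"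

lemma binary_digit_cases: "binary_digit m y \<in> {0, 1}"
proof -
  have "\<lfloor>2 ^ Suc m * y\<rfloor> - 2 * \<lfloor>2 ^ m * y\<rfloor> \<in> {0, 1}"
    by (simp add: mult.assoc) linarith
  then show ?thesis by (auto simp: binary_digit_def)
qed

lemma binary_digit_sums:
  assumes "0 \<le> y" "y < 1"
  shows "(\<lambda>m. binary_digit m y / 2 ^ Suc m) sums y"
proof -
  \<comment> \<open>The digit is a difference of floors, so the weighted sum telescopes; its first
    term vanishes as \<open>y\<close> lies in [0,1).\<close>
  have partial: "(\<Sum>m<n. binary_digit m y / 2 ^ Suc m) = \<lfloor>2 ^ n * y\<rfloor> / 2 ^ n" for n
  proof (induction n)
    case 0
    show ?case using assms by (simp add: floor_eq_iff)
  next
    case (Suc n)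
    then show ?case by (simp add: binary_digit_def field_simps)
  qed
  have "(\<lambda>n. of_int \<lfloor>2 ^ n * y\<rfloor> / 2 ^ n) \<longlonglongrightarrow> y"
  proof (rule real_tendsto_sandwich[where f = "\<lambda>n. y - (1/2) ^ n" and h = "\<lambda>n. y"])
    show "\<forall>\<^sub>F n in sequentially. y - (1/2) ^ n \<le> of_int \<lfloor>2 ^ n * y\<rfloor> / 2 ^ n"
    proof (intro always_eventually allI)
      fix n
      have "2 ^ n * y - 1 \<le> of_int \<lfloor>2 ^ n * y\<rfloor>" by linarith
      then have "(2 ^ n * y - 1) / 2 ^ n \<le> of_int \<lfloor>2 ^ n * y\<rfloor> / 2 ^ n"
        by (intro divide_right_mono) auto
      then show "y - (1/2) ^ n \<le> of_int \<lfloor>2 ^ n * y\<rfloor> / 2 ^ n"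
        by (simp add: diff_divide_distrib power_one_over)
    qed
    show "\<forall>\<^sub>F n in sequentially. of_int \<lfloor>2 ^ n * y\<rfloor> / 2 ^ n \<le> y"
      by (intro always_eventually allI) (simp add: divide_le_eq mult.commute)
    have "(\<lambda>n. y - (1/2) ^ n) \<longlonglongrightarrow> y - 0"
      by (intro tendsto_intros LIMSEQ_power_zero) auto
    then show "(\<lambda>n. y - (1/2) ^ n) \<longlonglongrightarrow> y" by simp
  qed simp
  then show ?thesis unfolding sums_def partial .
qed

section \<open>Cantor space, its embedding in the line and the coding of sequences\<close>

definition binary_seqs :: "(nat \<Rightarrow> real) set" where
  "binary_seqs = {b. \<forall>i. b i \<in> {0, 1}}"

lemma compact_binary_seqs: "compact binary_seqs"
proof -
  have "compactin (product_topology (\<lambda>i::nat. euclidean :: real topology) UNIV) (PiE UNIV (\<lambda>i. {0, 1}))"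
    by (subst compactin_PiE) auto
  moreover have "PiE UNIV (\<lambda>i::nat. {0, 1 :: real}) = binary_seqs"
    by (auto simp: binary_seqs_def PiE_UNIV_domain)
  ultimately show ?thesis by (simp add: euclidean_product_topology)
qed

lemma continuous_on_digit_series:
  fixes q :: "nat \<Rightarrow> real" and h :: "nat \<Rightarrow> nat"
  assumes "summable q" "\<And>i. 0 \<le> q i"
  shows "continuous_on binary_seqs (\<lambda>b. \<Sum>i. b (h i) * q i)"
proof -
  have "uniform_limit binary_seqs (\<lambda>n b. \<Sum>i<n. b (h i) * q i) (\<lambda>b. \<Sum>i. b (h i) * q i) sequentially"
  proof (rule Weierstrass_m_test)
    fix n b assume "b \<in> binary_seqs"
    then have "b (h n) \<in> {0, 1}" unfolding binary_seqs_def by blast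
    then show "norm (b (h n) * q n) \<le> q n" using assms(2)[of n] by auto
  qed fact
  moreover have "continuous_on binary_seqs (\<lambda>b. \<Sum>i<n. b (h i) * q i)" for n
    by (intro continuous_intros continuous_on_subset[OF continuous_on_product_coordinates]) auto
  ultimately show ?thesis
    by (intro uniform_limit_theorem[where F = sequentially]) auto
qed

text \<open>Digits 0 and 1 read in base 3. Unlike a reading in base 2 this is injective, so it
  embeds the Cantor space in the real line.\<close>

definition ternary :: "(nat \<Rightarrow> real) \<Rightarrow> real" where
  "ternary b = (\<Sum>i. b i * (1/3) ^ i)"

lemma summable_ternary: "summable (\<lambda>i. (1/3 :: real) ^ i)"
  by (simp add: summable_geometric)

lemma continuous_on_ternary: "continuous_on binary_seqs ternary"
  unfolding ternary_def[abs_def]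
  by (rule continuous_on_digit_series[of _ id, simplified]) (simp_all add: summable_geometric)

lemma summable_ternary_digits:
  assumes "b \<in> binary_seqs" shows "summable (\<lambda>i. b i * (1/3) ^ i)"
proof (rule summable_comparison_test_ev[OF _ summable_ternary], intro always_eventually allI)
  fix i
  have "b i \<in> {0, 1}" using assms unfolding binary_seqs_def by blast
  then show "norm (b i * (1/3) ^ i) \<le> (1/3) ^ i" by auto
qed

lemma ternary_bounds:
  assumes "b \<in> binary_seqs" shows "0 \<le> ternary b" "ternary b \<le> 3 / 2"
proof -
  have b: "0 \<le> b i" "b i \<le> 1" for i
  proof -
    have "b i \<in> {0, 1}" using assms unfolding binary_seqs_def by blast
    then show "0 \<le> b i" "b i \<le> 1" by auto
  qed
  show "0 \<le> ternary b"
    unfolding ternary_def using b by (intro suminf_nonneg summable_ternary_digits assms) auto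
  have "ternary b \<le> (\<Sum>i. (1/3) ^ i)"
    unfolding ternary_def using b
    by (intro suminf_le summable_ternary_digits assms summable_ternary) (simp add: mult_left_le_one_le)
  then show "ternary b \<le> 3 / 2" by (simp add: suminf_geometric)
qed

lemma ternary_first_digit:
  assumes b: "b \<in> binary_seqs" and b': "b' \<in> binary_seqs"
    and eq: "\<And>i. i < k \<Longrightarrow> b i = b' i" and k: "b k = 0" "b' k = 1"
  shows "ternary b < ternary b'"
proof -
  note split = suminf_split_initial_segment[OF summable_ternary_digits, of _ "Suc k"]
  have tail: "(\<Sum>i. a (i + Suc k) * (1/3) ^ (i + Suc k)) = (1/3) ^ Suc k * ternary (\<lambda>i. a (i + Suc k))"
    if "a \<in> binary_seqs" for a
  proof -
    have "(\<lambda>i. a (i + Suc k)) \<in> binary_seqs" using that by (simp add: binary_seqs_def)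
    from suminf_mult[OF summable_ternary_digits[OF this], of "(1/3) ^ Suc k"]
    show ?thesis by (simp add: ternary_def power_add mult_ac)
  qed
  have shift: "(\<lambda>i. a (i + Suc k)) \<in> binary_seqs" if "a \<in> binary_seqs" for a
    using that by (simp add: binary_seqs_def)
  have "ternary b = (1/3) ^ Suc k * ternary (\<lambda>i. b (i + Suc k)) + (\<Sum>i<Suc k. b i * (1/3) ^ i)"
    unfolding ternary_def[of b] by (subst split[OF b]) (simp only: tail[OF b])
  also have "(\<Sum>i<Suc k. b i * (1/3) ^ i) = (\<Sum>i<Suc k. b' i * (1/3) ^ i) - (1/3) ^ k"
    using eq k by simp
  \<comment> \<open>All digits after position \<open>k\<close> together contribute at most 3/2 times
    the next power, that is half of the unit \<open>(1/3) ^ k\<close> by which the two sums differ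
    at \<open>k\<close>.\<close>
  finally have "ternary b \<le> (1/3) ^ Suc k * (3/2) + ((\<Sum>i<Suc k. b' i * (1/3) ^ i) - (1/3) ^ k)"
    using mult_left_mono[OF ternary_bounds(2)[OF shift[OF b]] zero_le_power[of "1/3 :: real" "Suc k"]] by linarith
  also have "\<dots> < (\<Sum>i<Suc k. b' i * (1/3) ^ i)" by simp
  also have "\<dots> \<le> (1/3) ^ Suc k * ternary (\<lambda>i. b' (i + Suc k)) + (\<Sum>i<Suc k. b' i * (1/3) ^ i)"
    using mult_left_mono[OF ternary_bounds(1)[OF shift[OF b']] zero_le_power[of "1/3 :: real" "Suc k"]] by linarith
  also have "\<dots> = ternary b'"
    unfolding ternary_def[of b'] by (subst split[OF b']) (simp only: tail[OF b'])
  finally show ?thesis .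
qed

lemma inj_on_ternary: "inj_on ternary binary_seqs"
proof (rule inj_onI, rule ccontr)
  fix b b' assume b: "b \<in> binary_seqs" "b' \<in> binary_seqs" and eq: "ternary b = ternary b'" and "b \<noteq> b'"
  then obtain j where j: "b j \<noteq> b' j" by blast
  define k where "k = (LEAST j. b j \<noteq> b' j)"
  have k: "b k \<noteq> b' k" unfolding k_def using j by (rule LeastI)
  have less: "b i = b' i" if "i < k" for i using not_less_Least that unfolding k_def by blast
  have "b k \<in> {0, 1}" "b' k \<in> {0, 1}" using b unfolding binary_seqs_def by blast+
  then consider "b k = 0" "b' k = 1" | "b' k = 0" "b k = 1" using k by auto
  then show False
    using ternary_first_digit[OF b less] ternary_first_digit[OF b(2,1) less[symmetric]] eq
    by cases auto
qed

text \<open>Digit m of entry n is stored at position \<open>prod_encode (n, m)\<close>. Decoding is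
  continuous, while encoding jumps at dyadic numbers and is only Borel; the real coding below relies
  on exactly this division of labour.\<close>

definition encode :: "(nat \<Rightarrow> real) \<Rightarrow> nat \<Rightarrow> real" where
  "encode y i = binary_digit (snd (prod_decode i)) (y (fst (prod_decode i)))"

definition decode :: "(nat \<Rightarrow> real) \<Rightarrow> nat \<Rightarrow> real" where
  "decode b n = (\<Sum>m. b (prod_encode (n, m)) * (1 / 2 ^ Suc m))"

lemma encode_mem: "encode y \<in> binary_seqs"
  using binary_digit_cases by (simp add: encode_def binary_seqs_def)

lemma decode_encode:
  assumes "\<And>n. 0 \<le> y n \<and> y n < 1"
  shows "decode (encode y) = y"
  using binary_digit_sums assms by (auto simp: decode_def encode_def sums_iff)

lemma continuous_on_decode: "continuous_on binary_seqs decode"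
proof (rule continuous_on_coordinatewise_then_product)
  fix n
  have "summable (\<lambda>m. 1 / 2 * (1/2 :: real) ^ m)" by (intro summable_mult summable_geometric) simp
  then have "summable (\<lambda>m. 1 / 2 ^ Suc m :: real)" by (simp add: power_one_over)
  then show "continuous_on binary_seqs (\<lambda>b. decode b n)"
    unfolding decode_def by (rule continuous_on_digit_series) simp
qed

section \<open>Sequential compactness of spaces of probability measures\<close>

lemma borel_probsD:
  assumes "\<mu> \<in> borel_probs Z"
  shows "prob_space \<mu>" "space \<mu> = topspace Z" "sets \<mu> = sigma_sets (topspace Z) {U. openin Z U}"
  using assms by (auto simp: borel_probs_def)

lemma borel_measurable_continuous_map:
  assumes "continuous_map Z euclideanreal f"
    and "space M = topspace Z" "sets M = sigma_sets (topspace Z) {U. openin Z U}"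
  shows "f \<in> borel_measurable M"
proof (rule borel_measurableI)
  fix S :: "real set" assume "open S"
  then have "openin Z {x \<in> topspace Z. f x \<in> S}"
    using assms(1) by (auto simp: continuous_map_def)
  then show "f -` S \<inter> space M \<in> sets M"
    unfolding assms(2,3) by (intro sigma_sets.Basic) (auto simp: vimage_def Int_def conj_commute)
qed

lemma bounded_continuous_map:
  assumes "compact_space Z" "continuous_map Z euclideanreal f"
  obtains B where "0 \<le> B" "\<And>x. x \<in> topspace Z \<Longrightarrow> \<bar>f x\<bar> \<le> B"
proof -
  have "compactin euclideanreal (f ` topspace Z)"
    using image_compactin[OF _ assms(2)] assms(1) by (simp add: compact_space_def)
  then have "bounded (f ` topspace Z)" by (simp add: compact_imp_bounded)
  then obtain B where "\<And>x. x \<in> topspace Z \<Longrightarrow> norm (f x) \<le> B" by (auto simp: bounded_iff)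
  then show thesis by (intro that[of "max 0 B"]) (auto simp: le_max_iff_disj)
qed

lemma integrable_continuous_map:
  assumes "compact_space Z" "\<mu> \<in> borel_probs Z" "continuous_map Z euclideanreal f"
  shows "integrable \<mu> f"
proof -
  interpret prob_space \<mu> using borel_probsD[OF assms(2)] by simp
  obtain B where "\<And>x. x \<in> topspace Z \<Longrightarrow> \<bar>f x\<bar> \<le> B" using bounded_continuous_map[OF assms(1,3)] by blast
  then show ?thesis
    using borel_measurable_continuous_map[OF assms(3) borel_probsD(2,3)[OF assms(2)]]
    by (intro integrable_const_bound[of _ B]) (auto simp: borel_probsD[OF assms(2)])
qed

text \<open>A Borel coding \<open>s\<close> of \<open>Z\<close> by points of a compact set \<open>C\<close> of reals, with a continuous
  decoding \<open>r\<close>, reduces weak compactness to Helly's selection theorem.\<close>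

lemma exists_real_coding:
  fixes g :: "nat \<Rightarrow> 'a \<Rightarrow> real"
  assumes Z: "compact_space Z" and g: "\<And>n. continuous_map Z euclideanreal (g n)"
    and sep: "\<forall>x\<in>topspace Z. \<forall>y\<in>topspace Z. x \<noteq> y \<longrightarrow> (\<exists>n. g n x \<noteq> g n y)"
  shows "\<exists>(C :: real set) s r. compact C \<and>
    (\<forall>M. space M = topspace Z \<longrightarrow> sets M = sigma_sets (topspace Z) {U. openin Z U} \<longrightarrow>
      s \<in> borel_measurable M) \<and>
    continuous_map (top_of_set C) Z r \<and> (\<forall>x\<in>topspace Z. s x \<in> C \<and> r (s x) = x)"
proof -
  \<comment> \<open>Squeezes all separating functions into the open unit interval, where binary
    digits recover a number.\<close>
  define G where "G x n = 1/2 + arctan (g n x) / pi" for x n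
  have G01: "0 \<le> G x n \<and> G x n < 1" for x n
    using arctan_bounded[of "g n x"] unfolding G_def by (simp add: field_simps)
  have contGn: "continuous_map Z euclideanreal (\<lambda>x. G x n)" for n
  proof -
    have "continuous_on UNIV (\<lambda>y::real. 1/2 + arctan y / pi)" by (intro continuous_intros) simp
    then show ?thesis
      using continuous_map_compose[OF g[of n], of euclideanreal "\<lambda>y. 1/2 + arctan y / pi"]
      by (simp add: G_def o_def)
  qed
  have contG: "continuous_map Z euclidean G"
    unfolding euclidean_product_topology[symmetric] continuous_map_componentwise_UNIV
    using contGn by simp
  have injG: "inj_on G (topspace Z)"
  proof (rule inj_onI, rule ccontr)
    fix x y assume xy: "x \<in> topspace Z" "y \<in> topspace Z" "G x = G y" "x \<noteq> y"
    then obtain n where n: "g n x \<noteq> g n y" using sep by blast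
    have "G x n = G y n" using xy by simp
    then have "arctan (g n x) = arctan (g n y)" by (simp add: G_def)
    then show False using n by (simp add: arctan_eq_iff)
  qed
  define Y where "Y = G ` topspace Z"
  have cptY: "compact Y"
    using image_compactin[OF _ contG] Z by (simp add: compact_space_def Y_def)
  have "homeomorphic_map Z (top_of_set Y) G"
    by (intro continuous_imp_homeomorphic_map Z injG continuous_map_into_subtopology contG)
      (auto simp: Y_def Hausdorff_space_subtopology)
  then obtain G' where G': "homeomorphic_maps Z (top_of_set Y) G G'"
    by (auto simp: homeomorphic_map_maps)
  \<comment> \<open>All codes of points of \<open>Y\<close>, for instance both expansions of a
    dyadic entry; this makes the set closed, which the range of \<open>encode\<close> on
    \<open>Y\<close> need not be.\<close>
  define L where "L = {b \<in> binary_seqs. decode b \<in> Y}"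
  have "closed L"
    unfolding L_def using continuous_closed_preimage[OF continuous_on_decode
        compact_imp_closed[OF compact_binary_seqs] compact_imp_closed[OF cptY]]
    by (simp add: vimage_def Int_def)
  then have cptL: "compact L"
    using compact_Int_closed[OF compact_binary_seqs, of L] by (simp add: L_def Int_def conj_ac)
  have L: "L \<subseteq> binary_seqs" by (auto simp: L_def)
  define C where "C = ternary ` L"
  define t where "t = inv_into L ternary"
  have injL: "inj_on ternary L" using inj_on_subset[OF inj_on_ternary L] .
  have contt: "continuous_on C t"
    unfolding C_def t_def
    by (intro continuous_on_inv cptL continuous_on_subset[OF continuous_on_ternary L])
      (simp add: injL)
  have tL: "t u \<in> L" if "u \<in> C" for u using that unfolding C_def t_def by (rule inv_into_into)
  define s where "s x = ternary (encode (G x))" for x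
  have enc: "encode (G x) \<in> L" "decode (encode (G x)) = G x" if "x \<in> topspace Z" for x
    using that decode_encode[of "G x"] G01 encode_mem by (auto simp: L_def Y_def)
  show ?thesis
  proof (intro exI conjI allI impI ballI)
    show "compact C"
      unfolding C_def
      by (intro compact_continuous_image cptL continuous_on_subset[OF continuous_on_ternary L])
  next
    fix M assume M: "space M = topspace Z" "sets M = sigma_sets (topspace Z) {U. openin Z U}"
    have [measurable]: "(\<lambda>x. G x n) \<in> borel_measurable M" for n
      by (rule borel_measurable_continuous_map[OF contGn M])
    have "(\<lambda>x. encode (G x) i) \<in> borel_measurable M" for i
      unfolding encode_def binary_digit_def by measurable
    then show "s \<in> borel_measurable M" unfolding s_def ternary_def by measurable
  next
    have "continuous_on C (\<lambda>u. decode (t u))"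
      by (intro continuous_on_compose2[OF continuous_on_decode contt]) (use tL L in auto)
    then have "continuous_map (top_of_set C) (top_of_set Y) (\<lambda>u. decode (t u))"
      using tL by (auto simp: continuous_map_in_subtopology L_def)
    then show "continuous_map (top_of_set C) Z (G' \<circ> (\<lambda>u. decode (t u)))"
      using G' unfolding homeomorphic_maps_def by (blast intro: continuous_map_compose)
  next
    fix x assume x: "x \<in> topspace Z"
    have "t (s x) = encode (G x)" unfolding s_def t_def by (rule inv_into_f_f[OF injL enc(1)[OF x]])
    then show "s x \<in> C" "(G' \<circ> (\<lambda>u. decode (t u))) (s x) = x"
      using enc[OF x] G' x unfolding homeomorphic_maps_def by (auto simp: s_def C_def)
  qed
qed

text \<open>The laws of \<open>s\<close> live on the compact set \<open>C\<close>, so a subsequence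
  of them converges weakly to some \<nu>; the limit measure is the image of \<nu> under the decoding
  \<open>r\<close>. Although \<open>s\<close> need not be continuous, every continuous
  \<open>f\<close> equals \<open>h\<close> composed with \<open>s\<close>, where \<open>h\<close>
  extends \<open>f \<circ> r\<close> continuously to the line.\<close>

theorem borel_probs_convergent_subsequence:
  fixes g :: "nat \<Rightarrow> 'a \<Rightarrow> real" and \<mu> :: "nat \<Rightarrow> 'a measure"
  assumes Z: "compact_space Z" and g: "\<And>n. continuous_map Z euclideanreal (g n)"
    and sep: "\<forall>x\<in>topspace Z. \<forall>y\<in>topspace Z. x \<noteq> y \<longrightarrow> (\<exists>n. g n x \<noteq> g n y)"
    and \<mu>: "\<And>n. \<mu> n \<in> borel_probs Z"
  shows "\<exists>(l :: nat \<Rightarrow> nat) M. strict_mono l \<and> limitin (weak_topology Z) (\<mu> \<circ> l) M sequentially"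
proof -
  obtain C :: "real set" and s r where C: "compact C"
    and s: "\<And>M. space M = topspace Z \<Longrightarrow> sets M = sigma_sets (topspace Z) {U. openin Z U} \<Longrightarrow> s \<in> borel_measurable M"
    and r: "continuous_map (top_of_set C) Z r"
    and rs: "\<And>x. x \<in> topspace Z \<Longrightarrow> s x \<in> C" "\<And>x. x \<in> topspace Z \<Longrightarrow> r (s x) = x"
    using exists_real_coding[OF Z g sep] by blast
  interpret \<mu>: prob_space "\<mu> n" for n using borel_probsD[OF \<mu>] by simp
  note space_\<mu> = borel_probsD(2)[OF \<mu>] and sets_\<mu> = borel_probsD(3)[OF \<mu>]
  have sm [measurable]: "s \<in> borel_measurable (\<mu> n)" for n by (rule s[OF space_\<mu> sets_\<mu>])
  obtain x0 where x0: "x0 \<in> topspace Z" using \<mu>.not_empty[of 0] space_\<mu>[of 0] by blast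
  have clC: "closed C" and neC: "C \<noteq> {}" using C rs(1)[OF x0] by (auto simp: compact_imp_closed)
  define N where "N n = distr (\<mu> n) borel s" for n
  have N: "real_distribution (N n)" for n
    unfolding N_def by (simp add: \<mu>.real_distribution_distr)
  have "bounded C" using C by (rule compact_imp_bounded)
  then obtain B where "\<And>u. u \<in> C \<Longrightarrow> norm u \<le> B" by (auto simp: bounded_iff)
  then have B: "\<And>u. u \<in> C \<Longrightarrow> \<bar>u\<bar> \<le> B" by simp
  have "tight N"
    unfolding tight_def
  proof (intro conjI allI impI N)
    fix \<epsilon> :: real assume "\<epsilon> > 0"
    \<comment> \<open>Tightness asks for intervals open on the left; the extra 1 keeps the point
      \<open>- B\<close> inside.\<close>
    have "measure (N n) {- B - 1 <.. B} = 1" for n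
    proof -
      have "s -` {- B - 1 <.. B} \<inter> space (\<mu> n) = space (\<mu> n)"
        using B rs(1) unfolding space_\<mu> by (force simp: abs_le_iff)
      then show ?thesis unfolding N_def by (subst measure_distr) (auto simp: \<mu>.prob_space)
    qed
    moreover have "- B - 1 < B" using B[OF rs(1)[OF x0]] by linarith
    ultimately show "\<exists>a b. a < b \<and> (\<forall>n. 1 - \<epsilon> < measure (N n) {a<..b})"
      using \<open>\<epsilon> > 0\<close> by (intro exI[of _ "- B - 1"] exI[of _ B]) auto
  qed
  from tight_imp_convergent_subsubsequence[OF this, of id] obtain l \<nu>
    where l: "strict_mono l" and \<nu>: "real_distribution \<nu>" and lim: "weak_conv_m (N \<circ> l) \<nu>"
    by (auto simp: strict_mono_def)
  interpret \<nu>: real_distribution \<nu> by fact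
  have conv: "(\<lambda>n. \<integral>x. h (s x) \<partial>\<mu> (l n)) \<longlonglongrightarrow> (\<integral>u. h u \<partial>\<nu>)"
    if h: "continuous_on UNIV h" and b: "\<And>u. \<bar>h u\<bar> \<le> b" for h :: "real \<Rightarrow> real" and b
  proof -
    have hm: "h \<in> borel_measurable borel" using h by (rule borel_measurable_continuous_onI)
    have "(\<lambda>n. integral\<^sup>L ((N \<circ> l) n) h) \<longlonglongrightarrow> integral\<^sup>L \<nu> h"
      by (rule weak_conv_imp_integral_bdd_continuous_conv[where B = b])
        (use N \<nu> lim h b in \<open>auto simp: continuous_on_eq_continuous_at comp_def\<close>)
    then show ?thesis by (simp add: N_def integral_distr[OF sm hm])
  qed
  \<comment> \<open>A bounded continuous function whose zero set is \<open>C\<close>. Its integrals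
    along the sequence vanish, hence so does the limit, and \<nu> is concentrated on
    \<open>C\<close>.\<close>
  define h0 where "h0 u = min 1 (infdist u C)" for u :: real
  have h0: "continuous_on UNIV h0" unfolding h0_def by (intro continuous_intros)
  have h0b: "0 \<le> h0 u" "\<bar>h0 u\<bar> \<le> 1" for u by (auto simp: h0_def infdist_nonneg)
  have "(\<integral>x. h0 (s x) \<partial>\<mu> (l n)) = 0" for n
  proof -
    have "(\<integral>x. h0 (s x) \<partial>\<mu> (l n)) = (\<integral>x. 0 \<partial>\<mu> (l n))"
      using rs(1) by (intro Bochner_Integration.integral_cong) (auto simp: space_\<mu> h0_def)
    then show ?thesis by simp
  qed
  then have "(\<integral>u. h0 u \<partial>\<nu>) = 0"
    using conv[OF h0 h0b(2)] by (simp add: LIMSEQ_const_iff)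
  moreover have "integrable \<nu> h0"
    using h0b(2) borel_measurable_continuous_onI[OF h0] by (intro \<nu>.integrable_const_bound[of _ 1]) auto
  ultimately have "AE u in \<nu>. h0 u = 0"
    using integral_nonneg_eq_0_iff_AE[of \<nu> h0] h0b(1) by simp
  then have aeC: "AE u in \<nu>. u \<in> C"
    by eventually_elim (use in_closed_iff_infdist_zero[OF clC neC] in \<open>auto simp: h0_def min_def split: if_splits\<close>)
  \<comment> \<open>The value \<open>x0\<close> off \<open>C\<close> is a default, met only on a
    \<nu>-null set.\<close>
  define r' where "r' u = (if u \<in> C then r u else x0)" for u
  have r'Z: "r' u \<in> topspace Z" for u
    using x0 continuous_map_image_subset_topspace[OF r] by (auto simp: r'_def)
  define S where "S = sigma (topspace Z) {U. openin Z U}"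
  have sub: "{U. openin Z U} \<subseteq> Pow (topspace Z)" by (auto dest: openin_subset)
  have S: "space S = topspace Z" "sets S = sigma_sets (topspace Z) {U. openin Z U}"
    using sub by (auto simp: S_def space_measure_of_conv)
  have r'm: "r' \<in> measurable \<nu> S"
    unfolding S_def
  proof (rule measurable_measure_of[OF sub])
    fix U assume "U \<in> {U. openin Z U}"
    then have "openin (top_of_set C) {u \<in> C. r u \<in> U}"
      using r by (auto simp: continuous_map_def)
    then obtain V where V: "open V" "{u \<in> C. r u \<in> U} = C \<inter> V" by (auto simp: openin_open)
    have "r' -` U \<inter> space \<nu> = (C \<inter> V) \<union> (if x0 \<in> U then - C else {})"
      unfolding V(2)[symmetric] by (auto simp: r'_def split: if_splits)
    then show "r' -` U \<inter> space \<nu> \<in> sets \<nu>" using V(1) clC by auto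
  qed (use r'Z in auto)
  define M where "M = distr \<nu> S r'"
  have MP: "M \<in> borel_probs Z"
    unfolding borel_probs_def M_def using \<nu>.prob_space_distr[OF r'm] S by auto
  have "(\<lambda>n. \<integral>x. f x \<partial>\<mu> (l n)) \<longlonglongrightarrow> (\<integral>x. f x \<partial>M)"
    if f: "continuous_map Z euclideanreal f" for f
  proof -
    obtain b where b: "0 \<le> b" "\<And>x. x \<in> topspace Z \<Longrightarrow> \<bar>f x\<bar> \<le> b"
      using bounded_continuous_map[OF Z f] by blast
    have "continuous_on C (f \<circ> r)"
      using continuous_map_compose[OF r f] by simp
    \<comment> \<open>Weak convergence of laws is tested on bounded continuous functions of the
      whole line, so the extension has to keep the bound \<open>b\<close>.\<close>
    then obtain h where h: "continuous_on UNIV h" "\<And>u. u \<in> C \<Longrightarrow> h u = f (r u)" "\<And>u. \<bar>h u\<bar> \<le> b"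
      using Tietze[of C "f \<circ> r" UNIV b] b clC continuous_map_image_subset_topspace[OF r]
      by (auto simp: image_subset_iff)
    have "(\<integral>x. h (s x) \<partial>\<mu> (l n)) = (\<integral>x. f x \<partial>\<mu> (l n))" for n
      using h(2) rs by (intro Bochner_Integration.integral_cong) (auto simp: space_\<mu>)
    moreover have "(\<integral>u. h u \<partial>\<nu>) = (\<integral>x. f x \<partial>M)"
    proof -
      have fm: "f \<in> borel_measurable S" by (rule borel_measurable_continuous_map[OF f S])
      have "(\<integral>x. f x \<partial>M) = (\<integral>u. f (r' u) \<partial>\<nu>)"
        unfolding M_def by (rule integral_distr[OF r'm fm])
      also have "\<dots> = (\<integral>u. h u \<partial>\<nu>)"
      proof (rule integral_cong_AE)
        show "(\<lambda>u. f (r' u)) \<in> borel_measurable \<nu>" using measurable_compose[OF r'm fm] .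
        show "h \<in> borel_measurable \<nu>" using borel_measurable_continuous_onI[OF h(1)] by simp
        show "AE u in \<nu>. f (r' u) = h u" using aeC by eventually_elim (simp add: r'_def h(2))
      qed
      finally show ?thesis ..
    qed
    ultimately show ?thesis using conv[OF h(1,3)] by simp
  qed
  then have "limitin (weak_topology Z) (\<mu> \<circ> l) M sequentially"
    unfolding limitin_weak_topology using MP \<mu> by simp
  with l show ?thesis by blast
qed

section \<open>Gaussian kernels on spaces of probability measures\<close>

lemma L2_set_union_le:
  assumes "finite A" "finite B"
  shows "L2_set f (A \<union> B) \<le> L2_set f A + L2_set f B"
proof -
  have "(\<Sum>i\<in>A \<union> B. (f i)\<^sup>2) \<le> (\<Sum>i\<in>A. (f i)\<^sup>2) + (\<Sum>i\<in>B. (f i)\<^sup>2)"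
    using sum.union_inter[OF assms, of "\<lambda>i. (f i)\<^sup>2"] sum_nonneg[of "A \<inter> B" "\<lambda>i. (f i)\<^sup>2"] by simp
  then have "L2_set f (A \<union> B) \<le> sqrt ((\<Sum>i\<in>A. (f i)\<^sup>2) + (\<Sum>i\<in>B. (f i)\<^sup>2))"
    unfolding L2_set_def by (rule real_sqrt_le_mono)
  also have "\<dots> \<le> L2_set f A + L2_set f B"
    unfolding L2_set_def by (intro sqrt_add_le_add_sqrt sum_nonneg) auto
  finally show ?thesis .
qed

lemma (in prob_space) expectation_sq_le:
  fixes f :: "'a \<Rightarrow> real"
  assumes "integrable M f" "integrable M (\<lambda>x. (f x)\<^sup>2)"
  shows "(expectation f)\<^sup>2 \<le> expectation (\<lambda>x. (f x)\<^sup>2)"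
  using variance_positive[of f] variance_eq[OF assms] by simp

text \<open>Jensen's inequality for the square, summed over \<open>F\<close>: bounds on finite
  sections that hold at each point pass to the means.\<close>

lemma L2_set_integral_le:
  assumes Z: "compact_space Z" and \<mu>: "\<mu> \<in> borel_probs Z" and F: "finite F"
    and f: "\<And>w. continuous_map Z euclideanreal (f w)"
    and le: "\<And>x. x \<in> topspace Z \<Longrightarrow> L2_set (\<lambda>w. f w x) F \<le> \<epsilon>"
  shows "L2_set (\<lambda>w. \<integral>x. f w x \<partial>\<mu>) F \<le> \<epsilon>"
proof -
  interpret prob_space \<mu> using borel_probsD[OF \<mu>] by simp
  obtain x0 where "x0 \<in> topspace Z" using not_empty borel_probsD(2)[OF \<mu>] by blast
  then have \<epsilon>: "0 \<le> \<epsilon>" using le[of x0] L2_set_nonneg order_trans by blast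
  have f2: "continuous_map Z euclideanreal (\<lambda>x. (f w x)\<^sup>2)" for w
    by (intro continuous_map_real_pow f)
  note int = integrable_continuous_map[OF Z \<mu>]
  have "(\<Sum>w\<in>F. (\<integral>x. f w x \<partial>\<mu>)\<^sup>2) \<le> (\<Sum>w\<in>F. \<integral>x. (f w x)\<^sup>2 \<partial>\<mu>)"
    by (intro sum_mono expectation_sq_le int f f2)
  also have "\<dots> = (\<integral>x. (\<Sum>w\<in>F. (f w x)\<^sup>2) \<partial>\<mu>)"
    by (intro Bochner_Integration.integral_sum[symmetric] int f2)
  also have "\<dots> \<le> (\<integral>x. \<epsilon>\<^sup>2 \<partial>\<mu>)"
  proof (intro integral_mono Bochner_Integration.integrable_sum int f2)
    fix x assume "x \<in> space \<mu>"
    then have "(L2_set (\<lambda>w. f w x) F)\<^sup>2 \<le> \<epsilon>\<^sup>2"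
      using le[of x] by (intro power_mono) (auto simp: borel_probsD[OF \<mu>])
    then show "(\<Sum>w\<in>F. (f w x)\<^sup>2) \<le> \<epsilon>\<^sup>2" by (simp add: L2_set_def sum_nonneg)
  qed simp
  also have "\<dots> = \<epsilon>\<^sup>2" by (simp add: prob_space)
  finally show ?thesis unfolding L2_set_def using \<epsilon> by (intro real_le_lsqrt) auto
qed

definition mean :: "('a \<Rightarrow> 'i ell2) \<Rightarrow> 'a measure \<Rightarrow> 'i ell2" where
  "mean S \<mu> = Ell2 (\<lambda>w. \<integral>x. coord (S x) w \<partial>\<mu>)"

text \<open>Everything that is used of the signature map. In \<open>mult\<close> the list depends on
  \<open>u\<close> and \<open>v\<close> but not on the point, and may repeat entries, as shuffles
  do. Countably many coordinates form the separating sequence for the selection theorem.\<close>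

locale compact_feature =
  fixes Z :: "'a topology" and S :: "'a \<Rightarrow> 'i::countable ell2"
  assumes compact: "compact_space Z"
    and S: "continuous_map Z euclidean S"
    and inj: "inj_on S (topspace Z)"
    and one: "\<exists>w. \<forall>x\<in>topspace Z. coord (S x) w = 1"
    and mult: "\<exists>ws. \<forall>x\<in>topspace Z. coord (S x) u * coord (S x) v = (\<Sum>w\<leftarrow>ws. coord (S x) w)"
begin

abbreviation "P \<equiv> borel_probs Z"

lemma continuous_map_compose_S: "continuous_on (S ` topspace Z) f \<Longrightarrow> continuous_map Z euclidean (\<lambda>x. f (S x))"
proof -
  assume f: "continuous_on (S ` topspace Z) f"
  have "continuous_map Z (top_of_set (S ` topspace Z)) S"
    by (intro continuous_map_into_subtopology S) auto
  then show ?thesis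
    using continuous_map_compose[of Z _ S euclidean f] f by (simp add: o_def)
qed

lemma continuous_coord_S: "continuous_map Z euclideanreal (\<lambda>x. coord (S x) w)"
  by (intro continuous_map_compose_S continuous_intros)

lemma compact_image_S: "compact (S ` topspace Z)"
  using image_compactin[OF _ S] compact by (simp add: compact_space_def)

lemma coord_mean:
  assumes "\<mu> \<in> P"
  shows "coord (mean S \<mu>) w = (\<integral>x. coord (S x) w \<partial>\<mu>)"
proof -
  have "continuous_map Z euclideanreal (\<lambda>x. norm (S x))"
    by (intro continuous_map_compose_S continuous_intros)
  then obtain B where B: "\<And>x. x \<in> topspace Z \<Longrightarrow> \<bar>norm (S x)\<bar> \<le> B"
    using bounded_continuous_map[OF compact] by blast
  have "L2_set (\<lambda>w. \<integral>x. coord (S x) w \<partial>\<mu>) F \<le> B" if "finite F" for F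
  proof (rule L2_set_integral_le[OF compact assms that continuous_coord_S])
    fix x assume "x \<in> topspace Z"
    then show "L2_set (\<lambda>w. coord (S x) w) F \<le> B"
      using L2_set_coord_le[OF that, of "S x"] B[of x] by simp
  qed
  then show ?thesis unfolding mean_def by (subst coord_Ell2_finite_bound) auto
qed

lemma mean_tail_le:
  assumes "\<epsilon> > 0"
  shows "\<exists>F. finite F \<and> (\<forall>\<mu>\<in>P. \<forall>G. finite G \<and> G \<inter> F = {} \<longrightarrow> L2_set (coord (mean S \<mu>)) G \<le> \<epsilon>)"
proof -
  obtain F where F: "finite F"
    "\<And>x G. x \<in> topspace Z \<Longrightarrow> finite G \<Longrightarrow> G \<inter> F = {} \<Longrightarrow> L2_set (coord (S x)) G \<le> \<epsilon>"
    using compact_ell2_tail_le[OF compact_image_S assms] by blast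
  have "L2_set (coord (mean S \<mu>)) G \<le> \<epsilon>" if "\<mu> \<in> P" "finite G" "G \<inter> F = {}" for \<mu> G
    using L2_set_integral_le[OF compact that(1,2) continuous_coord_S F(2)[OF _ that(2,3)]]
    by (simp add: coord_mean[OF that(1)] cong: L2_set_cong)
  with F(1) show ?thesis by blast
qed

lemma continuous_map_mean: "continuous_map (weak_topology Z) euclidean (mean S)"
  unfolding continuous_map_atin limitin_canonical_iff topspace_weak_topology
proof
  fix \<mu> assume \<mu>: "\<mu> \<in> P"
  let ?F = "atin (weak_topology Z) \<mu>"
  have "limitin (weak_topology Z) (\<lambda>\<nu>. \<nu>) \<mu> ?F"
    using continuous_map_atin[THEN iffD1, OF continuous_map_id, rule_format, of \<mu> "weak_topology Z"] \<mu>
    by (simp add: id_def)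
  then have evP: "\<forall>\<^sub>F \<nu> in ?F. \<nu> \<in> P"
    and lim: "\<And>f. continuous_map Z euclideanreal f \<Longrightarrow> ((\<lambda>\<nu>. \<integral>x. f x \<partial>\<nu>) \<longlongrightarrow> (\<integral>x. f x \<partial>\<mu>)) ?F"
    unfolding limitin_weak_topology by blast+
  show "(mean S \<longlongrightarrow> mean S \<mu>) ?F"
  proof (rule tendstoI)
    fix \<epsilon> :: real assume \<epsilon>: "\<epsilon> > 0"
    then obtain F where F: "finite F"
      "\<And>\<nu> G. \<nu> \<in> P \<Longrightarrow> finite G \<Longrightarrow> G \<inter> F = {} \<Longrightarrow> L2_set (coord (mean S \<nu>)) G \<le> \<epsilon> / 4"
      using mean_tail_le[of "\<epsilon> / 4"] by auto
    have "((\<lambda>\<nu>. L2_set (\<lambda>w. (\<integral>x. coord (S x) w \<partial>\<nu>) - (\<integral>x. coord (S x) w \<partial>\<mu>)) F) \<longlongrightarrow>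
        L2_set (\<lambda>w. (\<integral>x. coord (S x) w \<partial>\<mu>) - (\<integral>x. coord (S x) w \<partial>\<mu>)) F) ?F"
      unfolding L2_set_def by (intro tendsto_intros lim continuous_coord_S)
    then have "((\<lambda>\<nu>. L2_set (\<lambda>w. (\<integral>x. coord (S x) w \<partial>\<nu>) - (\<integral>x. coord (S x) w \<partial>\<mu>)) F) \<longlongrightarrow> 0) ?F"
      by (simp add: L2_set_def)
    then have "\<forall>\<^sub>F \<nu> in ?F. L2_set (\<lambda>w. (\<integral>x. coord (S x) w \<partial>\<nu>) - (\<integral>x. coord (S x) w \<partial>\<mu>)) F < \<epsilon> / 4"
      using \<epsilon> by (intro order_tendstoD) auto
    with evP show "\<forall>\<^sub>F \<nu> in ?F. dist (mean S \<nu>) (mean S \<mu>) < \<epsilon>"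
    proof eventually_elim
      case (elim \<nu>)
      \<comment> \<open>One quarter for the coordinates in \<open>F\<close>, where weak convergence
        acts, and one for the tail of each of the two means.\<close>
      have "norm (mean S \<nu> - mean S \<mu>) \<le> 3 * \<epsilon> / 4"
      proof (rule norm_ell2_leI)
        fix G :: "'i set" assume G: "finite G"
        let ?d = "coord (mean S \<nu> - mean S \<mu>)"
        have "L2_set ?d G \<le> L2_set ?d (G \<inter> F) + L2_set ?d (G - F)"
          using L2_set_union_le[of "G \<inter> F" "G - F" ?d] G by (simp add: Int_Diff_Un)
        also have "L2_set ?d (G \<inter> F) \<le> L2_set ?d F"
          unfolding L2_set_def using F(1) by (intro real_sqrt_le_mono sum_mono2) auto
        also have "L2_set ?d F \<le> \<epsilon> / 4"
          using elim \<mu> by (simp add: coord_mean)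
        also have "L2_set ?d (G - F) \<le> L2_set (coord (mean S \<nu>)) (G - F) + L2_set (\<lambda>w. - coord (mean S \<mu>) w) (G - F)"
          using L2_set_triangle_ineq[of "coord (mean S \<nu>)" "\<lambda>w. - coord (mean S \<mu>) w" "G - F"] by simp
        also have "L2_set (\<lambda>w. - coord (mean S \<mu>) w) (G - F) = L2_set (coord (mean S \<mu>)) (G - F)"
          by (simp add: L2_set_def)
        also have "\<dots> \<le> \<epsilon> / 4" using \<mu> G by (intro F(2)) auto
        also have "L2_set (coord (mean S \<nu>)) (G - F) \<le> \<epsilon> / 4" using elim(1) G by (intro F(2)) auto
        finally show "L2_set ?d G \<le> 3 * \<epsilon> / 4" by simp
      qed
      then show ?case using \<epsilon> by (simp add: dist_norm)
    qed
  qed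
qed

text \<open>A sequence in the image is lifted to measures, a weakly convergent subsequence is
  selected, and continuity of the mean carries it back. The general \<open>A\<close> serves twice:
  for all measures, and for preimages of closed sets in \<open>factor_through_mean\<close>.\<close>

lemma compact_image_mean:
  assumes "A \<subseteq> P"
    and closed: "\<And>\<mu> M. (\<And>n. \<mu> n \<in> A) \<Longrightarrow> limitin (weak_topology Z) \<mu> M sequentially \<Longrightarrow> M \<in> A"
  shows "compact (mean S ` A)"
  unfolding compact_eq_seq_compact_metric seq_compact_def
proof (intro allI impI)
  fix y :: "nat \<Rightarrow> 'i ell2" assume "\<forall>n. y n \<in> mean S ` A"
  then have "\<forall>n. \<exists>\<mu>. \<mu> \<in> A \<and> y n = mean S \<mu>" by blast
  then obtain \<mu> where \<mu>: "\<And>n. \<mu> n \<in> A" "\<And>n. y n = mean S (\<mu> n)"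
    using choice[of "\<lambda>n \<mu>. \<mu> \<in> A \<and> y n = mean S \<mu>"] by blast
  have sep: "\<forall>x\<in>topspace Z. \<forall>x'\<in>topspace Z. x \<noteq> x' \<longrightarrow>
      (\<exists>n. coord (S x) (from_nat n) \<noteq> coord (S x') (from_nat n))"
  proof (intro ballI impI)
    fix x x' assume "x \<in> topspace Z" "x' \<in> topspace Z" "x \<noteq> x'"
    then have "S x \<noteq> S x'" using inj by (auto dest: inj_onD)
    then obtain w where "coord (S x) w \<noteq> coord (S x') w" using ell2_eq_iff by blast
    then show "\<exists>n. coord (S x) (from_nat n) \<noteq> coord (S x') (from_nat n)"
      by (intro exI[of _ "to_nat w"]) simp
  qed
  obtain l M where l: "strict_mono l" "limitin (weak_topology Z) (\<mu> \<circ> l) M sequentially"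
    using borel_probs_convergent_subsequence[OF compact continuous_coord_S sep, of \<mu>]
      subsetD[OF assms(1) \<mu>(1)]
    by blast
  have "M \<in> A" using closed[OF _ l(2)] \<mu>(1) by simp
  moreover have "(y \<circ> l) \<longlonglongrightarrow> mean S M"
    using continuous_map_limit[OF continuous_map_mean l(2)] by (simp add: \<mu>(2) o_def)
  ultimately show "\<exists>l'\<in>mean S ` A. \<exists>r. strict_mono r \<and> (y \<circ> r) \<longlonglongrightarrow> l'"
    using l(1) by blast
qed

text \<open>A continuous injection of a compact space into a Hausdorff space is a homeomorphism onto
  its image, so \<open>h\<close> may be viewed on the image of \<open>S\<close>. There it is
  approximated by linear combinations of coordinates, whose integrals are read off from the
  mean.\<close>

lemma integral_eq_of_mean_eq:
  assumes P: "\<mu> \<in> P" "\<nu> \<in> P" and eq: "mean S \<mu> = mean S \<nu>" and h: "continuous_map Z euclideanreal h"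
  shows "(\<integral>x. h x \<partial>\<mu>) = (\<integral>x. h x \<partial>\<nu>)"
proof -
  let ?Y = "S ` topspace Z" and ?B = "range (\<lambda>w (y :: 'i ell2). coord y w)"
  have "homeomorphic_map Z (top_of_set ?Y) S"
    by (intro continuous_imp_homeomorphic_map compact inj continuous_map_into_subtopology S)
      (auto simp: Hausdorff_space_subtopology)
  then obtain S' where S': "homeomorphic_maps Z (top_of_set ?Y) S S'"
    by (auto simp: homeomorphic_map_maps)
  have "continuous_map (top_of_set ?Y) euclideanreal (h \<circ> S')"
    using S' h unfolding homeomorphic_maps_def by (blast intro: continuous_map_compose)
  then have contY: "continuous_on ?Y (h \<circ> S')" by simp
  have S'S: "S' (S x) = x" if "x \<in> topspace Z" for x
    using S' that unfolding homeomorphic_maps_def by blast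
  have contB: "continuous_on ?Y b" if "b \<in> ?B" for b
    using that by (auto intro: continuous_on_coord continuous_on_id)
  have contp: "continuous_map Z euclideanreal (\<lambda>x. p (S x))" if "p \<in> fspan ?B" for p
    by (rule continuous_map_compose_S[OF continuous_on_fspan[OF contB that]])
  note int = integrable_continuous_map[OF compact]
  have p_eq: "(\<integral>x. p (S x) \<partial>\<mu>) = (\<integral>x. p (S x) \<partial>\<nu>)" if "p \<in> fspan ?B" for p
    using that
  proof (induction p rule: fspan.induct)
    case (fspan_step b p r)
    then obtain w where b: "b = (\<lambda>y. coord y w)" by blast
    have "(\<integral>x. r * coord (S x) w + p (S x) \<partial>M) = r * coord (mean S M) w + (\<integral>x. p (S x) \<partial>M)"
      if "M \<in> P" for M
      using int[OF that contp[OF fspan_step(2)]] int[OF that continuous_coord_S] coord_mean[OF that]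
      by simp
    then show ?case using P fspan_step.IH eq by (simp add: b)
  qed simp
  have "\<bar>(\<integral>x. h x \<partial>\<mu>) - (\<integral>x. h x \<partial>\<nu>)\<bar> \<le> 0 + \<epsilon>" if "\<epsilon> > 0" for \<epsilon>
  proof -
    have "\<exists>p\<in>fspan ?B. \<forall>y\<in>?Y. \<bar>(h \<circ> S') y - p y\<bar> < \<epsilon> / 2"
    proof (rule Stone_Weierstrass_fspan[OF compact_image_S])
      show "continuous_on ?Y b" if "b \<in> ?B" for b using that by (rule contB)
      show "\<exists>p\<in>fspan ?B. \<forall>x\<in>?Y. b x * b' x = p x" if "b \<in> ?B" "b' \<in> ?B" for b b'
      proof -
        from that obtain u v where b: "b = (\<lambda>y. coord y u)" "b' = (\<lambda>y. coord y v)" by blast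
        obtain ws where "\<forall>x\<in>topspace Z. coord (S x) u * coord (S x) v = (\<Sum>w\<leftarrow>ws. coord (S x) w)"
          using mult by blast
        moreover have "(\<lambda>y. \<Sum>w\<leftarrow>ws. coord y w) \<in> fspan ?B"
          by (intro fspan_sum_list fspan_base) auto
        ultimately show ?thesis unfolding b by (intro bexI[of _ "\<lambda>y. \<Sum>w\<leftarrow>ws. coord y w"]) auto
      qed
      obtain w where "\<forall>x\<in>topspace Z. coord (S x) w = 1" using one by blast
      then show "\<exists>p\<in>fspan ?B. \<forall>x\<in>?Y. p x = 1"
        by (intro bexI[of _ "\<lambda>y. coord y w"] fspan_base) auto
      show "\<exists>b\<in>?B. b x \<noteq> b y" if "x \<noteq> y" for x y
        using that ell2_eq_iff[of x y] by auto
    qed (use contY \<open>\<epsilon> > 0\<close> in auto)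
    then obtain p where p: "p \<in> fspan ?B" "\<And>x. x \<in> topspace Z \<Longrightarrow> \<bar>h x - p (S x)\<bar> < \<epsilon> / 2"
      using S'S by auto
    have "\<bar>(\<integral>x. h x \<partial>M) - (\<integral>x. p (S x) \<partial>M)\<bar> \<le> \<epsilon> / 2" if M: "M \<in> P" for M
    proof -
      interpret M: prob_space M using borel_probsD[OF M] by simp
      have "\<bar>(\<integral>x. h x \<partial>M) - (\<integral>x. p (S x) \<partial>M)\<bar> = \<bar>\<integral>x. h x - p (S x) \<partial>M\<bar>"
        by (subst Bochner_Integration.integral_diff[OF int[OF M h] int[OF M contp[OF p(1)]]]) simp
      also have "\<dots> \<le> (\<integral>x. \<bar>h x - p (S x)\<bar> \<partial>M)" by (rule integral_abs_bound)
      also have "\<dots> \<le> (\<integral>x. \<epsilon> / 2 \<partial>M)"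
        using p(2) int[OF M h] int[OF M contp[OF p(1)]]
        by (intro integral_mono) (auto simp: borel_probsD[OF M] less_imp_le)
      also have "\<dots> = \<epsilon> / 2" by (simp add: M.prob_space)
      finally show ?thesis .
    qed
    from this[OF P(1)] this[OF P(2)] p_eq[OF p(1)] show ?thesis by linarith
  qed
  then have "\<bar>(\<integral>x. h x \<partial>\<mu>) - (\<integral>x. h x \<partial>\<nu>)\<bar> \<le> 0" by (rule field_le_epsilon)
  then show ?thesis by simp
qed

text \<open>The preimage of a closed set under \<open>g\<close> is the image under the mean of a
  sequentially closed set of measures, hence compact and closed.\<close>

lemma factor_through_mean:
  assumes f: "continuous_map (weak_topology Z) euclideanreal f"
  obtains g where "continuous_on (mean S ` P) g" "\<And>\<mu>. \<mu> \<in> P \<Longrightarrow> g (mean S \<mu>) = f \<mu>"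
proof -
  have f_eq: "f \<mu> = f \<nu>" if "\<mu> \<in> P" "\<nu> \<in> P" "mean S \<mu> = mean S \<nu>" for \<mu> \<nu>
  proof -
    \<comment> \<open>Since \<mu> and \<nu> give all continuous functions the same integral, the
      constant sequence \<mu> converges to \<nu>, and a continuous \<open>f\<close> cannot tell them
      apart. No equality of measures has to be derived.\<close>
    have "limitin (weak_topology Z) (\<lambda>n. \<mu>) \<nu> sequentially"
      using that integral_eq_of_mean_eq[OF that] by (simp add: limitin_weak_topology)
    from continuous_map_limit[OF f this] show ?thesis by (simp add: o_def LIMSEQ_const_iff)
  qed
  define g where "g y = f (SOME \<mu>. \<mu> \<in> P \<and> mean S \<mu> = y)" for y
  have g: "g (mean S \<mu>) = f \<mu>" if "\<mu> \<in> P" for \<mu>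
    unfolding g_def by (rule someI2[of _ \<mu>]) (use that f_eq in blast)+
  have "continuous_on (mean S ` P) g"
  proof (rule continuous_on_closed_vimage[THEN iffD2, rule_format])
    show "closed (mean S ` P)"
      by (intro compact_imp_closed compact_image_mean) (auto simp: limitin_weak_topology)
    fix T :: "real set" assume T: "closed T"
    have "M \<in> {\<mu> \<in> P. f \<mu> \<in> T}"
      if "\<And>n. \<mu> n \<in> {\<mu> \<in> P. f \<mu> \<in> T}" "limitin (weak_topology Z) \<mu> M sequentially" for \<mu> M
    proof -
      have "(\<lambda>n. f (\<mu> n)) \<longlonglongrightarrow> f M"
        using continuous_map_limit[OF f that(2)] by (simp add: o_def)
      moreover have "f (\<mu> n) \<in> T" for n using that(1)[of n] by simp
      ultimately have "f M \<in> T" using closed_sequentially[OF T, of "\<lambda>n. f (\<mu> n)"] by blast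
      then show ?thesis using that(2) by (simp add: limitin_weak_topology)
    qed
    then have "closed (mean S ` {\<mu> \<in> P. f \<mu> \<in> T})"
      by (intro compact_imp_closed compact_image_mean) blast+
    also have "mean S ` {\<mu> \<in> P. f \<mu> \<in> T} = g -` T \<inter> mean S ` P" using g by auto
    finally show "closed (g -` T \<inter> mean S ` P)" .
  qed
  with g that show thesis by blast
qed

text \<open>A span element \<open>v\<close> of the features pairs with the features as a finite
  combination of kernel sections. Such a combination belongs to every Hilbert space with this
  kernel, whatever \<open>H\<close> is.\<close>

theorem universal_kernel_gauss_mean:
  assumes \<sigma>: "\<sigma> > 0"
  shows "universal_kernel (weak_topology Z) (\<lambda>\<mu> \<nu>. exp (- (\<sigma>\<^sup>2) * (norm (mean S \<mu> - mean S \<nu>))\<^sup>2))"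
  unfolding universal_kernel_def topspace_weak_topology sup_dense_in_continuous_def
proof (intro conjI allI impI)
  let ?k = "\<lambda>\<mu> \<nu>. exp (- (\<sigma>\<^sup>2) * (norm (mean S \<mu> - mean S \<nu>))\<^sup>2)"
  show "\<exists>H ip. rkhs P ?k H ip"
    by (rule rkhs_of_feature_map[of _ _ "\<lambda>\<mu>. gauss_feature \<sigma> (mean S \<mu>)"])
      (simp add: inner_gauss_feature)
  fix H ip assume "rkhs P ?k H ip"
  then interpret rkhs P ?k H ip .
  show "\<forall>h\<in>H. continuous_map (weak_topology Z) euclideanreal h"
  proof
    fix h assume h: "h \<in> H"
    show "continuous_map (weak_topology Z) euclideanreal h"
    proof (rule continuous_map_mem[OF h])
      fix \<mu>
      have "continuous_on UNIV (\<lambda>y. exp (- (\<sigma>\<^sup>2) * (norm (mean S \<mu> - y))\<^sup>2))"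
        by (intro continuous_intros)
      then show "continuous_map (weak_topology Z) euclideanreal (?k \<mu>)"
        using continuous_map_compose[OF continuous_map_mean, of euclideanreal
            "\<lambda>y. exp (- (\<sigma>\<^sup>2) * (norm (mean S \<mu> - y))\<^sup>2)"] by (simp add: o_def)
    qed (auto simp: norm_minus_commute)
  qed
  fix f \<epsilon> assume f: "continuous_map (weak_topology Z) euclideanreal f" and \<epsilon>: "(0::real) < \<epsilon>"
  obtain g where g: "continuous_on (mean S ` P) g" "\<And>\<mu>. \<mu> \<in> P \<Longrightarrow> g (mean S \<mu>) = f \<mu>"
    using factor_through_mean[OF f] by blast
  have cpt: "compact (mean S ` P)"
    by (intro compact_image_mean) (auto simp: limitin_weak_topology)
  obtain v where v: "v \<in> span (gauss_feature \<sigma> ` mean S ` P)"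
    "\<And>\<mu>. \<mu> \<in> P \<Longrightarrow> \<bar>g (mean S \<mu>) - v \<bullet> gauss_feature \<sigma> (mean S \<mu>)\<bar> \<le> \<epsilon>"
    using span_gauss_feature_dense[OF cpt g(1) \<sigma> \<epsilon>] by auto
  have "\<exists>h\<in>H. \<forall>\<mu>\<in>P. h \<mu> = v \<bullet> gauss_feature \<sigma> (mean S \<mu>)"
    using v(1)
  proof (induction v rule: span_induct_alt)
    case base
    show ?case using zero by (intro bexI[of _ "\<lambda>x\<in>P. 0"]) auto
  next
    case (step c x y)
    then obtain h \<nu> where h: "h \<in> H" "\<And>\<mu>. \<mu> \<in> P \<Longrightarrow> h \<mu> = y \<bullet> gauss_feature \<sigma> (mean S \<mu>)"
      and \<nu>: "\<nu> \<in> P" "x = gauss_feature \<sigma> (mean S \<nu>)" by auto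
    let ?h = "\<lambda>\<mu>\<in>P. (\<lambda>\<mu>\<in>P. c * (\<lambda>\<mu>\<in>P. ?k \<mu> \<nu>) \<mu>) \<mu> + h \<mu>"
    have "?h \<in> H" by (intro add scale kernel_mem h \<nu>)
    moreover have "?h \<mu> = (c *\<^sub>R x + y) \<bullet> gauss_feature \<sigma> (mean S \<mu>)" if "\<mu> \<in> P" for \<mu>
      using that h(2)[OF that] by (simp add: \<nu>(2) inner_add_left inner_gauss_feature norm_minus_commute)
    ultimately show ?case by blast
  qed
  then obtain h where h: "h \<in> H" "\<And>\<mu>. \<mu> \<in> P \<Longrightarrow> h \<mu> = v \<bullet> gauss_feature \<sigma> (mean S \<mu>)" by blast
  then show "\<exists>h\<in>H. \<forall>\<mu>\<in>P. \<bar>f \<mu> - h \<mu>\<bar> \<le> \<epsilon>"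
    using v(2) g(2) by (intro bexI[of _ h]) auto
qed

end

section \<open>Riemann--Stieltjes primitives\<close>

text \<open>Increment form of \<open>d\<Phi> = f dg\<close>: it stands in for the fundamental theorem of
  calculus, as \<open>g\<close> need not be differentiable.\<close>

definition RS_primitive ::
    "(real \<Rightarrow> real) \<Rightarrow> (real \<Rightarrow> real) \<Rightarrow> real \<Rightarrow> real \<Rightarrow> (real \<Rightarrow> real) \<Rightarrow> bool" where
  "RS_primitive f g a b \<Phi> \<longleftrightarrow>
     (\<forall>\<epsilon>>0. \<exists>\<delta>>0. \<forall>u \<xi> v. a \<le> u \<and> u \<le> \<xi> \<and> \<xi> \<le> v \<and> v \<le> b \<and> v - u < \<delta> \<longrightarrow>
        \<bar>\<Phi> v - \<Phi> u - f \<xi> * (g v - g u)\<bar> \<le> \<epsilon> * (v - u))"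

lemma RS_primitiveD:
  assumes "RS_primitive f g a b \<Phi>" "\<epsilon> > 0"
  obtains \<delta> where "\<delta> > 0" "\<And>u \<xi> v. a \<le> u \<Longrightarrow> u \<le> \<xi> \<Longrightarrow> \<xi> \<le> v \<Longrightarrow> v \<le> b \<Longrightarrow> v - u < \<delta> \<Longrightarrow>
        \<bar>\<Phi> v - \<Phi> u - f \<xi> * (g v - g u)\<bar> \<le> \<epsilon> * (v - u)"
  using assms unfolding RS_primitive_def by meson

lemma RS_primitive_cong:
  assumes "\<And>u. a \<le> u \<Longrightarrow> u \<le> b \<Longrightarrow> f u = f' u" "\<And>u. a \<le> u \<Longrightarrow> u \<le> b \<Longrightarrow> g u = g' u"
    "\<And>u. a \<le> u \<Longrightarrow> u \<le> b \<Longrightarrow> \<Phi> u = \<Phi>' u + c" "RS_primitive f g a b \<Phi>"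
  shows "RS_primitive f' g' a b \<Phi>'"
  unfolding RS_primitive_def
proof (intro allI impI)
  fix \<epsilon> :: real assume "\<epsilon> > 0"
  then obtain \<delta> where \<delta>: "\<delta> > 0" "\<And>u \<xi> v. a \<le> u \<Longrightarrow> u \<le> \<xi> \<Longrightarrow> \<xi> \<le> v \<Longrightarrow> v \<le> b \<Longrightarrow> v - u < \<delta> \<Longrightarrow>
        \<bar>\<Phi> v - \<Phi> u - f \<xi> * (g v - g u)\<bar> \<le> \<epsilon> * (v - u)"
    using RS_primitiveD[OF assms(4)] by blast
  show "\<exists>\<delta>>0. \<forall>u \<xi> v. a \<le> u \<and> u \<le> \<xi> \<and> \<xi> \<le> v \<and> v \<le> b \<and> v - u < \<delta> \<longrightarrow>
        \<bar>\<Phi>' v - \<Phi>' u - f' \<xi> * (g' v - g' u)\<bar> \<le> \<epsilon> * (v - u)"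
  proof (intro exI[of _ \<delta>] conjI \<delta>(1) allI impI)
    fix u \<xi> v assume h: "a \<le> u \<and> u \<le> \<xi> \<and> \<xi> \<le> v \<and> v \<le> b \<and> v - u < \<delta>"
    then have "\<bar>\<Phi> v - \<Phi> u - f \<xi> * (g v - g u)\<bar> \<le> \<epsilon> * (v - u)" by (intro \<delta>(2)) auto
    then show "\<bar>\<Phi>' v - \<Phi>' u - f' \<xi> * (g' v - g' u)\<bar> \<le> \<epsilon> * (v - u)"
      using assms(1)[of \<xi>] assms(2,3)[of u] assms(2,3)[of v] h by simp
  qed
qed

text \<open>The hypothesis \<open>eq\<close> speaks of a value times an increment, so it covers
  linearity in the integrand and in the integrator at once.\<close>

lemma RS_primitive_linear_combination:
  assumes P: "RS_primitive f g a b \<Phi>" and P': "RS_primitive f' g' a b \<Phi>'"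
    and eq: "\<And>u \<xi> v. f'' \<xi> * (g'' v - g'' u) = r * (f \<xi> * (g v - g u)) + r' * (f' \<xi> * (g' v - g' u))"
  shows "RS_primitive f'' g'' a b (\<lambda>u. r * \<Phi> u + r' * \<Phi>' u)"
  unfolding RS_primitive_def
proof (intro allI impI)
  fix \<epsilon> :: real assume "\<epsilon> > 0"
  define C where "C = \<bar>r\<bar> + \<bar>r'\<bar> + 1"
  have C: "C > 0" by (simp add: C_def)
  have "\<epsilon> / C > 0" using \<open>\<epsilon> > 0\<close> C by simp
  obtain \<delta> where \<delta>: "\<delta> > 0" "\<And>u \<xi> v. a \<le> u \<Longrightarrow> u \<le> \<xi> \<Longrightarrow> \<xi> \<le> v \<Longrightarrow> v \<le> b \<Longrightarrow> v - u < \<delta> \<Longrightarrow>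
        \<bar>\<Phi> v - \<Phi> u - f \<xi> * (g v - g u)\<bar> \<le> \<epsilon> / C * (v - u)"
    using RS_primitiveD[OF P \<open>\<epsilon> / C > 0\<close>] by blast
  obtain \<delta>' where \<delta>': "\<delta>' > 0" "\<And>u \<xi> v. a \<le> u \<Longrightarrow> u \<le> \<xi> \<Longrightarrow> \<xi> \<le> v \<Longrightarrow> v \<le> b \<Longrightarrow> v - u < \<delta>' \<Longrightarrow>
        \<bar>\<Phi>' v - \<Phi>' u - f' \<xi> * (g' v - g' u)\<bar> \<le> \<epsilon> / C * (v - u)"
    using RS_primitiveD[OF P' \<open>\<epsilon> / C > 0\<close>] by blast
  show "\<exists>\<delta>>0. \<forall>u \<xi> v. a \<le> u \<and> u \<le> \<xi> \<and> \<xi> \<le> v \<and> v \<le> b \<and> v - u < \<delta> \<longrightarrow>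
        \<bar>(r * \<Phi> v + r' * \<Phi>' v) - (r * \<Phi> u + r' * \<Phi>' u) - f'' \<xi> * (g'' v - g'' u)\<bar> \<le> \<epsilon> * (v - u)"
  proof (intro exI[of _ "min \<delta> \<delta>'"] conjI allI impI)
    fix u \<xi> v assume h: "a \<le> u \<and> u \<le> \<xi> \<and> \<xi> \<le> v \<and> v \<le> b \<and> v - u < min \<delta> \<delta>'"
    let ?R = "\<Phi> v - \<Phi> u - f \<xi> * (g v - g u)" and ?R' = "\<Phi>' v - \<Phi>' u - f' \<xi> * (g' v - g' u)"
    have "(r * \<Phi> v + r' * \<Phi>' v) - (r * \<Phi> u + r' * \<Phi>' u) - f'' \<xi> * (g'' v - g'' u) = r * ?R + r' * ?R'"
      unfolding eq by (simp add: algebra_simps)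
    also have "\<bar>\<dots>\<bar> \<le> \<bar>r\<bar> * \<bar>?R\<bar> + \<bar>r'\<bar> * \<bar>?R'\<bar>"
      using abs_triangle_ineq[of "r * ?R" "r' * ?R'"] by (simp add: abs_mult)
    also have "\<dots> \<le> \<bar>r\<bar> * (\<epsilon> / C * (v - u)) + \<bar>r'\<bar> * (\<epsilon> / C * (v - u))"
      using h by (intro add_mono mult_left_mono \<delta>(2) \<delta>'(2)) auto
    also have "\<dots> = (\<bar>r\<bar> + \<bar>r'\<bar>) * (\<epsilon> / C * (v - u))" by (rule distrib_right[symmetric])
    also have "\<bar>r\<bar> + \<bar>r'\<bar> = C - 1" by (simp add: C_def)
    also have "(C - 1) * (\<epsilon> / C * (v - u)) = (C - 1) / C * (\<epsilon> * (v - u))" by simp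
    also have "\<dots> \<le> 1 * (\<epsilon> * (v - u))"
      using C h \<open>\<epsilon> > 0\<close> by (intro mult_right_mono) (auto simp: field_simps)
    finally show "\<bar>(r * \<Phi> v + r' * \<Phi>' v) - (r * \<Phi> u + r' * \<Phi>' u) - f'' \<xi> * (g'' v - g'' u)\<bar> \<le> \<epsilon> * (v - u)"
      by simp
  qed (use \<delta>(1) \<delta>'(1) in auto)
qed

lemma RS_primitive_zero: "RS_primitive (\<lambda>u. 0) g a b (\<lambda>u. 0)"
  unfolding RS_primitive_def by (auto intro!: exI[of _ "1::real"])

lemma RS_primitive_add:
  "RS_primitive f g a b \<Phi> \<Longrightarrow> RS_primitive f' g a b \<Phi>' \<Longrightarrow>
    RS_primitive (\<lambda>u. f u + f' u) g a b (\<lambda>u. \<Phi> u + \<Phi>' u)"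
  using RS_primitive_linear_combination[of f g a b \<Phi> f' g \<Phi>' "\<lambda>u. f u + f' u" g 1 1]
  by (simp add: algebra_simps)

lemma RS_primitive_diff:
  "RS_primitive f g a b \<Phi> \<Longrightarrow> RS_primitive f' g a b \<Phi>' \<Longrightarrow>
    RS_primitive (\<lambda>u. f u - f' u) g a b (\<lambda>u. \<Phi> u - \<Phi>' u)"
  using RS_primitive_linear_combination[of f g a b \<Phi> f' g \<Phi>' "\<lambda>u. f u - f' u" g 1 "-1"]
  by (simp add: algebra_simps)

lemma RS_primitive_diff_integrator:
  "RS_primitive f g a b \<Phi> \<Longrightarrow> RS_primitive f g' a b \<Phi>' \<Longrightarrow>
    RS_primitive f (\<lambda>u. g u - g' u) a b (\<lambda>u. \<Phi> u - \<Phi>' u)"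
  using RS_primitive_linear_combination[of f g a b \<Phi> f g' \<Phi>' f "\<lambda>u. g u - g' u" 1 "-1"]
  by (simp add: algebra_simps)

lemma RS_primitive_sum_list:
  assumes "\<And>w. w \<in> set ws \<Longrightarrow> RS_primitive (f w) g a b (\<Phi> w)"
  shows "RS_primitive (\<lambda>u. \<Sum>w\<leftarrow>ws. f w u) g a b (\<lambda>u. \<Sum>w\<leftarrow>ws. \<Phi> w u)"
  using assms by (induction ws) (auto intro: RS_primitive_zero RS_primitive_add)

lemma RS_primitive_has_RS_integral:
  assumes P: "RS_primitive f g a b \<Phi>" and st: "a \<le> s" "s \<le> t" "t \<le> b"
  shows "has_RS_integral f g s t (\<Phi> t - \<Phi> s)"
  unfolding has_RS_integral_def
proof (intro allI impI)
  fix \<epsilon> :: real assume "\<epsilon> > 0"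
  \<comment> \<open>The summand 1 keeps the final inequality strict and allows
    \<open>s = t\<close>.\<close>
  define \<epsilon>' where "\<epsilon>' = \<epsilon> / (t - s + 1)"
  have "\<epsilon>' > 0" using \<open>\<epsilon> > 0\<close> st by (simp add: \<epsilon>'_def)
  then obtain \<delta> where \<delta>: "\<delta> > 0" "\<And>u \<xi> v. a \<le> u \<Longrightarrow> u \<le> \<xi> \<Longrightarrow> \<xi> \<le> v \<Longrightarrow> v \<le> b \<Longrightarrow> v - u < \<delta> \<Longrightarrow>
        \<bar>\<Phi> v - \<Phi> u - f \<xi> * (g v - g u)\<bar> \<le> \<epsilon>' * (v - u)"
    using RS_primitiveD[OF P] by blast
  show "\<exists>\<delta>>0. \<forall>p. p tagged_division_of {s..t} \<and> (\<lambda>\<xi>. ball \<xi> \<delta>) fine p \<longrightarrow>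
        \<bar>(\<Sum>(\<xi>, K)\<in>p. f \<xi> * (g (Sup K) - g (Inf K))) - (\<Phi> t - \<Phi> s)\<bar> < \<epsilon>"
  \<comment> \<open>A cell inside the ball of radius \<delta>/2 about its tag is shorter than
    \<delta>.\<close>
  proof (intro exI[of _ "\<delta> / 2"] conjI allI impI)
    fix p assume h: "p tagged_division_of {s..t} \<and> (\<lambda>\<xi>. ball \<xi> (\<delta> / 2)) fine p"
    then have p: "p tagged_division_of {s..t}" and fine: "(\<lambda>\<xi>. ball \<xi> (\<delta> / 2)) fine p" by auto
    have cell: "\<bar>f \<xi> * (g (Sup K) - g (Inf K)) - (\<Phi> (Sup K) - \<Phi> (Inf K))\<bar> \<le> \<epsilon>' * (Sup K - Inf K)"
      if mem: "(\<xi>, K) \<in> p" for \<xi> K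
    proof -
      obtain u v where K: "K = {u..v}" using tagged_division_ofD(4)[OF p mem] by (auto simp: box_real)
      have \<xi>: "\<xi> \<in> K" and sub: "K \<subseteq> {s..t}" using tagged_division_ofD(2,3)[OF p mem] .
      have uv: "u \<le> \<xi>" "\<xi> \<le> v" using \<xi> K by auto
      have "K \<subseteq> ball \<xi> (\<delta> / 2)" using fine mem by (auto simp: fine_def)
      moreover have "u \<in> K" "v \<in> K" using K uv by auto
      ultimately have "u \<in> ball \<xi> (\<delta> / 2)" "v \<in> ball \<xi> (\<delta> / 2)" by blast+
      then have "v - u < \<delta>" using uv by (simp add: dist_real_def abs_less_iff)
      moreover have "a \<le> u" "v \<le> b" using sub K uv st by auto
      ultimately have "\<bar>\<Phi> v - \<Phi> u - f \<xi> * (g v - g u)\<bar> \<le> \<epsilon>' * (v - u)" by (intro \<delta>(2) uv)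
      then show ?thesis using K uv by (simp add: abs_minus_commute)
    qed
    have tel: "(\<Sum>(\<xi>, K)\<in>p. \<Phi> (Sup K) - \<Phi> (Inf K)) = \<Phi> t - \<Phi> s" for \<Phi> :: "real \<Rightarrow> real"
      using additive_tagged_division_1[OF st(2) p] .
    have "\<bar>(\<Sum>(\<xi>, K)\<in>p. f \<xi> * (g (Sup K) - g (Inf K))) - (\<Phi> t - \<Phi> s)\<bar> =
        \<bar>\<Sum>(\<xi>, K)\<in>p. f \<xi> * (g (Sup K) - g (Inf K)) - (\<Phi> (Sup K) - \<Phi> (Inf K))\<bar>"
      unfolding tel[of \<Phi>, symmetric] by (simp add: sum_subtractf case_prod_unfold)
    also have "\<dots> \<le> (\<Sum>(\<xi>, K)\<in>p. \<epsilon>' * (Sup K - Inf K))"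
      using cell by (intro order_trans[OF sum_abs] sum_mono) auto
    also have "\<dots> = \<epsilon>' * (t - s)"
      using tel[of "\<lambda>u. \<epsilon>' * u"] by (simp add: right_diff_distrib)
    also have "\<dots> < \<epsilon>"
    proof -
      have "\<epsilon>' * (t - s) < \<epsilon>' * (t - s + 1)" using \<open>\<epsilon>' > 0\<close> by simp
      also have "\<dots> = \<epsilon>" using st by (simp add: \<epsilon>'_def)
      finally show ?thesis .
    qed
    finally show "\<bar>(\<Sum>(\<xi>, K)\<in>p. f \<xi> * (g (Sup K) - g (Inf K))) - (\<Phi> t - \<Phi> s)\<bar> < \<epsilon>" .
  qed (use \<delta>(1) in simp)
qed

lemma RS_integral_primitive:
  assumes "RS_primitive f g a b \<Phi>" "a \<le> t" "t \<le> b"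
  shows "RS_integral f g a t = \<Phi> t - \<Phi> a"
  using RS_primitive_has_RS_integral[OF assms(1) _ assms(2,3)] by (intro RS_integral_eqI) simp

text \<open>The primitive is the integral of \<open>f\<close> over (a, v] against the
  Lebesgue-Stieltjes measure of \<open>F\<close>. On a short interval its error is at most the
  oscillation of \<open>f\<close> times \<open>F v - F u\<close>, and the latter is at most
  \<open>L * (v - u)\<close>.\<close>

lemma RS_primitive_mono_exists:
  fixes F f :: "real \<Rightarrow> real"
  assumes f: "continuous_on UNIV f" and F: "mono F" and L: "L-lipschitz_on UNIV F" and ab: "a \<le> b"
  shows "\<exists>\<Phi>. RS_primitive f F a b \<Phi>"
proof -
  have contF: "continuous_on UNIV F" by (rule lipschitz_on_continuous_on[OF L])
  define \<mu> where "\<mu> = interval_measure F"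
  have Ioc: "emeasure \<mu> {u<..v} = F v - F u" if "u \<le> v" for u v
    unfolding \<mu>_def using that F contF
    by (intro emeasure_interval_measure_Ioc)
      (auto simp: mono_def continuous_on_eq_continuous_at intro: continuous_at_imp_continuous_within)
  have sets: "sets \<mu> = sets borel" by (simp add: \<mu>_def)
  have fm: "f \<in> borel_measurable \<mu>"
    using borel_measurable_continuous_onI[OF f] by (simp add: \<mu>_def cong: measurable_cong_sets)
  define \<Phi> where "\<Phi> v = (\<integral>x. indicator {a<..v} x * f x \<partial>\<mu>)" for v
  have bdd: "\<exists>B. \<forall>x\<in>{a..b}. \<bar>f x\<bar> \<le> B"
    using compact_imp_bounded[OF compact_continuous_image[OF continuous_on_subset[OF f] compact_Icc[of a b]]]
    by (auto simp: bounded_iff)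
  then obtain B where B: "\<And>x. x \<in> {a..b} \<Longrightarrow> \<bar>f x\<bar> \<le> B" by blast
  have int: "integrable \<mu> (\<lambda>x. indicator {u<..v} x * h x)"
    if "a \<le> u" "v \<le> b" "h \<in> borel_measurable \<mu>" "\<And>x. x \<in> {a..b} \<Longrightarrow> \<bar>h x\<bar> \<le> C" for u v C :: real and h :: "real \<Rightarrow> real"
  proof (cases "u \<le> v")
    case True
    have "integrable \<mu> (\<lambda>x. indicator {u<..v} x *\<^sub>R h x)"
    proof (rule integrableI_bounded_set_indicator[where B = C])
      show "emeasure \<mu> {u<..v} < \<infinity>" using Ioc[OF True] by simp
      show "AE x in \<mu>. x \<in> {u<..v} \<longrightarrow> norm (h x) \<le> C" using that by auto
    qed (use that sets in auto)
    then show ?thesis by simp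
  qed simp
  show ?thesis
  proof (rule exI[of _ \<Phi>], unfold RS_primitive_def, intro allI impI)
    fix \<epsilon> :: real assume \<epsilon>: "\<epsilon> > 0"
    define \<epsilon>' where "\<epsilon>' = \<epsilon> / (L + 1)"
    have "L \<ge> 0" using L by (rule lipschitz_on_nonneg)
    then have \<epsilon>': "\<epsilon>' > 0" using \<epsilon> by (simp add: \<epsilon>'_def)
    have "uniformly_continuous_on {a..b} f"
      using f by (intro compact_uniformly_continuous) (auto intro: continuous_on_subset)
    then obtain \<delta> where \<delta>: "\<delta> > 0"
      "\<And>x y. x \<in> {a..b} \<Longrightarrow> y \<in> {a..b} \<Longrightarrow> dist y x < \<delta> \<Longrightarrow> dist (f y) (f x) < \<epsilon>'"
      using \<epsilon>' unfolding uniformly_continuous_on_def by metis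
    show "\<exists>\<delta>>0. \<forall>u \<xi> v. a \<le> u \<and> u \<le> \<xi> \<and> \<xi> \<le> v \<and> v \<le> b \<and> v - u < \<delta> \<longrightarrow>
        \<bar>\<Phi> v - \<Phi> u - f \<xi> * (F v - F u)\<bar> \<le> \<epsilon> * (v - u)"
    proof (intro exI[of _ \<delta>] conjI \<delta>(1) allI impI)
      fix u \<xi> v assume h: "a \<le> u \<and> u \<le> \<xi> \<and> \<xi> \<le> v \<and> v \<le> b \<and> v - u < \<delta>"
      then have uv: "u \<le> v" "a \<le> u" "v \<le> b" and \<xi>: "\<xi> \<in> {a..b}" by auto
      have Fuv: "F u \<le> F v" using F uv by (simp add: monoD)
      have meas: "(\<integral>x. indicator {u<..v} x * c \<partial>\<mu>) = c * (F v - F u)" for c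
        using Ioc[OF uv(1)] Fuv by (simp add: measure_def sets)
      note int_f = int[OF _ _ fm B]
      have "\<Phi> v = (\<integral>x. indicator {a<..u} x * f x + indicator {u<..v} x * f x \<partial>\<mu>)"
        unfolding \<Phi>_def using uv by (intro Bochner_Integration.integral_cong) (auto simp: indicator_def)
      also have "\<dots> = \<Phi> u + (\<integral>x. indicator {u<..v} x * f x \<partial>\<mu>)"
        unfolding \<Phi>_def using uv by (intro Bochner_Integration.integral_add int_f) auto
      finally have "\<Phi> v - \<Phi> u - f \<xi> * (F v - F u) =
          (\<integral>x. indicator {u<..v} x * f x \<partial>\<mu>) - (\<integral>x. indicator {u<..v} x * f \<xi> \<partial>\<mu>)"
        unfolding meas by linarith
      also have "\<dots> = (\<integral>x. indicator {u<..v} x * f x - indicator {u<..v} x * f \<xi> \<partial>\<mu>)"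
        using uv by (intro Bochner_Integration.integral_diff[symmetric] int_f int[of _ _ _ "\<bar>f \<xi>\<bar>"]) auto
      also have "\<bar>\<dots>\<bar> \<le> (\<integral>x. \<bar>indicator {u<..v} x * f x - indicator {u<..v} x * f \<xi>\<bar> \<partial>\<mu>)"
        by (rule integral_abs_bound)
      also have "\<dots> \<le> (\<integral>x. indicator {u<..v} x * \<epsilon>' \<partial>\<mu>)"
      proof (rule integral_mono)
        show "integrable \<mu> (\<lambda>x. \<bar>indicator {u<..v} x * f x - indicator {u<..v} x * f \<xi>\<bar>)"
          using uv by (intro integrable_abs Bochner_Integration.integrable_diff int_f int[of _ _ _ "\<bar>f \<xi>\<bar>"]) auto
        show "integrable \<mu> (\<lambda>x. indicator {u<..v} x * \<epsilon>')" using uv by (intro int[of _ _ _ "\<bar>\<epsilon>'\<bar>"]) auto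
        fix x
        show "\<bar>indicator {u<..v} x * f x - indicator {u<..v} x * f \<xi>\<bar> \<le> indicator {u<..v} x * \<epsilon>'"
        proof (cases "x \<in> {u<..v}")
          case True
          then have "dist x \<xi> < \<delta>" using h by (auto simp: dist_real_def)
          then have "dist (f x) (f \<xi>) < \<epsilon>'" using True uv \<xi> by (intro \<delta>(2)) auto
          then show ?thesis using True by (simp add: dist_real_def)
        qed simp
      qed
      also have "\<dots> = \<epsilon>' * (F v - F u)" by (rule meas)
      also have "\<dots> \<le> \<epsilon>' * ((L + 1) * (v - u))"
      proof (rule mult_left_mono)
        have "F v - F u \<le> L * (v - u)"
          using lipschitz_onD[OF L, of v u] uv Fuv by (simp add: dist_real_def)
        also have "\<dots> \<le> (L + 1) * (v - u)" using uv by (intro mult_right_mono) auto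
        finally show "F v - F u \<le> (L + 1) * (v - u)" .
      qed (use \<epsilon>' in simp)
      also have "\<dots> = \<epsilon> * (v - u)" using \<open>L \<ge> 0\<close> by (simp add: \<epsilon>'_def)
      finally show "\<bar>\<Phi> v - \<Phi> u - f \<xi> * (F v - F u)\<bar> \<le> \<epsilon> * (v - u)" .
    qed
  qed
qed

text \<open>A Lipschitz function is a difference of nondecreasing Lipschitz functions,
  \<open>g = (g + L\<cdot>id) - L\<cdot>id\<close>.\<close>

lemma RS_primitive_exists:
  assumes f: "continuous_on {a..b} f" and g: "L-lipschitz_on {a..b} g" and ab: "a \<le> b"
  shows "\<exists>\<Phi>. RS_primitive f g a b \<Phi>"
proof -
  \<comment> \<open>Clamping to [a,b] extends \<open>f\<close> and \<open>g\<close> to the whole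
    line, on which the Stieltjes measure is formed.\<close>
  define cl where "cl u = max a (min b u)" for u :: real
  have cl: "cl u \<in> {a..b}" "\<bar>cl u - cl v\<bar> \<le> \<bar>u - v\<bar>" "u \<in> {a..b} \<Longrightarrow> cl u = u" for u v
    using ab by (auto simp: cl_def max_def min_def)
  have L0: "L \<ge> 0" using g by (rule lipschitz_on_nonneg)
  have gcl: "\<bar>g (cl u) - g (cl v)\<bar> \<le> L * \<bar>u - v\<bar>" for u v
    using lipschitz_onD[OF g cl(1) cl(1), of u v] mult_left_mono[OF cl(2) L0, of u v]
    by (simp add: dist_real_def)
  have "continuous_on UNIV cl" unfolding cl_def by (intro continuous_intros)
  then have fcl: "continuous_on UNIV (\<lambda>u. f (cl u))"
    using cl(1) by (intro continuous_on_compose2[OF f]) auto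
  have lin: "\<bar>L * u - L * v\<bar> = L * \<bar>u - v\<bar>" for u v
    using L0 by (simp add: abs_mult flip: right_diff_distrib)
  have "mono (\<lambda>u. g (cl u) + L * u)"
  proof (rule monoI)
    fix u v :: real assume "u \<le> v"
    then show "g (cl u) + L * u \<le> g (cl v) + L * v"
      using gcl[of u v] by (simp add: algebra_simps abs_le_iff)
  qed
  moreover have "(2 * L)-lipschitz_on UNIV (\<lambda>u. g (cl u) + L * u)"
  proof (rule lipschitz_onI)
    fix u v :: real
    show "dist (g (cl u) + L * u) (g (cl v) + L * v) \<le> 2 * L * dist u v"
      using gcl[of u v] lin[of u v] unfolding dist_real_def by linarith
  qed (use L0 in simp)
  ultimately obtain \<Phi> where \<Phi>: "RS_primitive (\<lambda>u. f (cl u)) (\<lambda>u. g (cl u) + L * u) a b \<Phi>"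
    using RS_primitive_mono_exists[OF fcl _ _ ab] by blast
  have "mono (\<lambda>u. L * u)" using L0 by (simp add: monoI mult_left_mono)
  moreover have "L-lipschitz_on UNIV (\<lambda>u. L * u)"
    using L0 lin by (intro lipschitz_onI) (auto simp: dist_real_def)
  ultimately obtain \<Psi> where \<Psi>: "RS_primitive (\<lambda>u. f (cl u)) (\<lambda>u. L * u) a b \<Psi>"
    using RS_primitive_mono_exists[OF fcl _ _ ab] by blast
  have "RS_primitive f g a b (\<lambda>u. \<Phi> u - \<Psi> u)"
    by (rule RS_primitive_cong[OF _ _ _ RS_primitive_diff_integrator[OF \<Phi> \<Psi>], where c = 0]) (simp_all add: cl)
  then show ?thesis by blast
qed

lemma RS_primitive_continuous_on:
  assumes P: "RS_primitive f g a b \<Phi>" and f: "continuous_on {a..b} f" and g: "L-lipschitz_on {a..b} g"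
  shows "continuous_on {a..b} \<Phi>"
proof -
  have "\<exists>B. \<forall>x\<in>{a..b}. \<bar>f x\<bar> \<le> B"
    using compact_imp_bounded[OF compact_continuous_image[OF f compact_Icc]] by (auto simp: bounded_iff)
  then obtain B where B: "\<And>x. x \<in> {a..b} \<Longrightarrow> \<bar>f x\<bar> \<le> B" by blast
  \<comment> \<open>The fixed tolerance 1 already gives a Lipschitz bound on intervals shorter than
    \<delta>.\<close>
  obtain \<delta> where \<delta>: "\<delta> > 0" "\<And>u \<xi> v. a \<le> u \<Longrightarrow> u \<le> \<xi> \<Longrightarrow> \<xi> \<le> v \<Longrightarrow> v \<le> b \<Longrightarrow> v - u < \<delta> \<Longrightarrow>
        \<bar>\<Phi> v - \<Phi> u - f \<xi> * (g v - g u)\<bar> \<le> 1 * (v - u)"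
    using RS_primitiveD[OF P zero_less_one] by blast
  have L: "L \<ge> 0" using g by (rule lipschitz_on_nonneg)
  have le: "\<bar>\<Phi> v - \<Phi> u\<bar> \<le> (B * L + 1) * (v - u)" if uv: "a \<le> u" "u \<le> v" "v \<le> b" "v - u < \<delta>" for u v
  proof -
    have "\<bar>f u * (g v - g u)\<bar> \<le> B * (L * (v - u))"
      unfolding abs_mult using B[of u] lipschitz_onD[OF g, of v u] uv
      by (intro mult_mono) (auto simp: dist_real_def)
    then show ?thesis using \<delta>(2)[of u u v] uv by (simp add: algebra_simps abs_le_iff)
  qed
  show ?thesis
    unfolding continuous_on_iff
  proof (intro ballI allI impI)
    fix u \<epsilon> :: real assume u: "u \<in> {a..b}" and \<epsilon>: "\<epsilon> > 0"
    define C where "C = B * L + 1"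
    have "B \<ge> 0" using B[OF u] by linarith
    then have C: "C > 0" using L by (simp add: C_def add_nonneg_pos)
    show "\<exists>d>0. \<forall>v\<in>{a..b}. dist v u < d \<longrightarrow> dist (\<Phi> v) (\<Phi> u) < \<epsilon>"
    proof (intro exI[of _ "min \<delta> (\<epsilon> / C)"] conjI ballI impI)
      fix v assume v: "v \<in> {a..b}" "dist v u < min \<delta> (\<epsilon> / C)"
      have "\<bar>\<Phi> v - \<Phi> u\<bar> \<le> C * \<bar>v - u\<bar>"
        using le[of u v] le[of v u] u v by (cases "u \<le> v") (auto simp: C_def dist_real_def abs_minus_commute)
      also have "\<dots> < \<epsilon>" using v(2) C by (simp add: dist_real_def field_simps)
      finally show "dist (\<Phi> v) (\<Phi> u) < \<epsilon>" by (simp add: dist_real_def)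
    qed (use \<delta>(1) \<epsilon> C in auto)
  qed
qed

text \<open>Plays the part of "derivative at most zero implies nonincreasing". As \<delta> is
  uniform, [a,b] can be cut into equal pieces shorter than \<delta> and the increments added
  up.\<close>

lemma nonincreasing_of_increments:
  fixes \<theta> :: "real \<Rightarrow> real"
  assumes inc: "\<And>\<epsilon>. \<epsilon> > 0 \<Longrightarrow> \<exists>\<delta>>0. \<forall>u v. a \<le> u \<and> u \<le> v \<and> v \<le> b \<and> v - u < \<delta> \<longrightarrow> \<theta> v - \<theta> u \<le> \<epsilon> * (v - u)"
    and ab: "a \<le> b"
  shows "\<theta> b \<le> \<theta> a"
proof -
  have "\<theta> b - \<theta> a \<le> 0 + \<epsilon>" if "\<epsilon> > 0" for \<epsilon>
  proof -
    define \<epsilon>' where "\<epsilon>' = \<epsilon> / (b - a + 1)"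
    have "\<epsilon>' > 0" using that ab by (simp add: \<epsilon>'_def)
    obtain \<delta> where \<delta>: "\<delta> > 0"
      "\<And>u v. a \<le> u \<Longrightarrow> u \<le> v \<Longrightarrow> v \<le> b \<Longrightarrow> v - u < \<delta> \<Longrightarrow> \<theta> v - \<theta> u \<le> \<epsilon>' * (v - u)"
      using inc[OF \<open>\<epsilon>' > 0\<close>] by blast
    obtain N where N: "(b - a) / \<delta> < real N" using reals_Archimedean2 by blast
    have "0 \<le> (b - a) / \<delta>" using ab \<delta>(1) by simp
    then have N0: "N > 0" using N by (cases N) auto
    define h where "h = (b - a) / N"
    have h: "h \<ge> 0" "N * h = b - a" "h < \<delta>"
      using ab N N0 \<delta>(1) by (auto simp: h_def field_simps)
    have "\<theta> (a + n * h) - \<theta> a \<le> \<epsilon>' * (n * h)" if "n \<le> N" for n :: nat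
      using that
    proof (induction n)
      case (Suc n)
      have "Suc n * h \<le> N * h" using Suc.prems h(1) by (intro mult_right_mono) auto
      then have "\<theta> (a + Suc n * h) - \<theta> (a + n * h) \<le> \<epsilon>' * ((a + Suc n * h) - (a + n * h))"
        using h by (intro \<delta>(2)) (auto simp: algebra_simps)
      also have "(a + Suc n * h) - (a + n * h) = h" by (simp add: algebra_simps)
      finally show ?case using Suc.IH Suc.prems by (simp add: algebra_simps)
    qed simp
    from this[of N] have "\<theta> b - \<theta> a \<le> \<epsilon>' * (b - a)" using h(2) by simp
    also have "\<dots> \<le> \<epsilon>' * (b - a + 1)" using \<open>\<epsilon>' > 0\<close> by simp
    also have "\<dots> = \<epsilon>" using ab by (simp add: \<epsilon>'_def)
    finally show ?thesis by simp
  qed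
  then have "\<theta> b - \<theta> a \<le> 0" by (rule field_le_epsilon)
  then show ?thesis by simp
qed

text \<open>Product rule: the increments of \<Phi> \<Psi> come from f \<Psi> dg + \<Phi> h dk. The
  defect \<open>\<theta>\<close> has increments that are small against the length of the interval;
  applying \<open>nonincreasing_of_increments\<close> to it and to its negative gives equal values
  at both ends.\<close>

lemma RS_primitive_product:
  assumes \<Phi>: "RS_primitive f g a b \<Phi>" and \<Psi>: "RS_primitive h k a b \<Psi>"
    and A: "RS_primitive (\<lambda>u. f u * \<Psi> u) g a b A" and B: "RS_primitive (\<lambda>u. \<Phi> u * h u) k a b B"
    and cont: "continuous_on {a..b} f" "continuous_on {a..b} \<Phi>" "continuous_on {a..b} \<Psi>"
    and g: "L-lipschitz_on {a..b} g" and t: "a \<le> t" "t \<le> b"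
  shows "\<Phi> t * \<Psi> t - \<Phi> a * \<Psi> a = (A t - A a) + (B t - B a)"
proof -
  define \<theta> where "\<theta> u = \<Phi> u * \<Psi> u - A u - B u" for u
  have "\<exists>B. \<forall>x\<in>{a..b}. \<bar>q x\<bar> \<le> B" if "continuous_on {a..b} q" for q :: "real \<Rightarrow> real"
    using compact_imp_bounded[OF compact_continuous_image[OF that compact_Icc]] by (auto simp: bounded_iff)
  from this[OF cont(1)] this[OF cont(2)] this[OF cont(3)] obtain C1 C2 C3 where
    C123: "\<forall>x\<in>{a..b}. \<bar>f x\<bar> \<le> C1" "\<forall>x\<in>{a..b}. \<bar>\<Phi> x\<bar> \<le> C2" "\<forall>x\<in>{a..b}. \<bar>\<Psi> x\<bar> \<le> C3" by blast
  define C where "C = max 0 (max C1 (max C2 C3))"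
  have C0: "C \<ge> 0" by (simp add: C_def)
  have C: "\<bar>f x\<bar> \<le> C" "\<bar>\<Phi> x\<bar> \<le> C" "\<bar>\<Psi> x\<bar> \<le> C" if "a \<le> x" "x \<le> b" for x
    using that C123 by (auto simp: C_def le_max_iff_disj)
  have L: "L \<ge> 0" using g by (rule lipschitz_on_nonneg)
  have inc: "\<exists>\<delta>>0. \<forall>u v. a \<le> u \<and> u \<le> v \<and> v \<le> b \<and> v - u < \<delta> \<longrightarrow> \<bar>\<theta> v - \<theta> u\<bar> \<le> \<epsilon> * (v - u)"
    if "\<epsilon> > 0" for \<epsilon>
  proof -
    \<comment> \<open>The constant collects the five remainders below: \<open>C\<close> from each of
      \<open>?r1\<close> and \<open>?r3\<close>, \<open>C * L\<close> from \<open>?r2\<close>, and 1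
      from each of \<open>?r4\<close> and \<open>?r5\<close>.\<close>
    define D where "D = 2 * C + C * L + 2"
    have D: "D > 0" using C0 L by (simp add: D_def add_nonneg_pos)
    define \<epsilon>' where "\<epsilon>' = \<epsilon> / D"
    have \<epsilon>': "\<epsilon>' > 0" using that D by (simp add: \<epsilon>'_def)
    obtain d1 where d1: "d1 > 0" "\<And>u \<xi> v. a \<le> u \<Longrightarrow> u \<le> \<xi> \<Longrightarrow> \<xi> \<le> v \<Longrightarrow> v \<le> b \<Longrightarrow> v - u < d1 \<Longrightarrow>
        \<bar>\<Phi> v - \<Phi> u - f \<xi> * (g v - g u)\<bar> \<le> \<epsilon>' * (v - u)"
      using RS_primitiveD[OF \<Phi> \<epsilon>'] by blast
    obtain d2 where d2: "d2 > 0" "\<And>u \<xi> v. a \<le> u \<Longrightarrow> u \<le> \<xi> \<Longrightarrow> \<xi> \<le> v \<Longrightarrow> v \<le> b \<Longrightarrow> v - u < d2 \<Longrightarrow>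
        \<bar>\<Psi> v - \<Psi> u - h \<xi> * (k v - k u)\<bar> \<le> \<epsilon>' * (v - u)"
      using RS_primitiveD[OF \<Psi> \<epsilon>'] by blast
    obtain d3 where d3: "d3 > 0" "\<And>u \<xi> v. a \<le> u \<Longrightarrow> u \<le> \<xi> \<Longrightarrow> \<xi> \<le> v \<Longrightarrow> v \<le> b \<Longrightarrow> v - u < d3 \<Longrightarrow>
        \<bar>A v - A u - (f \<xi> * \<Psi> \<xi>) * (g v - g u)\<bar> \<le> \<epsilon>' * (v - u)"
      using RS_primitiveD[OF A \<epsilon>'] by blast
    obtain d4 where d4: "d4 > 0" "\<And>u \<xi> v. a \<le> u \<Longrightarrow> u \<le> \<xi> \<Longrightarrow> \<xi> \<le> v \<Longrightarrow> v \<le> b \<Longrightarrow> v - u < d4 \<Longrightarrow>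
        \<bar>B v - B u - (\<Phi> \<xi> * h \<xi>) * (k v - k u)\<bar> \<le> \<epsilon>' * (v - u)"
      using RS_primitiveD[OF B \<epsilon>'] by blast
    have "uniformly_continuous_on {a..b} \<Psi>"
      by (intro compact_uniformly_continuous cont) auto
    then obtain d5 where d5: "d5 > 0"
      "\<And>x y. x \<in> {a..b} \<Longrightarrow> y \<in> {a..b} \<Longrightarrow> dist y x < d5 \<Longrightarrow> dist (\<Psi> y) (\<Psi> x) < \<epsilon>'"
      using \<epsilon>' unfolding uniformly_continuous_on_def by metis
    define \<delta> where "\<delta> = Min {d1, d2, d3, d4, d5}"
    have \<delta>: "\<delta> > 0" "\<delta> \<le> d1" "\<delta> \<le> d2" "\<delta> \<le> d3" "\<delta> \<le> d4" "\<delta> \<le> d5"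
      using d1(1) d2(1) d3(1) d4(1) d5(1) by (auto simp: \<delta>_def)
    have "\<bar>\<theta> v - \<theta> u\<bar> \<le> \<epsilon> * (v - u)" if uv: "a \<le> u" "u \<le> v" "v \<le> b" "v - u < \<delta>" for u v
    proof -
      let ?r1 = "(\<Phi> v - \<Phi> u - f u * (g v - g u)) * \<Psi> v"
      \<comment> \<open>The only remainder that is not the defect of a primitive: a product of two
        increments, small by uniform continuity of \<open>\<Psi>\<close>.\<close>
      let ?r2 = "f u * (g v - g u) * (\<Psi> v - \<Psi> u)"
      let ?r3 = "\<Phi> u * (\<Psi> v - \<Psi> u - h u * (k v - k u))"
      let ?r4 = "A v - A u - (f u * \<Psi> u) * (g v - g u)"
      let ?r5 = "B v - B u - (\<Phi> u * h u) * (k v - k u)"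
      have "\<theta> v - \<theta> u = ?r1 + ?r2 + ?r3 - ?r4 - ?r5"
        by (simp add: \<theta>_def algebra_simps)
      moreover have "\<bar>?r1\<bar> \<le> (\<epsilon>' * (v - u)) * C"
        unfolding abs_mult using uv \<delta> \<epsilon>' by (intro mult_mono d1(2) C) auto
      moreover have "\<bar>?r2\<bar> \<le> (C * (L * (v - u))) * \<epsilon>'"
      proof -
        have "\<bar>g v - g u\<bar> \<le> L * (v - u)"
          using lipschitz_onD[OF g, of v u] uv by (simp add: dist_real_def)
        moreover have "\<bar>\<Psi> v - \<Psi> u\<bar> \<le> \<epsilon>'"
          using d5(2)[of u v] uv \<delta> by (simp add: dist_real_def)
        ultimately show ?thesis
          unfolding abs_mult using uv C0 L by (intro mult_mono C) auto
      qed
      moreover have "\<bar>?r3\<bar> \<le> C * (\<epsilon>' * (v - u))"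
        unfolding abs_mult using uv \<delta> C0 by (intro mult_mono d2(2) C) auto
      moreover have "\<bar>?r4\<bar> \<le> \<epsilon>' * (v - u)" using uv \<delta> by (intro d3(2)) auto
      moreover have "\<bar>?r5\<bar> \<le> \<epsilon>' * (v - u)" using uv \<delta> by (intro d4(2)) auto
      ultimately have "\<bar>\<theta> v - \<theta> u\<bar> \<le>
          (\<epsilon>' * (v - u)) * C + (C * (L * (v - u))) * \<epsilon>' + C * (\<epsilon>' * (v - u)) + \<epsilon>' * (v - u) + \<epsilon>' * (v - u)"
        by linarith
      also have "\<dots> = D * (\<epsilon>' * (v - u))" by (simp add: D_def algebra_simps)
      also have "\<dots> = \<epsilon> * (v - u)" using D by (simp add: \<epsilon>'_def)
      finally show ?thesis .
    qed
    with \<delta>(1) show ?thesis by blast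
  qed
  have "\<theta> t \<le> \<theta> a"
  proof (rule nonincreasing_of_increments[OF _ t(1)])
    fix \<epsilon> :: real assume "\<epsilon> > 0"
    from inc[OF this] obtain \<delta> where "\<delta> > 0"
      "\<And>u v. a \<le> u \<Longrightarrow> u \<le> v \<Longrightarrow> v \<le> b \<Longrightarrow> v - u < \<delta> \<Longrightarrow> \<bar>\<theta> v - \<theta> u\<bar> \<le> \<epsilon> * (v - u)" by blast
    then show "\<exists>\<delta>>0. \<forall>u v. a \<le> u \<and> u \<le> v \<and> v \<le> t \<and> v - u < \<delta> \<longrightarrow> \<theta> v - \<theta> u \<le> \<epsilon> * (v - u)"
      using t(2) by (intro exI[of _ \<delta>]) (auto simp: abs_le_iff)
  qed
  moreover have "- \<theta> t \<le> - \<theta> a"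
  proof (rule nonincreasing_of_increments[OF _ t(1)])
    fix \<epsilon> :: real assume "\<epsilon> > 0"
    from inc[OF this] obtain \<delta> where "\<delta> > 0"
      "\<And>u v. a \<le> u \<Longrightarrow> u \<le> v \<Longrightarrow> v \<le> b \<Longrightarrow> v - u < \<delta> \<Longrightarrow> \<bar>\<theta> v - \<theta> u\<bar> \<le> \<epsilon> * (v - u)" by blast
    then show "\<exists>\<delta>>0. \<forall>u v. a \<le> u \<and> u \<le> v \<and> v \<le> t \<and> v - u < \<delta> \<longrightarrow> - \<theta> v - - \<theta> u \<le> \<epsilon> * (v - u)"
      using t(2) by (intro exI[of _ \<delta>]) (auto simp: abs_le_iff)
  qed
  ultimately show ?thesis by (simp add: \<theta>_def)
qed

text \<open>To first order the increment of the family \<open>\<Phi>\<close> is the tensor product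
  of the vector of values of \<open>f\<close> with the increment of \<open>g\<close>, and the
  Euclidean norm of a tensor product is the product of the norms. The function \<open>\<psi>\<close>
  stands for a primitive of the majorant \<open>\<phi>\<close>.\<close>

lemma L2_set_primitive_le:
  fixes f :: "'w \<Rightarrow> real \<Rightarrow> real" and g :: "'i \<Rightarrow> real \<Rightarrow> real"
  assumes fin: "finite F" "finite G"
    and P: "\<And>w i. w \<in> F \<Longrightarrow> i \<in> G \<Longrightarrow> RS_primitive (f w) (g i) a b (\<Phi> w i)"
    and zero: "\<And>w i. w \<in> F \<Longrightarrow> i \<in> G \<Longrightarrow> \<Phi> w i a = 0"
    and f: "\<And>u. a \<le> u \<Longrightarrow> u \<le> b \<Longrightarrow> L2_set (\<lambda>w. f w u) F \<le> \<phi> u"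
    and g: "\<And>u v. a \<le> u \<Longrightarrow> u \<le> v \<Longrightarrow> v \<le> b \<Longrightarrow> L2_set (\<lambda>i. g i v - g i u) G \<le> L * (v - u)"
    and \<psi>: "\<And>u v. a \<le> u \<Longrightarrow> u \<le> v \<Longrightarrow> v \<le> b \<Longrightarrow> \<phi> u * (v - u) \<le> \<psi> v - \<psi> u"
    and L: "L \<ge> 0" and t: "a \<le> t" "t \<le> b"
  shows "L2_set (\<lambda>(w, i). \<Phi> w i t) (F \<times> G) \<le> L * (\<psi> t - \<psi> a)"
proof -
  define \<theta> where "\<theta> s = L2_set (\<lambda>(w, i). \<Phi> w i s) (F \<times> G) - L * \<psi> s" for s
  have "\<theta> t \<le> \<theta> a"
  proof (rule nonincreasing_of_increments[OF _ t(1)])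
    fix \<epsilon> :: real assume "\<epsilon> > 0"
    \<comment> \<open>The remainders are added in absolute value over all pairs, hence the
      cardinality; the 1 covers the empty product.\<close>
    define \<epsilon>' where "\<epsilon>' = \<epsilon> / (card (F \<times> G) + 1)"
    have \<epsilon>': "\<epsilon>' > 0" using \<open>\<epsilon> > 0\<close> by (simp add: \<epsilon>'_def)
    define R where "R p u v = \<Phi> (fst p) (snd p) v - \<Phi> (fst p) (snd p) u -
      f (fst p) u * (g (snd p) v - g (snd p) u)" for p u v
    define good where "good p \<delta> \<longleftrightarrow> \<delta> > 0 \<and>
      (\<forall>u v. a \<le> u \<and> u \<le> v \<and> v \<le> b \<and> v - u < \<delta> \<longrightarrow> \<bar>R p u v\<bar> \<le> \<epsilon>' * (v - u))" for p \<delta>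
    have "\<forall>p\<in>F \<times> G. \<exists>\<delta>. good p \<delta>"
    proof
      fix p assume p: "p \<in> F \<times> G"
      then have "RS_primitive (f (fst p)) (g (snd p)) a b (\<Phi> (fst p) (snd p))" by (intro P) auto
      from RS_primitiveD[OF this \<epsilon>'] obtain \<delta> where "\<delta> > 0"
        "\<And>u \<xi> v. a \<le> u \<Longrightarrow> u \<le> \<xi> \<Longrightarrow> \<xi> \<le> v \<Longrightarrow> v \<le> b \<Longrightarrow> v - u < \<delta> \<Longrightarrow>
        \<bar>\<Phi> (fst p) (snd p) v - \<Phi> (fst p) (snd p) u - f (fst p) \<xi> * (g (snd p) v - g (snd p) u)\<bar> \<le> \<epsilon>' * (v - u)"
        by blast
      then have "good p \<delta>" unfolding good_def R_def by simp
      then show "\<exists>\<delta>. good p \<delta>" ..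
    qed
    from bchoice[OF this] obtain d' where d': "\<forall>p\<in>F \<times> G. good p (d' p)" by blast
    have d: "\<And>p. p \<in> F \<times> G \<Longrightarrow> d' p > 0"
      "\<And>p u v. p \<in> F \<times> G \<Longrightarrow> a \<le> u \<Longrightarrow> u \<le> v \<Longrightarrow> v \<le> b \<Longrightarrow> v - u < d' p \<Longrightarrow> \<bar>R p u v\<bar> \<le> \<epsilon>' * (v - u)"
      using bspec[OF d'] unfolding good_def by simp_all
    define \<delta> where "\<delta> = Min (insert 1 (d' ` (F \<times> G)))"
    have \<delta>: "\<delta> > 0" "\<And>p. p \<in> F \<times> G \<Longrightarrow> \<delta> \<le> d' p"
      using fin d(1) by (auto simp: \<delta>_def)
    have "\<theta> v - \<theta> u \<le> \<epsilon> * (v - u)" if uv: "a \<le> u" "u \<le> v" "v \<le> b" "v - u < \<delta>" for u v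
    proof -
      let ?\<Phi> = "\<lambda>s p. \<Phi> (fst p) (snd p) s"
      let ?m = "\<lambda>p. f (fst p) u * (g (snd p) v - g (snd p) u)"
      let ?r = "\<lambda>p. R p u v"
      have "L2_set (?\<Phi> v) (F \<times> G) = L2_set (\<lambda>p. ?\<Phi> u p + (?m p + ?r p)) (F \<times> G)"
        by (simp add: R_def)
      also have "\<dots> \<le> L2_set (?\<Phi> u) (F \<times> G) + (L2_set ?m (F \<times> G) + L2_set ?r (F \<times> G))"
        by (intro order_trans[OF L2_set_triangle_ineq] add_left_mono L2_set_triangle_ineq)
      also have "L2_set ?m (F \<times> G) = L2_set (\<lambda>w. f w u) F * L2_set (\<lambda>i. g i v - g i u) G"
        by (simp add: L2_set_def power_mult_distrib sum_product sum.cartesian_product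
            case_prod_unfold flip: real_sqrt_mult)
      also have "\<dots> \<le> \<phi> u * (L * (v - u))"
        using f[of u] g[OF uv(1-3)] order_trans[OF L2_set_nonneg f[of u]] uv
        by (intro mult_mono) auto
      also have "\<dots> \<le> L * (\<psi> v - \<psi> u)"
        using mult_left_mono[OF \<psi>[OF uv(1-3)] L] by (simp add: mult_ac)
      also have "L2_set ?r (F \<times> G) \<le> (\<Sum>p\<in>F \<times> G. \<bar>?r p\<bar>)" by (rule L2_set_le_sum_abs)
      also have "\<dots> \<le> (\<Sum>p\<in>F \<times> G. \<epsilon>' * (v - u))"
        using uv \<delta>(2) by (intro sum_mono d(2)) (auto intro: less_le_trans)
      also have "\<dots> = card (F \<times> G) / (card (F \<times> G) + 1) * (\<epsilon> * (v - u))"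
        by (simp add: \<epsilon>'_def)
      also have "\<dots> \<le> 1 * (\<epsilon> * (v - u))"
        using \<open>\<epsilon> > 0\<close> uv by (intro mult_right_mono) auto
      finally show ?thesis by (simp add: \<theta>_def case_prod_unfold algebra_simps)
    qed
    with \<delta>(1) t(2) show "\<exists>\<delta>>0. \<forall>u v. a \<le> u \<and> u \<le> v \<and> v \<le> t \<and> v - u < \<delta> \<longrightarrow> \<theta> v - \<theta> u \<le> \<epsilon> * (v - u)"
      by (intro exI[of _ \<delta>]) auto
  qed
  moreover have "L2_set (\<lambda>(w, i). \<Phi> w i a) (F \<times> G) = 0"
    using zero by (auto simp: L2_set_def intro!: sum.neutral)
  ultimately show ?thesis by (simp add: \<theta>_def algebra_simps)
qed


section \<open>Iterated integrals\<close>

text \<open>The recursion removes first letters, which belong to the outermost integrals, so it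
  mirrors the product rule; repeated interleavings are kept.\<close>

fun shuffle_list :: "'i list \<Rightarrow> 'i list \<Rightarrow> 'i list list" where
  "shuffle_list [] v = [v]"
| "shuffle_list u [] = [u]"
| "shuffle_list (i # u) (j # v) =
     map ((#) i) (shuffle_list u (j # v)) @ map ((#) j) (shuffle_list (i # u) v)"

lemma set_shuffle_list:
  "w \<in> set (shuffle_list u v) \<Longrightarrow> set w = set u \<union> set v"
  by (induction u v arbitrary: w rule: shuffle_list.induct) auto

locale lipschitz_coordinates =
  fixes a T :: real and X :: "nat \<Rightarrow> real \<Rightarrow> real"
  assumes aT: "a \<le> T"
    and lip: "\<exists>L. L-lipschitz_on {a..T} (X i)"
begin

abbreviation I where "I \<equiv> iterated_integral a X"

text \<open>Existence of a primitive is what gives the definite description in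
  \<open>RS_integral\<close> its value on [a,T]. The new integral is again continuous, so the step
  can be repeated along the word.\<close>

lemma RS_primitive_step:
  assumes "continuous_on {a..T} (I w)"
  shows "RS_primitive (I w) (X i) a T (I (i # w))" "continuous_on {a..T} (I (i # w))" "I (i # w) a = 0"
proof -
  obtain L where L: "L-lipschitz_on {a..T} (X i)" using lip by blast
  obtain \<Phi> where \<Phi>: "RS_primitive (I w) (X i) a T \<Phi>"
    using RS_primitive_exists[OF assms L aT] by blast
  have eq: "I (i # w) t = \<Phi> t - \<Phi> a" if "a \<le> t" "t \<le> T" for t
    using RS_integral_primitive[OF \<Phi> that] by simp
  show P: "RS_primitive (I w) (X i) a T (I (i # w))"
    by (rule RS_primitive_cong[OF refl refl _ \<Phi>, where c = "\<Phi> a"]) (use eq in simp)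
  show "continuous_on {a..T} (I (i # w))" by (rule RS_primitive_continuous_on[OF P assms L])
  show "I (i # w) a = 0" using eq[of a] aT by simp
qed

lemma continuous_on_iterated_integral: "continuous_on {a..T} (I w)"
proof (induction w)
  case Nil
  have "I [] = (\<lambda>t. 1)" by (simp add: fun_eq_iff)
  then show ?case by simp
next
  case (Cons i w)
  then show ?case by (rule RS_primitive_step(2))
qed

lemmas RS_primitive_iterated_integral = RS_primitive_step(1)[OF continuous_on_iterated_integral]
  and iterated_integral_Cons_at_start = RS_primitive_step(3)[OF continuous_on_iterated_integral]

text \<open>Product rule for the two outermost integrals. By the induction hypotheses both
  integrands are sums over shuffles, and at \<open>a\<close> every integral of a nonempty word
  vanishes.\<close>

theorem shuffle_product:
  "a \<le> t \<Longrightarrow> t \<le> T \<Longrightarrow> I u t * I v t = (\<Sum>w\<leftarrow>shuffle_list u v. I w t)"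
proof (induction u v arbitrary: t rule: shuffle_list.induct)
  case (3 i u j v)
  obtain L where L: "L-lipschitz_on {a..T} (X i)" using lip by blast
  let ?A = "\<lambda>t. \<Sum>w\<leftarrow>shuffle_list u (j # v). I (i # w) t"
  let ?B = "\<lambda>t. \<Sum>w\<leftarrow>shuffle_list (i # u) v. I (j # w) t"
  have A: "RS_primitive (\<lambda>s. I u s * I (j # v) s) (X i) a T ?A"
    by (rule RS_primitive_cong[OF _ refl _ RS_primitive_sum_list[OF RS_primitive_iterated_integral], where c = 0])
      (use 3(1) in auto)
  have B: "RS_primitive (\<lambda>s. I (i # u) s * I v s) (X j) a T ?B"
    by (rule RS_primitive_cong[OF _ refl _ RS_primitive_sum_list[OF RS_primitive_iterated_integral], where c = 0])
      (use 3(2) in auto)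
  have "I (i # u) t * I (j # v) t - I (i # u) a * I (j # v) a = (?A t - ?A a) + (?B t - ?B a)"
    by (rule RS_primitive_product[OF RS_primitive_iterated_integral RS_primitive_iterated_integral A B
        continuous_on_iterated_integral continuous_on_iterated_integral continuous_on_iterated_integral L 3(3,4)])
  moreover have "(\<Sum>w\<leftarrow>ws. I (k # w) a) = 0" for k ws
    by (induction ws) (simp_all only: list.map sum_list.Cons sum_list.Nil iterated_integral_Cons_at_start add_0)
  ultimately show ?case
    by (simp only: iterated_integral_Cons_at_start shuffle_list.simps map_append map_map comp_def sum_list_append)
qed simp_all

end

section \<open>Norm bounds for signatures\<close>

text \<open>Bessel's inequality; \<open>s\<close> is the orthogonal projection of \<open>z\<close>
  to the span of finitely many basis vectors.\<close>

lemma L2_set_inner_orthonormal_le: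
  fixes z :: "'e::real_inner"
  assumes "orthonormal_basis d e" "finite G" "G \<subseteq> index_set d"
  shows "L2_set (\<lambda>i. z \<bullet> e i) G \<le> norm z"
proof -
  have on: "e i \<bullet> e j = (if i = j then 1 else 0)" if "i \<in> G" "j \<in> G" for i j
    using assms(1,3) that unfolding orthonormal_basis_def by blast
  define s where "s = (\<Sum>i\<in>G. (z \<bullet> e i) *\<^sub>R e i)"
  have zs: "z \<bullet> s = (\<Sum>i\<in>G. (z \<bullet> e i)\<^sup>2)"
    by (simp add: s_def inner_sum_right power2_eq_square)
  have es: "e i \<bullet> s = z \<bullet> e i" if "i \<in> G" for i
  proof -
    have "e i \<bullet> s = (\<Sum>j\<in>G. if i = j then z \<bullet> e j else 0)"
      unfolding s_def inner_sum_right using on that by (intro sum.cong) auto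
    then show ?thesis using that assms(2) by simp
  qed
  have "s \<bullet> s = (\<Sum>i\<in>G. (z \<bullet> e i) * (e i \<bullet> s))"
    by (subst (1) s_def) (simp add: inner_sum_left)
  also have "\<dots> = (\<Sum>i\<in>G. (z \<bullet> e i)\<^sup>2)" by (simp add: es power2_eq_square)
  finally have ss: "s \<bullet> s = (\<Sum>i\<in>G. (z \<bullet> e i)\<^sup>2)" .
  have "0 \<le> (z - s) \<bullet> (z - s)" by simp
  also have "\<dots> = z \<bullet> z - (\<Sum>i\<in>G. (z \<bullet> e i)\<^sup>2)"
    by (simp add: inner_diff_left inner_diff_right inner_commute[of s z] zs ss)
  finally show ?thesis unfolding L2_set_def norm_eq_sqrt_inner by simp
qed

text \<open>The convex function with exponent n + 1 lies above its tangent at p.\<close>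

lemma power_Suc_increment:
  fixes p q :: real
  assumes "0 \<le> p" "p \<le> q"
  shows "real (Suc n) * p ^ n * (q - p) \<le> q ^ Suc n - p ^ Suc n"
proof (induction n)
  case (Suc n)
  have "real (Suc (Suc n)) * p ^ Suc n * (q - p) = p * (real (Suc n) * p ^ n * (q - p)) + p ^ Suc n * (q - p)"
    by (simp add: algebra_simps)
  also have "\<dots> \<le> p * (q ^ Suc n - p ^ Suc n) + p ^ Suc n * (q - p)"
    using Suc assms by (intro add_right_mono mult_left_mono) auto
  also have "\<dots> \<le> q * (q ^ Suc n - p ^ Suc n) + p ^ Suc n * (q - p)"
    using assms power_mono[of p q "Suc n"] by (intro add_right_mono mult_right_mono) auto
  also have "\<dots> = q ^ Suc (Suc n) - p ^ Suc (Suc n)" by (simp add: algebra_simps)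
  finally show ?case .
qed simp

text \<open>Supplies the majorant condition of \<open>L2_set_primitive_le\<close> for the factorial
  bounds of consecutive levels.\<close>

lemma power_fact_increment:
  fixes a u v c :: real
  assumes "a \<le> u" "u \<le> v" "0 \<le> c"
  shows "c * ((u - a) ^ n / fact n) * (v - u) \<le>
    c * ((v - a) ^ Suc n / fact (Suc n)) - c * ((u - a) ^ Suc n / fact (Suc n))"
proof -
  have "real (Suc n) * (u - a) ^ n * (v - u) \<le> (v - a) ^ Suc n - (u - a) ^ Suc n"
    using power_Suc_increment[of "u - a" "v - a" n] assms by simp
  then have "real (Suc n) * (u - a) ^ n * (v - u) / fact (Suc n) \<le>
      ((v - a) ^ Suc n - (u - a) ^ Suc n) / fact (Suc n)"
    by (intro divide_right_mono) auto
  also have "real (Suc n) * (u - a) ^ n * (v - u) / fact (Suc n) = (u - a) ^ n / fact n * (v - u)"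
    by (simp only: fact_Suc mult.assoc mult_divide_mult_cancel_left_if) simp
  finally have "c * ((u - a) ^ n / fact n * (v - u)) \<le>
      c * (((v - a) ^ Suc n - (u - a) ^ Suc n) / fact (Suc n))"
    using assms by (intro mult_left_mono)
  then show ?thesis by (simp only: mult.assoc diff_divide_distrib right_diff_distrib)
qed

text \<open>The rectangle of tails and heads may contain more words than \<open>F\<close>, which
  only enlarges the sum of squares; it has the product shape on which
  \<open>L2_set_primitive_le\<close> works.\<close>

lemma L2_set_Cons_le:
  fixes f :: "'i list \<Rightarrow> real"
  assumes "finite F" "\<And>w. w \<in> F \<Longrightarrow> w \<noteq> []"
  shows "L2_set f F \<le> L2_set (\<lambda>(w, i). f (i # w)) (tl ` F \<times> hd ` F)"
proof -
  have "inj_on (\<lambda>w. (tl w, hd w)) F"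
    using assms(2) by (intro inj_onI) (metis Pair_inject list.expand)
  then have "(\<Sum>w\<in>F. (f w)\<^sup>2) = (\<Sum>p\<in>(\<lambda>w. (tl w, hd w)) ` F. (f (snd p # fst p))\<^sup>2)"
    using assms(2) by (simp add: sum.reindex)
  also have "\<dots> \<le> (\<Sum>p\<in>tl ` F \<times> hd ` F. (f (snd p # fst p))\<^sup>2)"
    using assms(1) by (intro sum_mono2) auto
  finally show ?thesis by (simp add: L2_set_def case_prod_unfold)
qed

text \<open>Levels are joined by the triangle inequality, so their norms add up; in both uses the
  sum is bounded by an exponential series.\<close>

lemma L2_set_by_length_le:
  fixes f :: "'i list \<Rightarrow> real"
  assumes G: "finite G" and le: "\<And>n. L2_set f {w \<in> G. length w = n} \<le> c n"
    and c: "\<And>N. (\<Sum>n<N. c n) \<le> B"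
  shows "L2_set f G \<le> B"
proof -
  have "L2_set f {w \<in> G. length w < N} \<le> (\<Sum>n<N. c n)" for N
  proof (induction N)
    case (Suc N)
    have "{w \<in> G. length w < Suc N} = {w \<in> G. length w < N} \<union> {w \<in> G. length w = N}" by auto
    then have "L2_set f {w \<in> G. length w < Suc N} \<le>
        L2_set f {w \<in> G. length w < N} + L2_set f {w \<in> G. length w = N}"
      using L2_set_union_le[of "{w \<in> G. length w < N}" "{w \<in> G. length w = N}" f] G by simp
    then show ?case using Suc le[of N] by simp
  qed simp
  moreover obtain N where "\<forall>w\<in>G. length w < N"
    using finite_nat_set_iff_bounded[of "length ` G"] G by auto
  then have "{w \<in> G. length w < N} = G" by auto
  ultimately show ?thesis using c[of N] by (metis order_trans)
qed

lemma sum_exp_series_le: "0 \<le> z \<Longrightarrow> (\<Sum>n<N. z ^ n / fact n) \<le> exp (z::real)"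
  unfolding exp_def using summable_exp_generic[of z]
  by (subst scaleR_conv_of_real[abs_def])
    (auto intro!: sum_le_suminf simp: divide_inverse mult.commute)

lemma tl_hd_words:
  assumes "F \<subseteq> words d" "\<And>w. w \<in> F \<Longrightarrow> length w = Suc n"
  shows "tl ` F \<subseteq> words d" "\<And>w. w \<in> tl ` F \<Longrightarrow> length w = n" "hd ` F \<subseteq> index_set d"
proof -
  have "tl w \<in> words d \<and> length (tl w) = n \<and> hd w \<in> index_set d" if "w \<in> F" for w
    using subsetD[OF assms(1) that] assms(2)[OF that] by (cases w) (auto simp: words_def)
  then show "tl ` F \<subseteq> words d" "\<And>w. w \<in> tl ` F \<Longrightarrow> length w = n" "hd ` F \<subseteq> index_set d"
    by blast+
qed

locale lipschitz_path =
  fixes a T :: real and d :: enat and e :: "nat \<Rightarrow> 'e::real_inner" and x :: "real \<Rightarrow> 'e" and L :: real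
  assumes aT: "a \<le> T" and basis: "orthonormal_basis d e" and L: "0 \<le> L"
    and increment: "\<And>u v. a \<le> u \<Longrightarrow> u \<le> v \<Longrightarrow> v \<le> T \<Longrightarrow> norm (x v - x u) \<le> L * (v - u)"
begin

sublocale lipschitz_coordinates a T "\<lambda>i u. x u \<bullet> e i"
proof
  fix i
  have "\<bar>x u \<bullet> e i - x v \<bullet> e i\<bar> \<le> L * norm (e i) * \<bar>u - v\<bar>" if "u \<in> {a..T}" "v \<in> {a..T}" for u v
  proof -
    have "norm (x u - x v) \<le> L * \<bar>u - v\<bar>"
      using increment[of u v] increment[of v u] that by (cases "u \<le> v") (auto simp: norm_minus_commute)
    then have "norm (x u - x v) * norm (e i) \<le> L * \<bar>u - v\<bar> * norm (e i)"
      by (intro mult_right_mono) auto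
    then show ?thesis
      using Cauchy_Schwarz_ineq2[of "x u - x v" "e i"] by (simp add: inner_diff_left mult_ac)
  qed
  then show "\<exists>C. C-lipschitz_on {a..T} (\<lambda>u. x u \<bullet> e i)"
    using L by (intro exI[of _ "L * norm (e i)"] lipschitz_onI) (auto simp: dist_real_def)
qed (rule aT)

lemma L2_set_coordinate_increment:
  assumes "finite G" "G \<subseteq> index_set d" "a \<le> u" "u \<le> v" "v \<le> T"
  shows "L2_set (\<lambda>i. x v \<bullet> e i - x u \<bullet> e i) G \<le> L * (v - u)"
  using L2_set_inner_orthonormal_le[OF basis assms(1,2), of "x v - x u"] increment[OF assms(3-5)]
  by (simp add: inner_diff_left)

text \<open>One more integration costs the factor \<open>L\<close> and integrates the previous
  majorant, whence the factorial decay.\<close>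

lemma L2_set_iterated_integral_le:
  assumes "finite F" "F \<subseteq> words d" "\<And>w. w \<in> F \<Longrightarrow> length w = n" "a \<le> t" "t \<le> T"
  shows "L2_set (\<lambda>w. I w t) F \<le> L ^ n * ((t - a) ^ n / fact n)"
  using assms
proof (induction n arbitrary: F t)
  case 0
  then have "F \<subseteq> {[]}" by auto
  then have "F = {} \<or> F = {[]}" by auto
  then show ?case by auto
next
  case (Suc n)
  have ne: "w \<noteq> []" if "w \<in> F" for w using Suc.prems(3)[OF that] by auto
  let ?F = "tl ` F" and ?G = "hd ` F"
  have F: "finite ?F" "?F \<subseteq> words d" "\<And>w. w \<in> ?F \<Longrightarrow> length w = n"
    and G: "finite ?G" "?G \<subseteq> index_set d"
    using Suc.prems(1) tl_hd_words[OF Suc.prems(2,3)] by simp_all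
  have "L2_set (\<lambda>w. I w t) F \<le> L2_set (\<lambda>(w, i). I (i # w) t) (?F \<times> ?G)"
    using L2_set_Cons_le[OF Suc.prems(1) ne] .
  also have "\<dots> \<le> L * (L ^ n * ((t - a) ^ Suc n / fact (Suc n)) - L ^ n * ((a - a) ^ Suc n / fact (Suc n)))"
  proof (rule L2_set_primitive_le[OF F(1) G(1) RS_primitive_iterated_integral
        iterated_integral_Cons_at_start _ _ _ L Suc.prems(4,5)])
    show "L2_set (\<lambda>w. I w u) ?F \<le> L ^ n * ((u - a) ^ n / fact n)" if "a \<le> u" "u \<le> T" for u
      by (rule Suc.IH[OF F that])
    show "L ^ n * ((u - a) ^ n / fact n) * (v - u) \<le>
        L ^ n * ((v - a) ^ Suc n / fact (Suc n)) - L ^ n * ((u - a) ^ Suc n / fact (Suc n))"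
      if "a \<le> u" "u \<le> v" "v \<le> T" for u v
      using that L by (intro power_fact_increment) auto
  qed (rule L2_set_coordinate_increment[OF G])
  also have "\<dots> = L ^ Suc n * ((t - a) ^ Suc n / fact (Suc n))" by simp
  finally show ?case .
qed

lemma L2_set_iterated_integral_le_exp:
  assumes "finite G" "G \<subseteq> words d"
  shows "L2_set (\<lambda>w. I w T) G \<le> exp (L * (T - a))"
proof (rule L2_set_by_length_le[OF assms(1)])
  fix n
  have "L2_set (\<lambda>w. I w T) {w \<in> G. length w = n} \<le> L ^ n * ((T - a) ^ n / fact n)"
    by (rule L2_set_iterated_integral_le) (use assms aT in auto)
  then show "L2_set (\<lambda>w. I w T) {w \<in> G. length w = n} \<le> (L * (T - a)) ^ n / fact n"
    by (simp add: power_mult_distrib)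
next
  fix N
  show "(\<Sum>n<N. (L * (T - a)) ^ n / fact n) \<le> exp (L * (T - a))"
    using L aT by (intro sum_exp_series_le) auto
qed

end

text \<open>The bound \<open>\<eta>\<close> is a Lipschitz constant of the difference path; later it
  is the distance \<open>lip_dist a T x y\<close>.\<close>

locale lipschitz_path_pair =
  x: lipschitz_path a T d e x L + y: lipschitz_path a T d e y L
  for a T :: real and d :: enat and e :: "nat \<Rightarrow> 'e::real_inner" and x y :: "real \<Rightarrow> 'e" and L :: real +
  fixes \<eta> :: real
  assumes \<eta>: "0 \<le> \<eta>"
    and close: "\<And>u v. a \<le> u \<Longrightarrow> u \<le> v \<Longrightarrow> v \<le> T \<Longrightarrow> norm ((x v - y v) - (x u - y u)) \<le> \<eta> * (v - u)"
begin

sublocale diff: lipschitz_path a T d e "\<lambda>u. x u - y u" \<eta>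
  using x.aT x.basis \<eta> close by unfold_locales auto

text \<open>Telescoping: \<open>I\<^sub>x dx - I\<^sub>y dy = (I\<^sub>x - I\<^sub>y) dx + I\<^sub>y d(x - y)\<close>.\<close>

lemma L2_set_iterated_integral_diff_le:
  assumes "finite F" "F \<subseteq> words d" "\<And>w. w \<in> F \<Longrightarrow> length w = n" "a \<le> t" "t \<le> T"
  shows "L2_set (\<lambda>w. x.I w t - y.I w t) F \<le> \<eta> * (real n * L ^ (n - 1)) * ((t - a) ^ n / fact n)"
  using assms
proof (induction n arbitrary: F t)
  case 0
  then have "F \<subseteq> {[]}" by auto
  then have "F = {} \<or> F = {[]}" by auto
  then show ?case by auto
next
  case (Suc n)
  have ne: "w \<noteq> []" if "w \<in> F" for w using Suc.prems(3)[OF that] by auto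
  let ?F = "tl ` F" and ?G = "hd ` F"
  have F: "finite ?F" "?F \<subseteq> words d" "\<And>w. w \<in> ?F \<Longrightarrow> length w = n"
    and G: "finite ?G" "?G \<subseteq> index_set d"
    using Suc.prems(1) tl_hd_words[OF Suc.prems(2,3)] by simp_all
  \<comment> \<open>The factor n counts the places at which x can be exchanged for y. The recursion
    is \<open>L * c + \<eta> * L ^ n\<close> for the next level; at n = 0 the truncated exponent is
    harmless since the factor n is 0.\<close>
  define c where "c = \<eta> * (real n * L ^ (n - 1))"
  have c: "0 \<le> c" using \<eta> x.L by (simp add: c_def)
  \<comment> \<open>The mixed integral, of the iterated integral of y against x, is the intermediate
    term of the telescoping.\<close>
  have "\<exists>J. RS_primitive (y.I w) (\<lambda>u. x u \<bullet> e i) a T J \<and> J a = 0" for w i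
  proof -
    obtain C where "C-lipschitz_on {a..T} (\<lambda>u. x u \<bullet> e i)"
      using x.lipschitz_coordinates_axioms unfolding lipschitz_coordinates_def by blast
    then obtain J where J: "RS_primitive (y.I w) (\<lambda>u. x u \<bullet> e i) a T J"
      using RS_primitive_exists[OF y.continuous_on_iterated_integral _ x.aT] by blast
    have "RS_primitive (y.I w) (\<lambda>u. x u \<bullet> e i) a T (\<lambda>u. J u - J a)"
      by (rule RS_primitive_cong[OF refl refl _ J, where c = "J a"]) simp
    then show ?thesis by (intro exI[of _ "\<lambda>u. J u - J a"]) simp
  qed
  then obtain J where J: "\<And>w i. RS_primitive (y.I w) (\<lambda>u. x u \<bullet> e i) a T (J w i)" "\<And>w i. J w i a = 0"
    by metis
  define A where "A w i u = x.I (i # w) u - J w i u" for w i u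
  define B where "B w i u = J w i u - y.I (i # w) u" for w i u
  have A: "RS_primitive (\<lambda>u. x.I w u - y.I w u) (\<lambda>u. x u \<bullet> e i) a T (A w i)" "A w i a = 0" for w i
    using RS_primitive_diff[OF x.RS_primitive_iterated_integral[of w i] J(1)[of w i]]
    by (simp_all add: A_def[abs_def] J(2) x.iterated_integral_Cons_at_start del: iterated_integral.simps)
  have B: "RS_primitive (y.I w) (\<lambda>u. (x u - y u) \<bullet> e i) a T (B w i)" "B w i a = 0" for w i
    using RS_primitive_diff_integrator[OF J(1)[of w i] y.RS_primitive_iterated_integral[of w i]]
    by (simp_all add: B_def[abs_def] J(2) y.iterated_integral_Cons_at_start inner_diff_left del: iterated_integral.simps)
  have boundA: "L2_set (\<lambda>(w, i). A w i t) (?F \<times> ?G) \<le>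
      L * (c * ((t - a) ^ Suc n / fact (Suc n)) - c * ((a - a) ^ Suc n / fact (Suc n)))"
  proof (rule L2_set_primitive_le[OF F(1) G(1) A(1) A(2) _ _ _ x.L Suc.prems(4,5)])
    show "L2_set (\<lambda>w. x.I w u - y.I w u) ?F \<le> c * ((u - a) ^ n / fact n)" if "a \<le> u" "u \<le> T" for u
      unfolding c_def by (rule Suc.IH[OF F that])
    show "c * ((u - a) ^ n / fact n) * (v - u) \<le>
        c * ((v - a) ^ Suc n / fact (Suc n)) - c * ((u - a) ^ Suc n / fact (Suc n))"
      if "a \<le> u" "u \<le> v" "v \<le> T" for u v
      using that c by (intro power_fact_increment)
  qed (rule x.L2_set_coordinate_increment[OF G])
  have boundB: "L2_set (\<lambda>(w, i). B w i t) (?F \<times> ?G) \<le>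
      \<eta> * (L ^ n * ((t - a) ^ Suc n / fact (Suc n)) - L ^ n * ((a - a) ^ Suc n / fact (Suc n)))"
  proof (rule L2_set_primitive_le[OF F(1) G(1) B(1) B(2) _ _ _ \<eta> Suc.prems(4,5)])
    show "L2_set (\<lambda>w. y.I w u) ?F \<le> L ^ n * ((u - a) ^ n / fact n)" if "a \<le> u" "u \<le> T" for u
      by (rule y.L2_set_iterated_integral_le[OF F that])
    show "L ^ n * ((u - a) ^ n / fact n) * (v - u) \<le>
        L ^ n * ((v - a) ^ Suc n / fact (Suc n)) - L ^ n * ((u - a) ^ Suc n / fact (Suc n))"
      if "a \<le> u" "u \<le> v" "v \<le> T" for u v
      using that x.L by (intro power_fact_increment) auto
  qed (rule diff.L2_set_coordinate_increment[OF G])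
  have "L2_set (\<lambda>w. x.I w t - y.I w t) F \<le> L2_set (\<lambda>(w, i). x.I (i # w) t - y.I (i # w) t) (?F \<times> ?G)"
    using L2_set_Cons_le[OF Suc.prems(1) ne] .
  also have "\<dots> = L2_set (\<lambda>p. (case p of (w, i) \<Rightarrow> A w i t) + (case p of (w, i) \<Rightarrow> B w i t)) (?F \<times> ?G)"
    by (simp add: A_def B_def case_prod_unfold del: iterated_integral.simps)
  also have "\<dots> \<le> L2_set (\<lambda>(w, i). A w i t) (?F \<times> ?G) + L2_set (\<lambda>(w, i). B w i t) (?F \<times> ?G)"
    by (rule L2_set_triangle_ineq)
  also have "\<dots> \<le> L * (c * ((t - a) ^ Suc n / fact (Suc n)) - c * ((a - a) ^ Suc n / fact (Suc n))) +
      \<eta> * (L ^ n * ((t - a) ^ Suc n / fact (Suc n)) - L ^ n * ((a - a) ^ Suc n / fact (Suc n)))"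
    by (rule add_mono[OF boundA boundB])
  also have "\<dots> = (L * c + \<eta> * L ^ n) * ((t - a) ^ Suc n / fact (Suc n))"
    by (simp only: diff_self power_0_Suc div_0 mult_zero_right diff_zero distrib_right mult.assoc)
  also have "L * c + \<eta> * L ^ n = \<eta> * (real (Suc n) * L ^ (Suc n - 1))"
    by (cases n) (simp_all add: c_def algebra_simps)
  finally show ?case .
qed

lemma L2_set_iterated_integral_diff_le_exp:
  assumes "finite G" "G \<subseteq> words d"
  shows "L2_set (\<lambda>w. x.I w T - y.I w T) G \<le> (T - a) * exp (L * (T - a)) * \<eta>"
proof (rule L2_set_by_length_le[OF assms(1)])
  fix n
  show "L2_set (\<lambda>w. x.I w T - y.I w T) {w \<in> G. length w = n} \<le>
      \<eta> * (real n * L ^ (n - 1)) * ((T - a) ^ n / fact n)"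
    by (rule L2_set_iterated_integral_diff_le) (use assms x.aT in auto)
next
  fix N
  let ?c = "\<lambda>n. \<eta> * (real n * L ^ (n - 1)) * ((T - a) ^ n / fact n)"
  have z: "0 \<le> L * (T - a)" using x.L x.aT by simp
  \<comment> \<open>The factor n cancels against the factorial. As the term at 0 vanishes, an index
    shift leaves the exponential series.\<close>
  have c_Suc: "?c (Suc n) = \<eta> * (T - a) * ((L * (T - a)) ^ n / fact n)" for n
  proof -
    have "real (Suc n) * ((T - a) ^ Suc n / fact (Suc n)) = (T - a) * ((T - a) ^ n / fact n)"
      by (simp only: fact_Suc times_divide_eq_right mult_divide_mult_cancel_left_if power_Suc) simp
    then have "\<eta> * L ^ n * (real (Suc n) * ((T - a) ^ Suc n / fact (Suc n))) =
        \<eta> * L ^ n * ((T - a) * ((T - a) ^ n / fact n))"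
      by (simp only:)
    then show ?thesis by (simp only: diff_Suc_1 power_mult_distrib mult_ac times_divide_eq_right times_divide_eq_left)
  qed
  have "(\<Sum>n<Suc N. ?c n) = (\<Sum>n<N. \<eta> * (T - a) * ((L * (T - a)) ^ n / fact n))"
    unfolding sum.lessThan_Suc_shift c_Suc by simp
  also have "\<dots> = \<eta> * (T - a) * (\<Sum>n<N. (L * (T - a)) ^ n / fact n)"
    by (simp only: sum_distrib_left)
  also have "\<dots> \<le> \<eta> * (T - a) * exp (L * (T - a))"
    using \<eta> x.aT by (intro mult_left_mono sum_exp_series_le z) auto
  finally have "(\<Sum>n<Suc N. ?c n) \<le> (T - a) * exp (L * (T - a)) * \<eta>" by (simp only: mult_ac)
  moreover have "(\<Sum>n<N. ?c n) \<le> (\<Sum>n<Suc N. ?c n)"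
    using \<eta> x.L x.aT by (intro sum_mono2) auto
  ultimately show "(\<Sum>n<N. ?c n) \<le> (T - a) * exp (L * (T - a)) * \<eta>" by linarith
qed

end

section \<open>The signature map on a compact set of Lipschitz paths\<close>

lemma lip_dist_increment_le:
  fixes x y :: "real \<Rightarrow> 'e::real_inner"
  assumes xy: "x \<in> lip_paths a T" "y \<in> lip_paths a T" and uv: "a \<le> u" "u \<le> v" "v \<le> T"
  shows "norm ((x v - y v) - (x u - y u)) \<le> lip_dist a T x y * (v - u)"
proof (cases "u = v")
  case False
  let ?P = "{(s, t). s \<in> {a..T} \<and> t \<in> {a..T} \<and> s \<noteq> t}"
  let ?q = "\<lambda>(s, t). norm ((x t - y t) - (x s - y s)) / \<bar>t - s\<bar>"
  obtain M N where M: "M-lipschitz_on {a..T} x" and N: "N-lipschitz_on {a..T} y"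
    using xy by (auto simp: lip_paths_def)
  have "?q p \<le> M + N" if "p \<in> ?P" for p
  proof -
    obtain s t where p: "p = (s, t)" by (cases p)
    have st: "s \<in> {a..T}" "t \<in> {a..T}" "s \<noteq> t" using that p by auto
    have "norm ((x t - y t) - (x s - y s)) \<le> norm (x t - x s) + norm (y t - y s)"
      using norm_triangle_ineq4[of "x t - x s" "y t - y s"] by (simp add: algebra_simps)
    also have "\<dots> \<le> (M + N) * \<bar>t - s\<bar>"
      using lipschitz_onD[OF M st(2,1)] lipschitz_onD[OF N st(2,1)]
      by (simp add: dist_norm algebra_simps)
    finally show ?thesis using st by (simp add: p divide_le_eq)
  qed
  then have "bdd_above (?q ` ?P)" by (rule bdd_aboveI2)
  then have "?q (u, v) \<le> (SUP p\<in>?P. ?q p)"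
    by (intro cSUP_upper) (use uv False in auto)
  also have "\<dots> \<le> lip_dist a T x y" using xy by (simp add: lip_dist_def lip_norm_def)
  finally show ?thesis using uv False by (simp add: divide_le_eq)
qed simp

text \<open>\<open>tensor_norm\<close> sums level by level, the norm of \<open>ell2\<close> over all
  lists at once; square-summability lets the sums be regrouped.\<close>

lemma tensor_norm_coord:
  assumes "\<And>w. w \<notin> words d \<Longrightarrow> coord z w = 0"
  shows "tensor_norm d (coord z) = norm z"
proof -
  let ?f = "\<lambda>w. (coord z w)\<^sup>2"
  have "(?f has_sum (norm z)\<^sup>2) UNIV"
    unfolding norm_ell2_sq by (rule has_sum_infsum[OF summable_coord_sq])
  then have "((\<lambda>p. ?f (snd p)) has_sum (norm z)\<^sup>2) (SIGMA n:UNIV. {w :: nat list. length w = n})"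
    using has_sum_reindex_bij_betw[OF bij_betw_by_length, of ?f] by blast
  then have "((\<lambda>n. \<Sum>\<^sub>\<infinity>w\<in>{w. length w = n}. ?f w) has_sum (norm z)\<^sup>2) UNIV"
    by (rule has_sum_SigmaD) (simp add: has_sum_infsum summable_coord_sq)
  then have "(\<lambda>n. \<Sum>\<^sub>\<infinity>w\<in>{w. length w = n}. ?f w) sums (norm z)\<^sup>2"
    by (rule has_sum_imp_sums)
  moreover have "(\<Sum>\<^sub>\<infinity>w\<in>{w \<in> words d. length w = n}. coord z w * coord z w) =
      (\<Sum>\<^sub>\<infinity>w\<in>{w. length w = n}. ?f w)" for n
    using assms by (intro infsum_cong_neutral) (auto simp: power2_eq_square)
  ultimately have "tensor_inner d (coord z) (coord z) = (norm z)\<^sup>2"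
    unfolding tensor_inner_def by (simp add: sums_iff)
  then show ?thesis by (simp add: tensor_norm_def)
qed

lemma rkhs_cong:
  assumes "rkhs P k H ip" and eq: "\<And>x y. x \<in> P \<Longrightarrow> y \<in> P \<Longrightarrow> k x y = k' x y"
  shows "rkhs P k' H ip"
proof -
  interpret rkhs P k H ip by fact
  have ker: "(\<lambda>y\<in>P. k' y x) = (\<lambda>y\<in>P. k y x)" if "x \<in> P" for x
    using eq that by (intro restrict_ext) simp
  show ?thesis
    by unfold_locales
      (fact extensional zero add scale ip_commute ip_add ip_scale ip_nonneg ip_eq_0 complete |
        simp add: ker kernel_mem | simp add: ker reproducing[symmetric])+
qed

text \<open>Only values at points of the space matter. This permits replacing expected signatures by
  means, an identity shown for Borel probability measures alone.\<close>

lemma universal_kernel_cong: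
  assumes "universal_kernel Z k"
    and eq: "\<And>x y. x \<in> topspace Z \<Longrightarrow> y \<in> topspace Z \<Longrightarrow> k x y = k' x y"
  shows "universal_kernel Z k'"
  using assms(1) rkhs_cong[of _ k _ _ k'] rkhs_cong[of _ k' _ _ k] eq
  unfolding universal_kernel_def by (metis (no_types, lifting))

section \<open>The signature as a feature map on a compact set of paths\<close>

locale compact_path_set =
  fixes a T :: real and d :: enat
    and e :: "nat \<Rightarrow> 'e::{real_inner, banach, second_countable_topology}"
    and X :: "(real \<Rightarrow> 'e) set"
  assumes aT: "a < T"
    and basis: "orthonormal_basis d e"
    and compact_X: "compactin (path_topology a T) X"
    and separated: "\<And>x y. \<lbrakk>x \<in> X; y \<in> X; x \<noteq> y\<rbrakk> \<Longrightarrow> \<not> tree_like_equivalent a T d e x y"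
begin

abbreviation Z where "Z \<equiv> subtopology (path_topology a T) X"
abbreviation Sig where "Sig \<equiv> signature a T d e"

interpretation M: Metric_space "lip_paths a T :: (real \<Rightarrow> 'e) set" "lip_dist a T"
  by (rule Metric_space_lip_paths[OF aT])

lemma X_subset: "X \<subseteq> lip_paths a T"
  using compactin_subset_topspace[OF compact_X] by (simp add: path_topology_def)

lemma topspace_Z: "topspace Z = X"
  using X_subset by (auto simp: path_topology_def)

text \<open>A compact set stays within bounded distance of one of its paths \<open>c\<close>; the
  Lipschitz constant of \<open>c\<close> plus that bound serves all of \<open>X\<close>.\<close>

lemma uniformly_Lipschitz:
  obtains L where "0 \<le> L" "\<And>x. x \<in> X \<Longrightarrow> lipschitz_path a T d e x L"
proof (cases "X = {}")
  case True
  then show thesis using that[of 0] by simp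
next
  case False
  then obtain c where c: "c \<in> X" by blast
  obtain B where B: "\<And>x. x \<in> X \<Longrightarrow> lip_dist a T x c \<le> B"
    using M.compactin_imp_mbounded[of X] compact_X c unfolding path_topology_def M.mbounded_alt by blast
  obtain N where N: "N-lipschitz_on {a..T} c" using c X_subset by (auto simp: lip_paths_def)
  have N0: "0 \<le> N" using N by (rule lipschitz_on_nonneg)
  have B0: "0 \<le> B" using B[OF c] M.nonneg[of c c] by linarith
  have "lipschitz_path a T d e x (B + N)" if x: "x \<in> X" for x
  proof
    fix u v assume uv: "a \<le> u" "u \<le> v" "v \<le> T"
    have "norm (x v - x u) \<le> norm ((x v - c v) - (x u - c u)) + norm (c v - c u)"
      using norm_triangle_ineq[of "(x v - c v) - (x u - c u)" "c v - c u"] by (simp add: algebra_simps)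
    also have "norm ((x v - c v) - (x u - c u)) \<le> lip_dist a T x c * (v - u)"
      using x c X_subset uv by (intro lip_dist_increment_le) auto
    also have "\<dots> \<le> B * (v - u)" using B[OF x] uv by (intro mult_right_mono) auto
    also have "norm (c v - c u) \<le> N * (v - u)"
      using lipschitz_onD[OF N, of v u] uv by (simp add: dist_norm)
    finally show "norm (x v - x u) \<le> (B + N) * (v - u)" by (simp add: distrib_right)
  qed (use aT basis B0 N0 in auto)
  then show thesis using that[of "B + N"] B0 N0 by simp
qed

text \<open>Iterated integrals take words with the outermost letter first, signatures take them
  reversed; reversal only reindexes the sum of squares.\<close>

lemma L2_set_signature:
  "L2_set (\<lambda>w. Sig x w - Sig y w) G = L2_set (\<lambda>w. iterated_integral a (\<lambda>i u. x u \<bullet> e i) w T -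
      iterated_integral a (\<lambda>i u. y u \<bullet> e i) w T) (rev ` (G \<inter> words d))" (is ?A)
  "L2_set (Sig x) G = L2_set (\<lambda>w. iterated_integral a (\<lambda>i u. x u \<bullet> e i) w T) (rev ` (G \<inter> words d))" (is ?B)
  if "finite G"
proof -
  have sum: "(\<Sum>w\<in>G. f w) = (\<Sum>w\<in>rev ` (G \<inter> words d). f (rev w))"
    if "\<And>w. w \<notin> words d \<Longrightarrow> f w = 0" for f :: "nat list \<Rightarrow> real"
  proof -
    have "(\<Sum>w\<in>G. f w) = (\<Sum>w\<in>G \<inter> words d. f w)"
      using \<open>finite G\<close> that by (intro sum.mono_neutral_right) auto
    also have "\<dots> = (\<Sum>w\<in>rev ` (G \<inter> words d). f (rev w))"
      by (subst sum.reindex) (auto simp: inj_on_def)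
    finally show ?thesis .
  qed
  have rev: "rev w \<in> words d" if "w \<in> rev ` (G \<inter> words d)" for w using that by auto
  show ?A ?B
    unfolding L2_set_def using rev
    by (subst sum, simp add: signature_def, simp add: signature_def cong: sum.cong)+
qed

lemma rev_words: "rev ` (G \<inter> words d) \<subseteq> words d"
  by (auto simp: words_def)

definition S where "S x = Ell2 (Sig x)"

lemma coord_S:
  assumes "x \<in> X"
  shows "coord (S x) = Sig x"
proof -
  obtain L where "lipschitz_path a T d e x L" using uniformly_Lipschitz assms by blast
  then interpret lipschitz_path a T d e x L .
  have "L2_set (Sig x) G \<le> exp (L * (T - a))" if "finite G" for G
    unfolding L2_set_signature(2)[OF that]
    by (rule L2_set_iterated_integral_le_exp) (use that rev_words in auto)
  then show ?thesis unfolding S_def by (rule coord_Ell2_finite_bound)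
qed

lemma norm_S_diff_le:
  "\<exists>K\<ge>0. \<forall>x\<in>X. \<forall>y\<in>X. norm (S x - S y) \<le> K * lip_dist a T x y"
proof -
  obtain L where L: "0 \<le> L" "\<And>x. x \<in> X \<Longrightarrow> lipschitz_path a T d e x L"
    using uniformly_Lipschitz by blast
  have "norm (S x - S y) \<le> (T - a) * exp (L * (T - a)) * lip_dist a T x y"
    if xy: "x \<in> X" "y \<in> X" for x y
  proof -
    interpret x: lipschitz_path a T d e x L by (rule L(2)[OF xy(1)])
    interpret y: lipschitz_path a T d e y L by (rule L(2)[OF xy(2)])
    interpret lipschitz_path_pair a T d e x y L "lip_dist a T x y"
      using xy X_subset by unfold_locales (auto intro!: lip_dist_increment_le)
    show ?thesis
    proof (rule norm_ell2_leI)
      fix G :: "nat list set" assume G: "finite G"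
      show "L2_set (coord (S x - S y)) G \<le> (T - a) * exp (L * (T - a)) * lip_dist a T x y"
        unfolding coord_diff coord_S[OF xy(1)] coord_S[OF xy(2)] L2_set_signature(1)[OF G]
        by (rule L2_set_iterated_integral_diff_le_exp) (use G rev_words in auto)
    qed
  qed
  then show ?thesis using aT by (intro exI[of _ "(T - a) * exp (L * (T - a))"]) auto
qed

lemma continuous_map_S: "continuous_map Z euclidean S"
proof -
  obtain K where K: "0 \<le> K" "\<And>x y. x \<in> X \<Longrightarrow> y \<in> X \<Longrightarrow> norm (S x - S y) \<le> K * lip_dist a T x y"
    using norm_S_diff_le by blast
  have "openin Z {x \<in> X. S x \<in> U}" if "open U" for U
    unfolding openin_subopen[of Z "{x \<in> X. S x \<in> U}"]
  proof
    fix x assume x: "x \<in> {x \<in> X. S x \<in> U}"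
    then obtain r where r: "r > 0" "ball (S x) r \<subseteq> U" using \<open>open U\<close> open_contains_ball by blast
    \<comment> \<open>The denominator is \<open>K + 1\<close> because \<open>K\<close> may be
      0.\<close>
    have "S y \<in> U" if y: "y \<in> X" "lip_dist a T x y < r / (K + 1)" for y
    proof -
      have "norm (S x - S y) \<le> K * lip_dist a T x y" using x y by (intro K(2)) auto
      also have "\<dots> \<le> (K + 1) * lip_dist a T x y" by (intro mult_right_mono) auto
      also have "\<dots> < r" using y(2) K(1) by (simp add: field_simps)
      finally show ?thesis using r(2) by (auto simp: dist_norm)
    qed
    then show "\<exists>V. openin Z V \<and> x \<in> V \<and> V \<subseteq> {x \<in> X. S x \<in> U}"
      using x r(1) K(1) X_subset
      by (intro exI[of _ "X \<inter> M.mball x (r / (K + 1))"] conjI)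
        (auto simp: path_topology_def intro!: openin_subtopology_Int2)
  qed
  then show ?thesis unfolding continuous_map_def topspace_Z by simp
qed

text \<open>The shuffle identity holds for reversed words, so both words are reversed before
  shuffling and the results are reversed back.\<close>

lemma signature_product:
  assumes "x \<in> X" "u \<in> words d" "v \<in> words d"
  shows "Sig x u * Sig x v = (\<Sum>w\<leftarrow>map rev (shuffle_list (rev u) (rev v)). Sig x w)"
proof -
  obtain L where "lipschitz_path a T d e x L" using uniformly_Lipschitz assms by blast
  then interpret lipschitz_path a T d e x L .
  have w: "rev w \<in> words d" if "w \<in> set (shuffle_list (rev u) (rev v))" for w
    using set_shuffle_list[OF that] assms by (auto simp: words_def lists_eq_set)
  have "Sig x u * Sig x v = (\<Sum>w\<leftarrow>shuffle_list (rev u) (rev v). I w T)"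
    using assms shuffle_product[of T "rev u" "rev v"] aT by (simp add: signature_def)
  also have "\<dots> = (\<Sum>w\<leftarrow>shuffle_list (rev u) (rev v). Sig x (rev w))"
    using w by (intro arg_cong[of _ _ sum_list] map_cong refl) (simp add: signature_def)
  finally show ?thesis by (simp add: comp_def)
qed

sublocale compact_feature Z S
proof
  show "compact_space Z" by (rule compact_space_subtopology[OF compact_X])
  show "continuous_map Z euclidean S" by (rule continuous_map_S)
  show "inj_on S (topspace Z)"
    unfolding topspace_Z
  proof (rule inj_onI, rule ccontr)
    fix x y assume "x \<in> X" "y \<in> X" "S x = S y" "x \<noteq> y"
    then show False using separated coord_S unfolding tree_like_equivalent_def by metis
  qed
  show "\<exists>w. \<forall>x\<in>topspace Z. coord (S x) w = 1"
    unfolding topspace_Z by (intro exI[of _ "[]"]) (simp add: coord_S signature_def words_def)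
  show "\<exists>ws. \<forall>x\<in>topspace Z. coord (S x) u * coord (S x) v = (\<Sum>w\<leftarrow>ws. coord (S x) w)" for u v
  proof (cases "u \<in> words d \<and> v \<in> words d")
    case True
    then show ?thesis
      unfolding topspace_Z
      by (intro exI[of _ "map rev (shuffle_list (rev u) (rev v))"]) (simp add: coord_S signature_product del: map_map)
  next
    case False
    then show ?thesis
      \<comment> \<open>If one of the indices is not a word, its coordinate is 0, and the empty sum
        represents the product.\<close>
      unfolding topspace_Z by (intro exI[of _ "[]"]) (auto simp: coord_S signature_def)
  qed
qed

lemma coord_mean_S:
  assumes "\<mu> \<in> borel_probs Z"
  shows "coord (mean S \<mu>) = expected_signature a T d e \<mu>"
proof
  fix w
  have "coord (mean S \<mu>) w = (\<integral>x. Sig x w \<partial>\<mu>)"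
    unfolding coord_mean[OF assms]
    by (intro Bochner_Integration.integral_cong) (auto simp: borel_probsD(2)[OF assms] topspace_Z coord_S)
  then show "coord (mean S \<mu>) w = expected_signature a T d e \<mu> w"
    by (simp add: expected_signature_def signature_def)
qed

end

theorem theorem3p3:
  fixes a T \<sigma> :: real and d :: enat
    and e :: "nat \<Rightarrow> 'e::{real_inner, banach, second_countable_topology}"
    and X :: "(real \<Rightarrow> 'e) set"
  assumes "0 \<le> a" and "a < T"
    and "orthonormal_basis d e"
    and "compactin (path_topology a T) X"
    and "\<And>x y. \<lbrakk>x \<in> X; y \<in> X; x \<noteq> y\<rbrakk> \<Longrightarrow> \<not> tree_like_equivalent a T d e x y"
    and "\<sigma> > 0"
  shows "universal_kernel (weak_topology (subtopology (path_topology a T) X))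
    (\<lambda>\<mu> \<nu>. exp (- (\<sigma>\<^sup>2) * (tensor_norm d
       (\<lambda>w. expected_signature a T d e \<mu> w - expected_signature a T d e \<nu> w))\<^sup>2))"
proof -
  interpret compact_path_set a T d e X
    by unfold_locales (use assms in auto)
  have "tensor_norm d (\<lambda>w. expected_signature a T d e \<mu> w - expected_signature a T d e \<nu> w) =
      norm (mean S \<mu> - mean S \<nu>)" if "\<mu> \<in> P" "\<nu> \<in> P" for \<mu> \<nu>
    using tensor_norm_coord[of d "mean S \<mu> - mean S \<nu>"] that
    by (simp add: coord_mean_S) (simp add: expected_signature_def)
  then show ?thesis
    by (intro universal_kernel_cong[OF universal_kernel_gauss_mean[OF \<open>\<sigma> > 0\<close>]]) simp
qed

end
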